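(* Let $a<-1$ and let $f$, $\Sigma$, $\Sigma'$, $R(w)$ and $\Omega$ be as in the context. For each $w\in\Sigma'$ the set $R(w)$ consists of a single point, and the assignment $w\mapsto R(w)$ gives a homeomorphism between $\Sigma'$ and $\Omega\cap\mathbf R^2$.
   Context: Fix a real number $a<-1$. Let $\overline{\mathbf R^2}=(\mathbf R\cup\{\infty\})\times(\mathbf R\cup\{\infty\})$, with $+\infty$ and $-\infty$ identified to $\infty$ in each factor. The birational map $f(x,y)=\left(y\frac{x+a}{x-1},\,x+a-1\right)$, with inverse $f^{-1}(x,y)=\left(y+1-a,\,x\frac{y-a}{y+1}\right)$, extends continuously to $\overline{\mathbf R^2}\setminus I(f)$, resp. $\overline{\mathbf R^2}\setminus I(f^{-1})$, where $I(f)=\{(1,0),(-a,\infty)\}$ and $I(f^{-1})=\{(0,-1),(\infty,a)\}$. Rectangles: $R_0=[1,\infty]\times[-\infty,-1]$ and $R_1=[-\infty,0]\times[0,\infty]$. Words: $\Sigma\subset\{0,1\}^{\mathbf Z}$ (product topology) is the set of bi-infinite sequences in which the block $11$ does not occur. For a finite block $w=w_{-n}\dots w_m$ ($n,m\ge0$) occurring in an element of $\Sigma$, $R(w)=\overline{\bigcap_{k=-n}^{m}f^{-k}(\operatorname{int}R_{w_k})}$ (images under iterates of $f^{\pm1}$; no point of $\operatorname{int}R_0\cup\operatorname{int}R_1$ is indeterminate for any iterate). For $w\in\Sigma$, $R(w)=\bigcap_{n,m\ge0}R(w_{-n}\dots w_m)$. Set $\Omega=\bigcup_{w\in\Sigma}R(w)$.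 A word is alternating if its digits alternate between $0$ and $1$. For $w\in\Sigma$, $w^+=(w_j)_{j\ge0}$ and $w^-=(w_j)_{j\le0}$. $\Sigma'$ is the set of $w\in\Sigma$ such that neither $w^+$ nor $w^-$ is alternating, with the subspace topology. *)

theory Defs
  imports "HOL-Analysis.Analysis"
begin

text \<open>The one-point compactification of the line is carried by \<open>real option\<close>,
  with \<open>None\<close> in the role of \<open>\<infinity>\<close>.\<close>

type_synonym pt = "real option \<times> real option"

abbreviation circle :: "real option topology" where
  "circle \<equiv> Alexandroff_compactification euclideanreal"

definition torus :: "pt topology" where
  "torus = prod_topology circle circle"

definition plane :: "pt set" where
  "plane = range Some \<times> range Some"


text \<open>The continuous extensions of the birational map \<open>f\<close> and of its inverse, with the values at \<open>\<infinity>\<close> written out.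
  The values at the points of indeterminacy are left unspecified. Lemmas \<open>continuous_map_f_ext\<close> and
  \<open>continuous_map_finv_ext\<close> below confirm that these are the continuous extensions.\<close>

definition indet_f :: "real \<Rightarrow> pt set" where
  "indet_f a = {(Some 1, Some 0), (Some (- a), None)}"

definition indet_finv :: "real \<Rightarrow> pt set" where
  "indet_finv a = {(Some 0, Some (- 1)), (None, Some a)}"

definition f_ext :: "real \<Rightarrow> pt \<Rightarrow> pt" where
  "f_ext a p = (if p \<in> indet_f a then undefined else case p of
       (Some x, Some y) \<Rightarrow>
         if x = 1 then (None, Some a) else (Some (y * ((x + a) / (x - 1))), Some (x + a - 1))
     | (Some x, None) \<Rightarrow> (None, Some (x + a - 1))
     | (None, y) \<Rightarrow> (y, None))"

definition finv_ext :: "real \<Rightarrow> pt \<Rightarrow> pt" where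
  "finv_ext a p = (if p \<in> indet_finv a then undefined else case p of
       (Some x, Some y) \<Rightarrow>
         if y = - 1 then (Some (- a), None) else (Some (y + 1 - a), Some (x * ((y - a) / (y + 1))))
     | (None, Some y) \<Rightarrow> (Some (y + 1 - a), None)
     | (x, None) \<Rightarrow> (None, x))"

definition f_iter :: "real \<Rightarrow> int \<Rightarrow> pt \<Rightarrow> pt" where
  "f_iter a k = (if k \<ge> 0 then f_ext a ^^ nat k else finv_ext a ^^ nat (- k))"


text \<open>\<open>R_0 = [1,\<infinity>] \<times> [-\<infinity>,-1]\<close> and \<open>R_1 = [-\<infinity>,0] \<times> [0,\<infinity>]\<close>.\<close>

definition rect :: "nat \<Rightarrow> pt set" where
  "rect i = (if i = 0 then insert None (Some ` {1..}) \<times> insert None (Some ` {..- 1})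
             else insert None (Some ` {..0}) \<times> insert None (Some ` {0..}))"


definition Sig :: "(int \<Rightarrow> nat) set" where
  "Sig = {w. range w \<subseteq> {0, 1} \<and> (\<forall>j. \<not> (w j = 1 \<and> w (j + 1) = 1))}"

definition alternating_on :: "int set \<Rightarrow> (int \<Rightarrow> nat) \<Rightarrow> bool" where
  "alternating_on J w \<longleftrightarrow> (\<forall>j. j \<in> J \<and> j + 1 \<in> J \<longrightarrow> w j \<noteq> w (j + 1))"

definition Sig' :: "(int \<Rightarrow> nat) set" where
  "Sig' = {w \<in> Sig. \<not> alternating_on {0..} w \<and> \<not> alternating_on {..0} w}"

definition seq_topology :: "(int \<Rightarrow> nat) topology" where
  "seq_topology = product_topology (\<lambda>_. discrete_topology {0, 1}) UNIV"


text \<open>\<open>R_block a w n m\<close> is the set attached to the finite block \<open>w_{-n} ... w_m\<close> of \<open>w\<close>.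
  It depends only on the values of \<open>w\<close> between \<open>-n\<close> and \<open>m\<close>.\<close>

definition R_block :: "real \<Rightarrow> (int \<Rightarrow> nat) \<Rightarrow> nat \<Rightarrow> nat \<Rightarrow> pt set" where
  "R_block a w n m = torus closure_of
     (\<Inter>k\<in>{- int n..int m}. f_iter a (- k) ` (torus interior_of rect (w k)))"

definition R_word :: "real \<Rightarrow> (int \<Rightarrow> nat) \<Rightarrow> pt set" where
  "R_word a w = (\<Inter>n m. R_block a w n m)"

definition Om :: "real \<Rightarrow> pt set" where
  "Om a = (\<Union>w\<in>Sig. R_word a w)"


subsection \<open>Continuity of the extensions\<close>

definition cinv :: "real option \<Rightarrow> real option" where
  "cinv u = (case u of None \<Rightarrow> Some 0 | Some x \<Rightarrow> if x = 0 then None else Some (inverse x))"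

text \<open>\<open>0 * \<infinity>\<close> gets a junk value.\<close>

definition cmul :: "pt \<Rightarrow> real option" where
  "cmul p = (case p of (Some x, Some y) \<Rightarrow> Some (x * y) | _ \<Rightarrow> None)"

lemma topspace_torus [simp]: "topspace torus = UNIV"
  by (auto simp: torus_def) (metis option.exhaust rangeI)+

lemma openin_circle:
  "openin circle V \<longleftrightarrow> (\<exists>U. open U \<and> V = Some ` U) \<or> (\<exists>C. compact C \<and> V = insert None (Some ` (- C)))"
  by (auto simp: openin_Alexandroff_compactification Compl_eq_Diff_UNIV compact_imp_closed)

lemma openin_circleI1:
  assumes "open {x. Some x \<in> V}" "None \<notin> V"
  shows "openin circle V"
proof -
  have "u \<in> V \<longleftrightarrow> u \<in> Some ` {x. Some x \<in> V}" for u
    using assms(2) by (cases u) auto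
  then have "V = Some ` {x. Some x \<in> V}" by (rule set_eqI)
  then show ?thesis unfolding openin_circle using assms(1) by blast
qed

lemma openin_circleI2:
  assumes "compact {x. Some x \<notin> V}" "None \<in> V"
  shows "openin circle V"
proof -
  have "u \<in> V \<longleftrightarrow> u \<in> insert None (Some ` (- {x. Some x \<notin> V}))" for u
    using assms(2) by (cases u) auto
  then have "V = insert None (Some ` (- {x. Some x \<notin> V}))" by (rule set_eqI)
  then show ?thesis unfolding openin_circle using assms(1) by blast
qed

lemma openin_circleD1: "openin circle V \<Longrightarrow> open {x. Some x \<in> V}"
  unfolding openin_circle
  by (auto simp: image_iff compact_imp_closed open_Compl simp flip: Compl_eq)

lemma openin_circleD2: "openin circle V \<Longrightarrow> None \<in> V \<Longrightarrow> compact {x. Some x \<notin> V}"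
  unfolding openin_circle by (auto simp: image_iff)

lemma topspace_circle: "topspace circle = UNIV"
  by (auto simp: UNIV_option_conv)

lemma continuous_map_affine:
  assumes "c \<noteq> 0"
  shows "continuous_map circle circle (map_option (\<lambda>x. c * x + d))"
  unfolding continuous_map_def topspace_circle
proof (intro conjI allI impI)
  fix V assume V: "openin circle V"
  let ?W = "{u \<in> UNIV. map_option (\<lambda>x. c * x + d) u \<in> V}"
  show "openin circle ?W"
  proof (cases "None \<in> V")
    case False
    have "open ((\<lambda>x. c * x + d) -` {x. Some x \<in> V})"
      by (intro open_vimage openin_circleD1 V continuous_intros)
    then show ?thesis using False by (intro openin_circleI1) (auto simp: vimage_def)
  next
    case True
    have "compact ((\<lambda>x. (x - d) / c) ` {x. Some x \<notin> V})"
      by (rule compact_continuous_image)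
        (use assms in \<open>auto intro!: continuous_intros openin_circleD2 V True\<close>)
    also have "(\<lambda>x. (x - d) / c) ` {x. Some x \<notin> V} = {x. Some (c * x + d) \<notin> V}"
      using assms by (auto simp: image_iff field_simps)
    finally show ?thesis using True by (intro openin_circleI2) auto
  qed
qed auto

lemma continuous_map_cinv: "continuous_map circle circle cinv"
  unfolding continuous_map_def topspace_circle
proof (intro conjI allI impI)
  fix V assume V: "openin circle V"
  let ?U = "{x. Some x \<in> V}"
  have U: "open ?U" by (rule openin_circleD1[OF V])
  have P: "open {x. x \<noteq> 0 \<and> inverse x \<in> ?U}"
  proof -
    have o: "open {x::real. x \<noteq> 0}"
      by (rule open_Collect_neq) auto
    have c: "continuous_on {x::real. x \<noteq> 0} inverse"
      by (rule continuous_on_inverse) auto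
    have "{x. x \<noteq> 0 \<and> inverse x \<in> ?U} = {x. x \<noteq> 0} \<inter> inverse -` ?U"
      by blast
    then show ?thesis using continuous_open_preimage[OF c o U] by simp
  qed
  have O: "open {x. Some x \<in> {u. cinv u \<in> V}}"
  proof (cases "None \<in> V")
    case False
    then have "{x. Some x \<in> {u. cinv u \<in> V}} = {x. x \<noteq> 0 \<and> inverse x \<in> ?U}"
      by (auto simp: cinv_def)
    then show ?thesis using P by simp
  next
    case True
    have "bounded {x. Some x \<notin> V}"
      using openin_circleD2[OF V True] by (rule compact_imp_bounded)
    then obtain b where b: "b > 0" "\<And>x. Some x \<notin> V \<Longrightarrow> \<bar>x\<bar> \<le> b"
      unfolding bounded_pos real_norm_def by blast
    have "{x. Some x \<in> {u. cinv u \<in> V}} = {x. x \<noteq> 0 \<and> inverse x \<in> ?U} \<union> ball 0 (inverse b)"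
    proof -
      have "Some (inverse x) \<in> V" if "\<bar>x\<bar> < inverse b" "x \<noteq> 0" for x
      proof (rule ccontr)
        assume "Some (inverse x) \<notin> V"
        then have "\<bar>inverse x\<bar> \<le> b" by (rule b)
        then have "\<bar>x\<bar> * \<bar>inverse x\<bar> \<le> \<bar>x\<bar> * b" by (simp add: mult_left_mono)
        also have "\<dots> < inverse b * b" using that b(1) by (intro mult_strict_right_mono)
        finally show False using that b(1) by simp
      qed
      then show ?thesis using True b(1) by (auto simp: cinv_def)
    qed
    then show ?thesis using P by (simp add: open_Un)
  qed
  show "openin circle {u \<in> UNIV. cinv u \<in> V}"
  proof (cases "Some 0 \<in> V")
    case False
    then show ?thesis using O by (intro openin_circleI1) (auto simp: cinv_def)
  next
    case True
    obtain e where e: "e > 0" "ball 0 e \<subseteq> ?U"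
      using U True unfolding open_contains_ball by blast
    have "compact {x. Some x \<notin> {u. cinv u \<in> V}}"
    proof (rule compact_eq_bounded_closed[THEN iffD2], intro conjI)
      show "closed {x. Some x \<notin> {u. cinv u \<in> V}}"
        unfolding closed_def using O by (rule back_subst[where P = "open"]) auto
      show "bounded {x. Some x \<notin> {u. cinv u \<in> V}}"
        unfolding bounded_iff
      proof (intro exI ballI)
        fix x assume x: "x \<in> {x. Some x \<notin> {u. cinv u \<in> V}}"
        show "norm x \<le> inverse e"
        proof (rule ccontr)
          assume n: "\<not> norm x \<le> inverse e"
          then have "x \<noteq> 0" using e by auto
          moreover have "\<bar>inverse x\<bar> < e"
          proof -
            have "inverse e * e < \<bar>x\<bar> * e" using n e(1) by (intro mult_strict_right_mono) auto
            then have "1 < \<bar>x\<bar> * e" using e(1) by simp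
            then have "\<bar>inverse x\<bar> * 1 < \<bar>inverse x\<bar> * (\<bar>x\<bar> * e)"
              using \<open>x \<noteq> 0\<close> by (intro mult_strict_left_mono) auto
            also have "\<dots> = e" using \<open>x \<noteq> 0\<close> by simp
            finally show ?thesis by simp
          qed
          ultimately show False using x e(2) by (auto simp: cinv_def subset_iff)
        qed
      qed
    qed
    then show ?thesis using True by (intro openin_circleI2) (auto simp: cinv_def)
  qed
qed auto

lemma continuous_map_Some_circle: "continuous_map euclideanreal circle Some"
  unfolding continuous_map_def
  by (auto dest: openin_circleD1 simp: topspace_circle)

lemma continuous_map_the: "continuous_map (subtopology circle (range Some)) euclideanreal the"
  unfolding continuous_map_def
proof (intro conjI allI impI)
  fix U :: "real set" assume "openin euclideanreal U"
  then have "openin circle (Some ` U)"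
    using openin_circle by auto
  moreover have "{x \<in> topspace (subtopology circle (range Some)). the x \<in> U} = Some ` U \<inter> range Some"
    by (auto simp: topspace_circle)
  ultimately show "openin (subtopology circle (range Some))
      {x \<in> topspace (subtopology circle (range Some)). the x \<in> U}"
    using openin_subtopology by blast
qed auto

lemma openin_range_Some: "openin circle (range Some)"
  unfolding openin_circle by (metis open_UNIV)

lemma openin_nonzero: "openin circle (- {Some 0})"
proof (rule openin_circleI2)
  have "{x::real. Some x \<notin> - {Some 0}} = {0}" by auto
  then show "compact {x::real. Some x \<notin> - {Some 0}}" by simp
qed auto

lemma continuous_map_cmul_finite:
  "continuous_map (subtopology torus (range Some \<times> range Some)) circle cmul"
proof -
  let ?T = "subtopology torus (range Some \<times> range Some)"
  have T: "?T = prod_topology (subtopology circle (range Some)) (subtopology circle (range Some))"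
    by (simp add: torus_def subtopology_Times)
  have "continuous_map ?T circle (Some \<circ> (\<lambda>p. the (fst p) * the (snd p)))"
    unfolding T
    by (intro continuous_map_compose[OF _ continuous_map_Some_circle] continuous_map_real_mult
        continuous_map_compose[OF continuous_map_fst continuous_map_the, unfolded o_def]
        continuous_map_compose[OF continuous_map_snd continuous_map_the, unfolded o_def])
  then show ?thesis
    by (rule continuous_map_eq) (auto simp: cmul_def)
qed

lemma continuous_map_cmul:
  "continuous_map (subtopology torus (- {(Some 0, None), (None, Some 0)})) circle cmul"
proof -
  let ?X = "subtopology torus (- {(Some 0, None), (None, Some 0)})"
  let ?A = "range Some \<times> range Some :: pt set"
  let ?B = "(- {Some 0}) \<times> (- {Some 0}) :: pt set"
  have oA: "openin torus ?A" and oB: "openin torus ?B"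
    using openin_range_Some openin_nonzero by (auto simp: torus_def openin_prod_Times_iff)
  have A: "continuous_map (subtopology torus ?A) circle cmul"
    by (rule continuous_map_cmul_finite)
  have B: "continuous_map (subtopology torus ?B) circle cmul"
  proof -
    have i: "continuous_map torus torus (\<lambda>p. (cinv (fst p), cinv (snd p)))"
      unfolding torus_def
      by (intro continuous_map_pairedI
          continuous_map_compose[OF continuous_map_fst continuous_map_cinv, unfolded o_def]
          continuous_map_compose[OF continuous_map_snd continuous_map_cinv, unfolded o_def])
    have "continuous_map (subtopology torus ?B) (subtopology torus ?A) (\<lambda>p. (cinv (fst p), cinv (snd p)))"
      by (rule continuous_map_into_subtopology[OF continuous_map_from_subtopology[OF i]])
        (auto simp: cinv_def split: option.splits)
    from continuous_map_compose[OF continuous_map_compose[OF this A] continuous_map_cinv]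
    show ?thesis
      by (rule continuous_map_eq) (auto simp: cinv_def cmul_def split: option.splits)
  qed
  show ?thesis
  proof (rule pasting_lemma[where I = UNIV and T = "\<lambda>b. if b then ?A else ?B" and f = "\<lambda>_. cmul"])
    show "openin ?X (if b then ?A else ?B)" for b :: bool
      using oA oB by (auto simp: openin_subtopology_alt subset_iff intro!: openin_subtopology_Int2 bexI)
    show "continuous_map (subtopology ?X (if b then ?A else ?B)) circle cmul" for b :: bool
      by (cases b) (auto simp: subtopology_subtopology
          intro: continuous_map_from_subtopology_mono[OF A] continuous_map_from_subtopology_mono[OF B])
    fix p assume p: "p \<in> topspace ?X"
    show "\<exists>b::bool. b \<in> UNIV \<and> p \<in> (if b then ?A else ?B) \<and> cmul p = cmul p"
      using p by (cases p; cases "fst p"; cases "snd p") (auto simp: ex_bool_eq)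
  qed auto
qed

text \<open>Both maps are built from multiplication and a Moebius map \<open>x \<mapsto> 1 + c / (x + d)\<close>.\<close>

lemma continuous_map_moebius:
  assumes "c \<noteq> 0"
  shows "continuous_map circle circle (map_option (\<lambda>x. c * x + 1) \<circ> cinv \<circ> map_option (\<lambda>x. 1 * x + d))"
  using continuous_map_compose[OF continuous_map_compose[OF continuous_map_affine[of 1 d] continuous_map_cinv]
      continuous_map_affine[OF assms, of 1]]
  by (simp add: o_assoc)

theorem continuous_map_f_ext:
  assumes "a < - 1"
  shows "continuous_map (subtopology torus (- indet_f a)) torus (f_ext a)"
proof -
  let ?X = "subtopology torus (- indet_f a)"
  let ?Y = "subtopology torus (- {(Some 0, None), (None, Some 0)})"
  define mu where "mu = (\<lambda>u. case u of None \<Rightarrow> Some 1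
      | Some x \<Rightarrow> if x - 1 = 0 then None else Some ((x + a) / (x - 1)))"
  define h where "h = (\<lambda>p :: pt. (snd p, mu (fst p)))"
  have "map_option (\<lambda>x. (a + 1) * x + 1) \<circ> cinv \<circ> map_option (\<lambda>x. 1 * x + (- 1)) = mu"
    by (rule ext) (auto simp: mu_def cinv_def divide_simps split: option.splits)
  then have mu: "continuous_map circle circle mu"
    using continuous_map_moebius[of "a + 1" "- 1"] assms by simp
  have fst: "continuous_map torus circle fst" and snd: "continuous_map torus circle snd"
    by (auto simp: torus_def continuous_map_fst continuous_map_snd)
  have "continuous_map torus torus h"
    using continuous_map_compose[OF fst mu] snd
    by (auto simp: torus_def h_def continuous_map_paired o_def)
  moreover have "h p \<in> - {(Some 0, None), (None, Some 0)}" if "p \<in> - indet_f a" for p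
    using that
    by (cases p; cases "fst p"; cases "snd p") (auto simp: h_def mu_def indet_f_def split: if_splits)
  ultimately have "continuous_map ?X ?Y h"
    by (intro continuous_map_into_subtopology continuous_map_from_subtopology) auto
  then have 1: "continuous_map ?X circle (\<lambda>p. cmul (h p))"
    using continuous_map_compose[OF _ continuous_map_cmul] by (auto simp: o_def)
  have 2: "continuous_map ?X circle (\<lambda>p. map_option (\<lambda>x. 1 * x + (a - 1)) (fst p))"
    using continuous_map_compose[OF continuous_map_from_subtopology[OF fst] continuous_map_affine[of 1]]
    by (auto simp: o_def)
  have "continuous_map ?X torus (\<lambda>p. (cmul (h p), map_option (\<lambda>x. 1 * x + (a - 1)) (fst p)))"
    using 1 2 unfolding torus_def by (rule_tac continuous_map_pairedI)
  then show ?thesis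
  proof (rule continuous_map_eq)
    fix p assume "p \<in> topspace ?X"
    then show "(cmul (h p), map_option (\<lambda>x. 1 * x + (a - 1)) (fst p)) = f_ext a p"
      by (cases p; cases "fst p"; cases "snd p")
        (auto simp: h_def mu_def cmul_def f_ext_def indet_f_def)
  qed
qed

theorem continuous_map_finv_ext:
  assumes "a < - 1"
  shows "continuous_map (subtopology torus (- indet_finv a)) torus (finv_ext a)"
proof -
  let ?X = "subtopology torus (- indet_finv a)"
  let ?Y = "subtopology torus (- {(Some 0, None), (None, Some 0)})"
  define mu where "mu = (\<lambda>u. case u of None \<Rightarrow> Some 1
      | Some x \<Rightarrow> if x + 1 = 0 then None else Some ((x - a) / (x + 1)))"
  define h where "h = (\<lambda>p :: pt. (fst p, mu (snd p)))"
  have "map_option (\<lambda>x. (- a - 1) * x + 1) \<circ> cinv \<circ> map_option (\<lambda>x. 1 * x + (1)) = mu"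
    by (rule ext) (auto simp: mu_def cinv_def divide_simps split: option.splits)
  then have mu: "continuous_map circle circle mu"
    using continuous_map_moebius[of "- a - 1" "1"] assms by simp
  have fst: "continuous_map torus circle fst" and snd: "continuous_map torus circle snd"
    by (auto simp: torus_def continuous_map_fst continuous_map_snd)
  have "continuous_map torus torus h"
    using continuous_map_compose[OF snd mu] fst
    by (auto simp: torus_def h_def continuous_map_paired o_def)
  moreover have "h p \<in> - {(Some 0, None), (None, Some 0)}" if "p \<in> - indet_finv a" for p
    using that
    by (cases p; cases "fst p"; cases "snd p") (auto simp: h_def mu_def indet_finv_def split: if_splits)
  ultimately have "continuous_map ?X ?Y h"
    by (intro continuous_map_into_subtopology continuous_map_from_subtopology) auto
  then have 1: "continuous_map ?X circle (\<lambda>p. cmul (h p))"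
    using continuous_map_compose[OF _ continuous_map_cmul] by (auto simp: o_def)
  have 2: "continuous_map ?X circle (\<lambda>p. map_option (\<lambda>x. 1 * x + (1 - a)) (snd p))"
    using continuous_map_compose[OF continuous_map_from_subtopology[OF snd] continuous_map_affine[of 1]]
    by (auto simp: o_def)
  have "continuous_map ?X torus (\<lambda>p. (map_option (\<lambda>x. 1 * x + (1 - a)) (snd p), cmul (h p)))"
    using 1 2 unfolding torus_def by (rule_tac continuous_map_pairedI)
  then show ?thesis
  proof (rule continuous_map_eq)
    fix p assume "p \<in> topspace ?X"
    then show "(map_option (\<lambda>x. 1 * x + (1 - a)) (snd p), cmul (h p)) = finv_ext a p"
      by (cases p; cases "fst p"; cases "snd p")
        (auto simp: h_def mu_def cmul_def finv_ext_def indet_finv_def)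
  qed
qed

end

theory Submission
  imports Defs
begin

text \<open>
Put \<open>b = - a > 1\<close>. In the rectangles the map is described by positive coordinates \<open>(p, q)\<close>, and an orbit
  that follows a word is a solution of a recursion in which each step expresses \<open>(p_k, q_{k+1})\<close> through
  \<open>(q_k, p_{k+1})\<close>. So an orbit is a fixed point of a system of equations, with the past entering through \<open>q\<close> and the
  future through \<open>p\<close>. The decisive fact is that every step is nonexpansive for the sum of the logarithmic distances
  (\<open>step_nonexpansive\<close>), and contracts by the factor \<open>(b - 1) / (b + 1)\<close> when both digits are \<open>0\<close>
  (\<open>step_contract_00\<close>).

For two orbits with the same word let \<open>D_k\<close> and \<open>E_k\<close> be the logarithmic distances of their \<open>p_k\<close> and of
  their \<open>q_k\<close>. Nonexpansiveness says that \<open>D_k - E_k\<close> does not decrease with \<open>k\<close>, and at every block \<open>00\<close> it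
  grows by a fixed multiple of \<open>D_k + E_{k+1}\<close>. At a block \<open>00\<close> the coordinate \<open>p_k\<close> lies between \<open>1\<close> and
  \<open>b\<close>, so \<open>D_k - E_k\<close> is bounded above there. If the future of the word contains infinitely many blocks \<open>00\<close>, this is
  compatible with the growth only if \<open>D_k - E_k\<close> is at most a small positive number on long orbits. If it contains a last one, the word
  alternates from then on, the orbit must run towards infinity (\<open>long_alternating_block_unbounded\<close>, by divergence of the
  harmonic series), and at the last block \<open>00\<close> the coordinate \<open>p_k\<close> is squeezed to \<open>1\<close>. By time reversal the
  past bounds \<open>D_k - E_k\<close> from below. Hence its total variation near time \<open>0\<close> is small, and so are \<open>D_0\<close> and
  \<open>E_0\<close>: orbits that share a long block of \<open>w \<in> Sig'\<close> are uniformly close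
  (\<open>orbits_with_same_word_close\<close>). Together with the existence of orbits for all finite blocks (\<open>orbit_exists\<close>),
  which comes from following a curve that crosses the rectangles, this shows that \<open>R_word a w\<close> is a point and depends
  continuously on \<open>w\<close>.

Conversely, a finite point determines the digits of nearby orbits, also when the orbit of the point runs into a
  collapsed line (\<open>itinerary_locally_constant\<close>): this gives injectivity and continuity of the inverse. Alternating halves
  force the points to infinity, so exactly the words of \<open>Sig'\<close> occur in the plane.
\<close>

section \<open>Orbits in positive coordinates\<close>

text \<open>Write \<open>b = - a\<close>. A point of \<open>int R_i\<close> is described by two positive numbers \<open>p, q\<close>: it is \<open>(p, - q)\<close> for \<open>i = 0\<close>
  and \<open>(- q, p)\<close> for \<open>i = 1\<close>. If \<open>f\<close> sends the point \<open>(p, q)\<close> of \<open>int R_i\<close> to the point \<open>(p', q')\<close> of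
  \<open>int R_j\<close>, the mixed data \<open>(q, p')\<close> determine \<open>p\<close> and \<open>q'\<close>: \<open>gen b i j\<close> is the resulting formula
  for \<open>p\<close>. The involution \<open>(x, y) \<mapsto> (- y, - x)\<close> conjugates \<open>f\<close> to its inverse and exchanges \<open>p\<close> with
  \<open>q\<close>, so the same formula, read backwards in time, gives \<open>q'\<close>.\<close>

definition gen :: "real \<Rightarrow> nat \<Rightarrow> nat \<Rightarrow> real \<Rightarrow> real \<Rightarrow> real" where
  "gen b i j q p' = (if i = 0 \<and> j = 0 then (p' + b * q) / (p' + q)
     else if i = 0 then p' + b + 1 else p' * (q + 1) / (q + b))"

definition step :: "real \<Rightarrow> nat \<Rightarrow> nat \<Rightarrow> real \<Rightarrow> real \<Rightarrow> real \<Rightarrow> real \<Rightarrow> bool" where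
  "step b i j p q p' q' \<longleftrightarrow> p = gen b i j q p' \<and> q' = gen b j i p' q"

definition chart :: "nat \<Rightarrow> real \<Rightarrow> real \<Rightarrow> real \<times> real" where
  "chart i p q = (if i = 0 then (p, - q) else (- q, p))"

text \<open>The conditions on \<open>p, q\<close> that single out the interior of \<open>R_i\<close>.\<close>

definition adm :: "nat \<Rightarrow> real \<Rightarrow> real \<Rightarrow> bool" where
  "adm i p q \<longleftrightarrow> (if i = 0 then 1 < p \<and> 1 < q else 0 < p \<and> 0 < q)"

definition orbit :: "real \<Rightarrow> (int \<Rightarrow> nat) \<Rightarrow> int \<Rightarrow> int \<Rightarrow> (int \<Rightarrow> real) \<Rightarrow> (int \<Rightarrow> real) \<Rightarrow> bool" where
  "orbit b w l m p q \<longleftrightarrow> (\<forall>k\<in>{l..m}. adm (w k) (p k) (q k)) \<and>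
     (\<forall>k\<in>{l..<m}. step b (w k) (w (k + 1)) (p k) (q k) (p (k + 1)) (q (k + 1)))"

section \<open>Contraction of logarithmic distances\<close>

definition ldist :: "real \<Rightarrow> real \<Rightarrow> real" where
  "ldist x y = \<bar>ln x - ln y\<bar>"

lemma ldist_nonneg [simp]: "0 \<le> ldist x y" by (simp add: ldist_def)

lemma ldist_commute: "ldist x y = ldist y x" by (simp add: ldist_def abs_minus_commute)

lemma ldist_mono: "0 < x \<Longrightarrow> x \<le> y \<Longrightarrow> ldist x y = ln y - ln x"
  by (simp add: ldist_def)

lemma adm_pos: "adm i p q \<Longrightarrow> 0 < p \<and> 0 < q"
  by (auto simp: adm_def split: if_splits)

lemma adm_swap: "adm i p q \<longleftrightarrow> adm i q p"
  by (auto simp: adm_def)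

lemma step_swap: "step b i j p q p' q' \<longleftrightarrow> step b j i q' p' q p"
  by (auto simp: step_def)

lemma orbit_admD: "orbit b w l m p q \<Longrightarrow> l \<le> k \<Longrightarrow> k \<le> m \<Longrightarrow> adm (w k) (p k) (q k)"
  by (simp add: orbit_def)

lemma orbit_posD:
  assumes "orbit b w l m p q" "l \<le> k" "k \<le> m"
  shows "0 < p k" "0 < q k"
  using adm_pos[OF orbit_admD[OF assms]] by auto

lemma orbit_stepD:
  "orbit b w l m p q \<Longrightarrow> l \<le> k \<Longrightarrow> k < m \<Longrightarrow> step b (w k) (w (k + 1)) (p k) (q k) (p (k + 1)) (q (k + 1))"
  by (simp add: orbit_def)

lemma orbit_subset:
  "orbit b w l m p q \<Longrightarrow> l \<le> l' \<Longrightarrow> m' \<le> m \<Longrightarrow> orbit b w l' m' p q"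
  by (auto simp: orbit_def)

lemma orbit_cong:
  "orbit b w l m p q \<Longrightarrow> (\<And>k. l \<le> k \<Longrightarrow> k \<le> m \<Longrightarrow> w' k = w k) \<Longrightarrow> orbit b w' l m p q"
  by (auto simp: orbit_def)

lemma orbit_reverse:
  assumes "orbit b w l m p q"
  shows "orbit b (\<lambda>k. w (- k)) (- m) (- l) (\<lambda>k. q (- k)) (\<lambda>k. p (- k))"
  unfolding orbit_def
proof (intro conjI ballI)
  fix k assume "k \<in> {- m..- l}"
  then show "adm (w (- k)) (q (- k)) (p (- k))"
    using orbit_admD[OF assms, of "- k"] by (simp add: adm_swap)
next
  fix k assume "k \<in> {- m..<- l}"
  then show "step b (w (- k)) (w (- (k + 1))) (q (- k)) (p (- k)) (q (- (k + 1))) (p (- (k + 1)))"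
    using orbit_stepD[OF assms, of "- (k + 1)"] by (simp add: step_swap)
qed

context
  fixes b :: real
  assumes b: "1 < b"
begin

lemma step_00:
  assumes "step b 0 0 p q p' q'" "0 < q" "0 < p'"
  shows "1 < p" "p < b" "1 < q'" "q' < b" "q' = b + 1 - p" "p - 1 = (b - 1) * q / (p' + q)"
proof -
  have e: "p = (p' + b * q) / (p' + q)" "q' = (q + b * p') / (q + p')"
    using assms by (auto simp: step_def gen_def)
  have s: "0 < p' + q" using assms by simp
  have q: "1 * q < b * q" "1 * p' < b * p'" using assms b by (auto intro: mult_strict_right_mono)
  show "1 < p" "p < b" "1 < q'" "q' < b"
    unfolding e using s q by (auto simp: field_simps)
  show "q' = b + 1 - p" "p - 1 = (b - 1) * q / (p' + q)"
    unfolding e using s assms(2,3) by (auto simp: field_simps)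
qed

text \<open>A backward step raises \<open>p\<close> by at most \<open>b + 1\<close>. This gives bounds on orbits that involve only the number
  of steps to the next block \<open>00\<close>.\<close>

lemma step_le:
  assumes "step b i j p q p' q'" "0 < q" "0 < p'" "1 < p' \<or> i = 0"
  shows "p \<le> p' + b + 1"
proof -
  consider "i = 0" "j = 0" | "i = 0" "j \<noteq> 0" | "i \<noteq> 0" by blast
  then show ?thesis
  proof cases
    case 1 then show ?thesis using step_00[of p q p' q'] assms b by auto
  next
    case 2 then show ?thesis using assms by (auto simp: step_def gen_def)
  next
    case 3
    then have "p = p' * ((q + 1) / (q + b))" using assms by (auto simp: step_def gen_def)
    also have "\<dots> \<le> p' * 1" using assms b by (intro mult_left_mono) auto
    finally show ?thesis using b by auto
  qed
qed

text \<open>For the digits \<open>00\<close> both outputs depend on the ratio \<open>t = p'/q\<close> alone, one decreasing and the other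
  increasing, so the sum of their logarithmic distances is a difference of values of
  \<open>ln ((b t + 1) / (t + b))\<close>. The derivative of this function with respect to \<open>ln t\<close> is
  \<open>(b\<^sup>2 - 1) t / ((b t + 1) (t + b))\<close>, and it is at most \<open>(b - 1) / (b + 1)\<close> because
  \<open>b (t - 1)\<^sup>2 \<ge> 0\<close>.\<close>

lemma ratio_contraction_aux:
  assumes "0 < x" "x \<le> y"
  shows "ldist ((x + b) / (x + 1)) ((y + b) / (y + 1)) + ldist ((b * x + 1) / (x + 1)) ((b * y + 1) / (y + 1))
     \<le> (b - 1) / (b + 1) * ldist x y"
proof -
  define c where "c = (b - 1) / (b + 1)"
  define F where "F t = c * ln t - (ln (b * t + 1) - ln (t + b))" for t
  have y: "0 < y" using assms by simp
  have "(y + b) * (x + 1) \<le> (x + b) * (y + 1)"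
  proof -
    have "(x + b) * (y + 1) - (y + b) * (x + 1) = (b - 1) * (y - x)" by (simp add: algebra_simps)
    moreover have "0 \<le> (b - 1) * (y - x)" using b assms by simp
    ultimately show ?thesis by linarith
  qed
  then have 1: "(y + b) / (y + 1) \<le> (x + b) / (x + 1)"
    using assms y by (simp add: divide_simps)
  have "(b * x + 1) * (y + 1) \<le> (b * y + 1) * (x + 1)"
  proof -
    have "(b * y + 1) * (x + 1) - (b * x + 1) * (y + 1) = (b - 1) * (y - x)" by (simp add: algebra_simps)
    moreover have "0 \<le> (b - 1) * (y - x)" using b assms by simp
    ultimately show ?thesis by linarith
  qed
  then have 2: "(b * x + 1) / (x + 1) \<le> (b * y + 1) / (y + 1)"
    using assms y by (simp add: divide_simps)
  have F: "F x \<le> F y"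
  proof (rule DERIV_nonneg_imp_nondecreasing[OF assms(2)])
    fix t assume "x \<le> t" "t \<le> y"
    then have t: "0 < t" using assms by simp
    have p: "0 < b * t + 1" "0 < t + b" using t b by (auto intro: add_pos_pos mult_pos_pos)
    have d: "(F has_real_derivative (c * (1 / t) - (1 / (b * t + 1) * b - 1 / (t + b)))) (at t)"
      unfolding F_def using t p by (auto intro!: derivative_eq_intros)
    have bb: "0 < b + 1" using b by simp
    have h: "d / x \<le> 1 / y" if "0 < x" "0 < y" "d * y \<le> x" for x y d :: real
      using that by (simp add: field_simps)
    have pp: "0 < (b * t + 1) * (t + b)" using p by simp
    have "c * (1 / t) - (1 / (b * t + 1) * b - 1 / (t + b))
        = (b - 1) / ((b + 1) * t) - (b - 1) * (b + 1) / ((b * t + 1) * (t + b))"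
      unfolding c_def using p bb t by (simp add: divide_simps) (simp add: algebra_simps)
    moreover have "(b - 1) * (b + 1) / ((b * t + 1) * (t + b)) \<le> (b - 1) / ((b + 1) * t)"
    proof -
      have "(b * t + 1) * (t + b) - (b + 1) * (b + 1) * t = b * (t - 1)\<^sup>2"
        by (simp add: algebra_simps power2_eq_square)
      moreover have "0 \<le> b * (t - 1)\<^sup>2" using b by simp
      ultimately have "(b + 1) * (b + 1) * t \<le> (b * t + 1) * (t + b)" by linarith
      then have "(b + 1) / ((b * t + 1) * (t + b)) \<le> 1 / ((b + 1) * t)"
        using h[OF pp, of "(b + 1) * t" "b + 1"] bb t by (simp add: mult.assoc)
      then have "(b - 1) * ((b + 1) / ((b * t + 1) * (t + b))) \<le> (b - 1) * (1 / ((b + 1) * t))"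
        using b by (intro mult_left_mono) auto
      then show ?thesis by simp
    qed
    ultimately show "\<exists>d. (F has_real_derivative d) (at t) \<and> 0 \<le> d"
      using d by (intro exI[of _ "c * (1 / t) - (1 / (b * t + 1) * b - 1 / (t + b))"]) auto
  qed
  have pos: "0 < b * x + 1" "0 < b * y + 1" "0 < x + b" "0 < y + b"
    using assms y b by (auto intro: add_pos_pos mult_pos_pos)
  have "ldist ((x + b) / (x + 1)) ((y + b) / (y + 1)) = ln ((x + b) / (x + 1)) - ln ((y + b) / (y + 1))"
    by (subst ldist_commute, rule ldist_mono) (use 1 pos y in auto)
  moreover have "ldist ((b * x + 1) / (x + 1)) ((b * y + 1) / (y + 1)) = ln ((b * y + 1) / (y + 1)) - ln ((b * x + 1) / (x + 1))"
    by (rule ldist_mono) (use 2 pos assms in auto)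
  moreover have "ldist x y = ln y - ln x" using assms by (rule ldist_mono)
  moreover have "ln ((t + b) / (t + 1)) = ln (t + b) - ln (t + 1)"
    "ln ((b * t + 1) / (t + 1)) = ln (b * t + 1) - ln (t + 1)" if "t = x \<or> t = y" for t
    using that pos y assms by (auto simp: ln_div)
  ultimately show ?thesis
    using F unfolding c_def[symmetric] by (simp add: F_def right_diff_distrib)
qed

lemma ratio_contraction:
  assumes "0 < x" "0 < y"
  shows "ldist ((x + b) / (x + 1)) ((y + b) / (y + 1)) + ldist ((b * x + 1) / (x + 1)) ((b * y + 1) / (y + 1))
     \<le> (b - 1) / (b + 1) * ldist x y"
proof (cases "x \<le> y")
  case True then show ?thesis using ratio_contraction_aux assms by blast
next
  case False
  then show ?thesis using ratio_contraction_aux[of y x] assms by (simp add: ldist_commute)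
qed

lemma ldist_ratio_le:
  assumes "0 < x" "0 < y" "0 < x'" "0 < y'"
  shows "ldist (x / y) (x' / y') \<le> ldist y y' + ldist x x'"
  using assms by (simp add: ldist_def ln_div)

lemma ldist_mult_le:
  assumes "0 < x" "0 < y" "0 < x'" "0 < y'"
  shows "ldist (x * y) (x' * y') \<le> ldist x x' + ldist y y'"
  using assms by (simp add: ldist_def ln_mult)

lemma step_contract_00:
  assumes "step b 0 0 p q p1 q1" "step b 0 0 r s r1 s1" "0 < q" "0 < p1" "0 < s" "0 < r1"
  shows "ldist p r + ldist q1 s1 \<le> (b - 1) / (b + 1) * (ldist q s + ldist p1 r1)"
proof -
  have h: "(x + b * y) / (x + y) = (x / y + b) / (x / y + 1)"
    "(y + b * x) / (y + x) = (b * (x / y) + 1) / (x / y + 1)" if "0 < y" for x y :: real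
  proof -
    have "x / y + b = (x + b * y) / y" "b * (x / y) + 1 = (y + b * x) / y" "x / y + 1 = (x + y) / y"
      using that by (auto simp: add_divide_distrib)
    then show "(x + b * y) / (x + y) = (x / y + b) / (x / y + 1)"
      "(y + b * x) / (y + x) = (b * (x / y) + 1) / (x / y + 1)"
      using that by (simp_all add: add.commute)
  qed
  have e: "p = (p1 / q + b) / (p1 / q + 1)" "q1 = (b * (p1 / q) + 1) / (p1 / q + 1)"
    "r = (r1 / s + b) / (r1 / s + 1)" "s1 = (b * (r1 / s) + 1) / (r1 / s + 1)"
    using assms h(1)[of q p1] h(2)[of q p1] h(1)[of s r1] h(2)[of s r1]
    by (simp_all add: step_def gen_def)
  have "ldist p r + ldist q1 s1 \<le> (b - 1) / (b + 1) * ldist (p1 / q) (r1 / s)"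
    unfolding e by (rule ratio_contraction) (use assms in auto)
  also have "\<dots> \<le> (b - 1) / (b + 1) * (ldist q s + ldist p1 r1)"
    using b assms by (intro mult_left_mono ldist_ratio_le) auto
  finally show ?thesis .
qed

text \<open>For the digits \<open>01\<close> both functions of \<open>p'\<close> are increasing, and their logarithms together grow more slowly
  than \<open>ln p'\<close>. The contraction degenerates as \<open>p' \<rightarrow> \<infinity>\<close>, hence the bound \<open>M\<close>.\<close>

lemma ratio_01_aux:
  assumes "0 < x" "x \<le> y" "y \<le> M"
  shows "ldist (x + b + 1) (y + b + 1) + ldist ((x + 1) / (x + b)) ((y + 1) / (y + b))
     \<le> (1 - 2 / (M + b + 1)) * ldist x y"
proof -
  define c where "c = 1 - 2 / (M + b + 1)"
  define F where "F t = c * ln t - ln (t + b + 1) - (ln (t + 1) - ln (t + b))" for t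
  have y: "0 < y" using assms by simp
  have "(x + 1) * (y + b) \<le> (y + 1) * (x + b)"
  proof -
    have "(y + 1) * (x + b) - (x + 1) * (y + b) = (b - 1) * (y - x)" by (simp add: algebra_simps)
    moreover have "0 \<le> (b - 1) * (y - x)" using b assms by simp
    ultimately show ?thesis by linarith
  qed
  then have 1: "(x + 1) / (x + b) \<le> (y + 1) / (y + b)"
    using assms y b by (simp add: divide_simps)
  have F: "F x \<le> F y"
  proof (rule DERIV_nonneg_imp_nondecreasing[OF assms(2)])
    fix t assume t': "x \<le> t" "t \<le> y"
    then have t: "0 < t" "t \<le> M" using assms by auto
    have d: "(F has_real_derivative (c * (1 / t) - 1 / (t + b + 1) - (1 / (t + 1) - 1 / (t + b)))) (at t)"
      unfolding F_def using t b by (auto intro!: derivative_eq_intros)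
    have p1: "0 < t * (t + b + 1)" "0 < (t + 1) * (t + b)" using t b by auto
    have "(b - 1) / ((t + 1) * (t + b)) \<le> (b - 1) / (t * (t + b + 1))"
    proof (rule divide_left_mono)
      show "t * (t + b + 1) \<le> (t + 1) * (t + b)" using b by (simp add: algebra_simps)
      show "0 < (t + 1) * (t + b) * (t * (t + b + 1))" by (rule mult_pos_pos[OF p1(2) p1(1)])
    qed (use b in simp)
    moreover have "1 / (t + 1) - 1 / (t + b) = (b - 1) / ((t + 1) * (t + b))"
      using t b by (simp add: field_simps)
    moreover have "1 / t - 1 / (t + b + 1) = (b - 1) / (t * (t + b + 1)) + 2 / (t * (t + b + 1))"
    proof -
      have "1 / t - 1 / (t + b + 1) = (b + 1) / (t * (t + b + 1))"
        using t b by (subst diff_frac_eq) auto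
      also have "b + 1 = (b - 1) + 2" by simp
      finally show ?thesis by (simp only: add_divide_distrib)
    qed
    moreover have "2 / (M + b + 1) * (1 / t) \<le> 2 / (t * (t + b + 1))"
    proof -
      have "2 / (M + b + 1) \<le> 2 / (t + b + 1)" using t b by (intro divide_left_mono) auto
      then have "2 / (M + b + 1) * (1 / t) \<le> 2 / (t + b + 1) * (1 / t)"
        using t by (intro mult_right_mono) auto
      then show ?thesis by (simp add: mult.commute)
    qed
    ultimately have "0 \<le> c * (1 / t) - 1 / (t + b + 1) - (1 / (t + 1) - 1 / (t + b))"
      unfolding c_def left_diff_distrib by linarith
    then show "\<exists>d. (F has_real_derivative d) (at t) \<and> 0 \<le> d" using d by blast
  qed
  have "ldist (x + b + 1) (y + b + 1) = ln (y + b + 1) - ln (x + b + 1)"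
    by (rule ldist_mono) (use assms b in auto)
  moreover have "ldist ((x + 1) / (x + b)) ((y + 1) / (y + b)) = ln ((y + 1) / (y + b)) - ln ((x + 1) / (x + b))"
    by (rule ldist_mono) (use 1 assms b in auto)
  moreover have "ldist x y = ln y - ln x" using assms by (intro ldist_mono)
  moreover have "ln ((t + 1) / (t + b)) = ln (t + 1) - ln (t + b)" if "t = x \<or> t = y" for t
    using that assms y b by (auto simp: ln_div)
  ultimately show ?thesis
    using F unfolding c_def[symmetric] by (simp add: F_def right_diff_distrib)
qed

lemma ratio_01:
  assumes "0 < x" "0 < y" "x \<le> M" "y \<le> M"
  shows "ldist (x + b + 1) (y + b + 1) + ldist ((x + 1) / (x + b)) ((y + 1) / (y + b))
     \<le> (1 - 2 / (M + b + 1)) * ldist x y"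
proof (cases "x \<le> y")
  case True then show ?thesis using ratio_01_aux assms by blast
next
  case False
  then show ?thesis using ratio_01_aux[of y x M] assms by (simp add: ldist_commute)
qed

lemma step_contract_01:
  assumes "step b 0 1 p q p1 q1" "step b 0 1 r s r1 s1" "0 < q" "0 < p1" "0 < s" "0 < r1" "p1 \<le> M" "r1 \<le> M"
  shows "ldist p r + ldist q1 s1 \<le> ldist q s + (1 - 2 / (M + b + 1)) * ldist p1 r1"
proof -
  have e: "p = p1 + b + 1" "q1 = q * ((p1 + 1) / (p1 + b))" "r = r1 + b + 1" "s1 = s * ((r1 + 1) / (r1 + b))"
    using assms by (auto simp: step_def gen_def)
  have "ldist q1 s1 \<le> ldist q s + ldist ((p1 + 1) / (p1 + b)) ((r1 + 1) / (r1 + b))"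
    unfolding e using assms b by (intro ldist_mult_le) auto
  then show ?thesis using ratio_01[of p1 r1 M] assms unfolding e by linarith
qed

text \<open>The inequality behind everything: each step is nonexpansive for the \<open>\<ell>\<^sup>1\<close> logarithmic distance when it is read as
  a map from \<open>(q, p')\<close> to \<open>(p, q')\<close>. In the sup norm this fails.\<close>

lemma step_nonexpansive:
  assumes "step b i j p q p1 q1" "step b i j r s r1 s1" "0 < q" "0 < p1" "0 < s" "0 < r1"
    "i \<in> {0,1}" "j \<in> {0,1}" "\<not> (i = 1 \<and> j = 1)"
  shows "ldist p r + ldist q1 s1 \<le> ldist q s + ldist p1 r1"
proof -
  have red: "0 \<le> x \<Longrightarrow> 0 \<le> c \<Longrightarrow> (1 - c) * x \<le> x" for x c :: real
    by (simp add: left_diff_distrib)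
  consider "i = 0" "j = 0" | "i = 0" "j = 1" | "i = 1" "j = 0" using assms by auto
  then show ?thesis
  proof cases
    case 1
    have "(b - 1) / (b + 1) * (ldist q s + ldist p1 r1) \<le> 1 * (ldist q s + ldist p1 r1)"
      using b by (intro mult_right_mono) auto
    then show ?thesis using step_contract_00[of p q p1 q1 r s r1 s1] assms 1 by auto
  next
    case 2
    have "(1 - 2 / (max p1 r1 + b + 1)) * ldist p1 r1 \<le> ldist p1 r1"
      by (rule red) (use b assms in auto)
    then show ?thesis using step_contract_01[of p q p1 q1 r s r1 s1 "max p1 r1"] assms 2 by auto
  next
    case 3
    have "(1 - 2 / (max q s + b + 1)) * ldist q s \<le> ldist q s"
      by (rule red) (use b assms in auto)
    then show ?thesis
      using step_contract_01[of q1 p1 q p s1 r1 s r "max q s"] assms 3 by (auto simp: step_swap)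
  qed
qed

end

section \<open>Words without the block 11\<close>

definition double_zero :: "(int \<Rightarrow> nat) \<Rightarrow> int \<Rightarrow> bool" where
  "double_zero w k \<longleftrightarrow> w k = 0 \<and> w (k + 1) = 0"

lemma Sig_digit: "w \<in> Sig \<Longrightarrow> w k = 0 \<or> w k = 1"
  by (auto simp: Sig_def)

lemma Sig_not_11: "w \<in> Sig \<Longrightarrow> w k = 1 \<Longrightarrow> w (k + 1) = 0"
  using Sig_digit[of w "k + 1"] by (auto simp: Sig_def)

lemma Sig_reverse: "w \<in> Sig \<Longrightarrow> (\<lambda>k. w (- k)) \<in> Sig"
  proof -
  assume w: "w \<in> Sig"
  have "\<not> (w (- j) = 1 \<and> w (- (j + 1)) = 1)" for j
    using Sig_not_11[OF w, of "- (j + 1)"] by auto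
  moreover have "range (\<lambda>k. w (- k)) \<subseteq> {0, 1}" 
  proof (intro image_subsetI)
    show "w (- k) \<in> {0, 1}" for k using Sig_digit[OF w, of "- k"] by simp
  qed
  ultimately show ?thesis by (simp add: Sig_def)
qed

lemma alternating_on_reverse:
  "alternating_on {0..} (\<lambda>k. w (- k)) \<longleftrightarrow> alternating_on {..0} w" (is "?l = ?r")
proof
  assume l: ?l
  show ?r unfolding alternating_on_def
  proof (intro allI impI)
    fix j :: int assume "j \<in> {..0} \<and> j + 1 \<in> {..0}"
    then show "w j \<noteq> w (j + 1)"
      using l[unfolded alternating_on_def, rule_format, of "- (j + 1)"] by (auto simp: add.commute)
  qed
next
  assume r: ?r
  show ?l unfolding alternating_on_def
  proof (intro allI impI)
    fix j :: int assume j: "j \<in> {0..} \<and> j + 1 \<in> {0..}"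
    have "- (j + 1) + 1 = - j" by simp
    then show "w (- j) \<noteq> w (- (j + 1))"
      using r[unfolded alternating_on_def, rule_format, of "- (j + 1)"] j by auto
  qed
qed

lemma not_alternating_future:
  assumes "w \<in> Sig" "\<not> alternating_on {0..} w"
  obtains k where "0 \<le> k" "double_zero w k"
proof -
  obtain k where k: "0 \<le> k" "w k = w (k + 1)" using assms unfolding alternating_on_def by auto
  then have "double_zero w k"
    using Sig_digit[OF assms(1), of k] Sig_not_11[OF assms(1), of k] unfolding double_zero_def by auto
  then show thesis using that k by blast
qed

lemma not_alternating_past:
  assumes "w \<in> Sig" "\<not> alternating_on {..0} w"
  obtains k where "k < 0" "double_zero w k"
proof -
  obtain k where k: "k + 1 \<le> 0" "w k = w (k + 1)" using assms unfolding alternating_on_def by auto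
  then have "double_zero w k"
    using Sig_digit[OF assms(1), of k] Sig_not_11[OF assms(1), of k] unfolding double_zero_def by auto
  moreover have "k < 0" using k by simp
  ultimately show thesis using that by blast
qed

lemma alternating_future_parity:
  assumes w: "w \<in> Sig" and alt: "\<And>k. s \<le> k \<Longrightarrow> w k \<noteq> w (k + 1)" and s: "w s = 1"
  shows "w (s + 2 * int j) = 1 \<and> w (s + 2 * int j + 1) = 0"
proof (induction j)
  case 0 then show ?case using s Sig_not_11[OF w, of s] by simp
next
  case (Suc j)
  have e: "s + 2 * int (Suc j) = s + 2 * int j + 1 + 1" by simp
  have "w (s + 2 * int (Suc j)) = 1"
    using Suc alt[of "s + 2 * int j + 1"] Sig_digit[OF w, of "s + 2 * int (Suc j)"] unfolding e by auto
  then show ?case using Sig_not_11[OF w, of "s + 2 * int (Suc j)"] by blast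
qed

section \<open>A quantity that increases in time\<close>

text \<open>For two orbits \<open>(p, q)\<close> and \<open>(r, s)\<close> with the same word this difference is a Lyapunov function: by
  nonexpansiveness of the steps it never decreases in time.\<close>

definition gap :: "(int \<Rightarrow> real) \<Rightarrow> (int \<Rightarrow> real) \<Rightarrow> (int \<Rightarrow> real) \<Rightarrow> (int \<Rightarrow> real) \<Rightarrow> int \<Rightarrow> real" where
  "gap p q r s k = ldist (p k) (r k) - ldist (q k) (s k)"

context
  fixes b :: real
  assumes b: "1 < b"
begin

lemma double_zero_bounds:
  assumes "orbit b w l m p q" "l \<le> k" "k < m" "double_zero w k"
  shows "1 < p k" "p k < b" "1 < q (k + 1)" "q (k + 1) < b" "p k - 1 = (b - 1) * q k / (p (k + 1) + q k)"
  using step_00[OF b, of "p k" "q k" "p (k + 1)" "q (k + 1)"] orbit_stepD[OF assms(1-3)] assms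
    orbit_posD[OF assms(1), of k] orbit_posD[OF assms(1), of "k + 1"] unfolding double_zero_def by auto

text \<open>At a block \<open>00\<close> one has \<open>1 < p < b\<close>; backwards in time \<open>p\<close> then grows at most linearly.\<close>

lemma orbit_p_bound:
  assumes w: "w \<in> Sig" and o: "orbit b w l m p q" and K: "K < m" "double_zero w K" and k: "k \<le> K" "l \<le> k"
  shows "p k \<le> b + (b + 1) * (K - k)"
  using k
proof (induction k rule: int_le_induct)
  case base
  then show ?case using double_zero_bounds[OF o _ K] by simp
next
  case (step i)
  have st: "step b (w (i - 1)) (w i) (p (i - 1)) (q (i - 1)) (p i) (q i)"
    using orbit_stepD[OF o, of "i - 1"] step K by simp
  have a: "adm (w i) (p i) (q i)" using orbit_admD[OF o, of i] step K by simp
  have pos: "0 < q (i - 1)" "0 < p i"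
    using orbit_posD[OF o, of "i - 1"] orbit_posD[OF o, of i] step K by auto
  have "1 < p i \<or> w (i - 1) = 0"
    using a Sig_digit[OF w, of "i - 1"] Sig_not_11[OF w, of "i - 1"] by (auto simp: adm_def)
  from step_le[OF b st pos this] have "p (i - 1) \<le> p i + b + 1" .
  also have "p i \<le> b + (b + 1) * (K - i)" using step by simp
  finally show ?case by (simp add: algebra_simps)
qed

lemma orbit_q_bound:
  assumes w: "w \<in> Sig" and o: "orbit b w l m p q" and K: "l \<le> K" "double_zero w K" and k: "K < k" "k \<le> m"
  shows "q k \<le> b + (b + 1) * (k - K - 1)"
proof -
  have "double_zero (\<lambda>k. w (- k)) (- K - 1)" using K by (simp add: double_zero_def add.commute)
  from orbit_p_bound[OF Sig_reverse[OF w] orbit_reverse[OF o] _ this, of "- k"] K k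
  have "q k \<le> b + (b + 1) * (- K - 1 - (- k))" by simp
  then show ?thesis by (simp add: algebra_simps)
qed

lemma gap_step:
  assumes w: "w \<in> Sig" and o: "orbit b w l m p q" "orbit b w l m r s" and k: "l \<le> k" "k < m"
  shows "gap p q r s k \<le> gap p q r s (k + 1)"
proof -
  have d: "w k \<in> {0,1}" "w (k+1) \<in> {0,1}" "\<not> (w k = 1 \<and> w (k+1) = 1)"
    using Sig_digit[OF w, of k] Sig_digit[OF w, of "k+1"] Sig_not_11[OF w, of k] by auto
  have pos: "0 < q k" "0 < p (k+1)" "0 < s k" "0 < r (k+1)"
    using orbit_posD[OF o(1), of k] orbit_posD[OF o(1), of "k+1"] orbit_posD[OF o(2), of k] orbit_posD[OF o(2), of "k+1"] k by auto
  show ?thesis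
    using step_nonexpansive[OF b orbit_stepD[OF o(1) k] orbit_stepD[OF o(2) k] pos d]
    unfolding gap_def by linarith
qed

lemma gap_mono:
  assumes w: "w \<in> Sig" and o: "orbit b w l m p q" "orbit b w l m r s" and k: "l \<le> j" "j \<le> k" "k \<le> m"
  shows "gap p q r s j \<le> gap p q r s k"
  using k(2,3)
proof (induction k rule: int_ge_induct)
  case base then show ?case by simp
next
  case (step i)
  then show ?case using gap_step[OF w o, of i] k by auto
qed

text \<open>The strict part of the contraction at a block \<open>00\<close> turns into a definite gain of \<open>gap\<close>.\<close>

lemma gap_gain_00:
  assumes w: "w \<in> Sig" and o: "orbit b w l m p q" "orbit b w l m r s" and k: "l \<le> k" "k < m" "double_zero w k"
  shows "gap p q r s k + 2 / (b + 1) * (ldist (p k) (r k) + ldist (q (k+1)) (s (k+1))) \<le> gap p q r s (k + 1)"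
proof -
  define S where "S = ldist (q k) (s k) + ldist (p (k+1)) (r (k+1))"
  define T where "T = ldist (p k) (r k) + ldist (q (k+1)) (s (k+1))"
  have T: "T \<le> (b - 1) / (b + 1) * S"
    using step_contract_00[OF b, of "p k" "q k" "p (k+1)" "q (k+1)" "r k" "s k" "r (k+1)" "s (k+1)"]
      orbit_stepD[OF o(1) k(1,2)] orbit_stepD[OF o(2) k(1,2)] k
      orbit_posD[OF o(1), of k] orbit_posD[OF o(1), of "k+1"] orbit_posD[OF o(2), of k] orbit_posD[OF o(2), of "k+1"]
    by (simp add: double_zero_def S_def T_def)
  have S: "0 \<le> S" by (simp add: S_def)
  have e: "(b - 1) / (b + 1) * S = S - 2 / (b + 1) * S" using b by (simp add: field_simps)
  have "0 \<le> 2 / (b + 1) * S" using S b by simp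
  then have "T \<le> S" using T unfolding e by linarith
  then have "2 / (b + 1) * T \<le> 2 / (b + 1) * S" using b by (intro mult_left_mono) auto
  then show ?thesis using T unfolding e by (simp add: gap_def S_def T_def)
qed

text \<open>A block \<open>01\<close> also produces a gain, but with a constant that gets worse as the orbits approach infinity.\<close>

lemma gap_gain_01:
  assumes o: "orbit b w l m p q" "orbit b w l m r s" and k: "l \<le> k" "k < m" "w k = 0" "w (k + 1) = 1"
    and M: "p (k + 1) \<le> M" "r (k + 1) \<le> M"
  shows "gap p q r s k + 2 / (M + b + 1) * ldist (p (k+1)) (r (k+1)) \<le> gap p q r s (k + 1)"
    "ldist (p k) (r k) \<le> ldist (p (k+1)) (r (k+1))"
proof -
  have st: "step b 0 1 (p k) (q k) (p (k+1)) (q (k+1))" "step b 0 1 (r k) (s k) (r (k+1)) (s (k+1))"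
    using orbit_stepD[OF o(1) k(1,2)] orbit_stepD[OF o(2) k(1,2)] k by auto
  have pos: "0 < q k" "0 < p (k+1)" "0 < s k" "0 < r (k+1)"
    using orbit_posD[OF o(1), of k] orbit_posD[OF o(1), of "k+1"] orbit_posD[OF o(2), of k] orbit_posD[OF o(2), of "k+1"] k by auto
  have "ldist (p k) (r k) + ldist (q (k+1)) (s (k+1)) \<le> ldist (q k) (s k) + (1 - 2 / (M + b + 1)) * ldist (p (k+1)) (r (k+1))"
    by (rule step_contract_01[OF b st pos M])
  then show "gap p q r s k + 2 / (M + b + 1) * ldist (p (k+1)) (r (k+1)) \<le> gap p q r s (k + 1)"
    by (simp add: gap_def left_diff_distrib)
  have e: "p k = p (k+1) + b + 1" "r k = r (k+1) + b + 1" using st by (auto simp: step_def gen_def)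
  have "ldist (p k) (r k) \<le> (1 - 2 / (M + b + 1)) * ldist (p (k+1)) (r (k+1))"
    using ratio_01[OF b pos(2,4) M]
      ldist_nonneg[of "(p (k+1) + 1) / (p (k+1) + b)" "(r (k+1) + 1) / (r (k+1) + b)"] unfolding e by linarith
  also have "\<dots> \<le> 1 * ldist (p (k+1)) (r (k+1))"
    using pos M b by (intro mult_right_mono) auto
  finally show "ldist (p k) (r k) \<le> ldist (p (k+1)) (r (k+1))" by simp
qed

section \<open>Alternating blocks\<close>

text \<open>Over two steps \<open>101\<close>, put \<open>z = p / (q + 1)\<close> and let a prime denote the value two steps later. The recursion
  gives \<open>z' (q + b + 2) \<le> z (q + b) - 2\<close>, so \<open>z\<close> loses at least \<open>2 / (q + b + 2)\<close>, while \<open>q\<close> grows at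
  most linearly.\<close>

lemma alternating_decrease:
  assumes o: "orbit b w l m p q" and k: "l \<le> k" "k + 2 \<le> m" "w k = 1" "w (k + 1) = 0" "w (k + 2) = 1"
  shows "p (k+2) / (q (k+2) + 1) \<le> p k / (q k + 1) - 2 / (q k + b + 2)" "q (k+2) \<le> q k + b + 1"
proof -
  define P where "P = p (k+2)"
  define Q where "Q = q (k+2)"
  define Y where "Y = q k"
  define X where "X = p k"
  have pos: "0 < P" "0 < Q" "0 < Y" "0 < X"
    using orbit_posD[OF o, of k] orbit_posD[OF o, of "k+2"] k by (auto simp: P_def Q_def Y_def X_def)
  have s1: "step b 1 0 (p k) (q k) (p (k+1)) (q (k+1))" using orbit_stepD[OF o, of k] k by simp
  have s2: "step b 0 1 (p (k+1)) (q (k+1)) (p (k+2)) (q (k+2))"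
    using orbit_stepD[OF o, of "k+1"] k by (simp add: add.assoc)
  have e: "X = (P + b + 1) * (Y + 1) / (Y + b)" "Q = (Y + b + 1) * (P + 1) / (P + b)"
    using s1 s2 by (auto simp: step_def gen_def P_def Q_def Y_def X_def algebra_simps)
  have z: "X / (Y + 1) = (P + b + 1) / (Y + b)" using pos e(1) by simp
  have q: "Q * (P + b) = (Y + b + 1) * (P + 1)" using pos b e(2) by (simp add: field_simps)
  have D: "0 < (Q + 1) * (P + 1)" "0 < Y + b + 2" "0 < Y + b" using pos b by auto
  have ql: "Q \<le> Y + b + 1"
  proof -
    have "Q = (Y + b + 1) * ((P + 1) / (P + b))" using e(2) by simp
    also have "\<dots> \<le> (Y + b + 1) * 1" using pos b by (intro mult_left_mono) auto
    finally show ?thesis by simp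
  qed
  then show "q (k+2) \<le> q k + b + 1" by (simp add: Q_def Y_def)
  have k1: "P / (Q + 1) * (Y + b + 2) \<le> P + b - 1"
  proof -
    have "P * (Y + b + 2) \<le> (P + b - 1) * (Q + 1)"
    proof -
      have "((P + b - 1) * (Q + 1) - P * (Y + b + 2)) * (P + 1)
          = (P + b - 1) * (P + 1) + (P + b - 1) * (Q * (P + 1)) - P * ((Y + b + 1) * (P + 1)) - P * (P + 1)"
        by (simp add: algebra_simps)
      also have "\<dots> = (P + b - 1) * (P + 1) + (P + b - 1) * (Q * (P + 1)) - P * (Q * (P + b)) - P * (P + 1)"
        by (simp only: q)
      also have "\<dots> = (b - 1) * (P + 1 + Q)" by (simp add: algebra_simps)
      finally have "0 \<le> ((P + b - 1) * (Q + 1) - P * (Y + b + 2)) * (P + 1)"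
        using pos b by simp
      then have "0 \<le> (P + b - 1) * (Q + 1) - P * (Y + b + 2)"
        using pos by (simp add: zero_le_mult_iff)
      then show ?thesis by simp
    qed
    then show ?thesis using pos by (simp add: field_simps)
  qed
  have "(P + b + 1) / (Y + b) - 2 / (Y + b + 2) \<ge> (P + b - 1) / (Y + b + 2)"
  proof -
    have "(P + b + 1) / (Y + b + 2) \<le> (P + b + 1) / (Y + b)"
      using pos b by (intro divide_left_mono) auto
    moreover have "(P + b + 1) / (Y + b + 2) = (P + b - 1) / (Y + b + 2) + 2 / (Y + b + 2)"
      by (simp flip: add_divide_distrib)
    ultimately show ?thesis by simp
  qed
  moreover have "P / (Q + 1) \<le> (P + b - 1) / (Y + b + 2)"
    using k1 D by (simp add: pos_le_divide_eq)
  ultimately show "p (k+2) / (q (k+2) + 1) \<le> p k / (q k + 1) - 2 / (q k + b + 2)"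
    using z by (simp add: P_def Q_def X_def Y_def)
qed

lemma harmonic_progression_unbounded:
  fixes M A :: real
  assumes "0 < A"
  shows "\<exists>n. M < (\<Sum>i<n. 2 / (A + (b + 1) * real i))"
proof (rule ccontr)
  assume "\<not> ?thesis"
  then have bd: "(\<Sum>i<n. 2 / (A + (b + 1) * real i)) \<le> M" for n by (simp add: not_less)
  have s: "summable (\<lambda>i. 2 / (A + (b + 1) * real i))"
  proof (rule bounded_imp_summable[of _ M])
    show "0 \<le> 2 / (A + (b + 1) * real n)" for n using assms b by simp
    show "(\<Sum>i\<le>n. 2 / (A + (b + 1) * real i)) \<le> M" for n
      using bd[of "Suc n"] by (simp only: lessThan_Suc_atMost)
  qed
  define C where "C = A + b + 1"
  have C: "0 < C" using assms b by (simp add: C_def)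
  have "summable (\<lambda>i. inverse (real (Suc i)))"
  proof (rule summable_comparison_test'[of "\<lambda>i. C * (2 / (A + (b + 1) * real i))" 0])
    show "summable (\<lambda>i. C * (2 / (A + (b + 1) * real i)))" using s by (rule summable_mult)
    fix i :: nat
    have "A + (b + 1) * real i \<le> C * real (Suc i)"
      using assms b by (simp add: C_def algebra_simps)
    then have "1 / (C * real (Suc i)) \<le> 1 / (A + (b + 1) * real i)"
      using assms b C by (intro divide_left_mono mult_pos_pos) (auto intro!: add_pos_nonneg)
    then have "C * (1 / (C * real (Suc i))) \<le> C * (1 / (A + (b + 1) * real i))"
      using C by (intro mult_left_mono) auto
    also have "\<dots> \<le> C * (2 / (A + (b + 1) * real i))"
      using C assms b by (intro mult_left_mono divide_right_mono) auto
    also have "C * (1 / (C * real (Suc i))) = inverse (real (Suc i))"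
      using C by (simp add: inverse_eq_divide)
    finally show "norm (inverse (real (Suc i))) \<le> C * (2 / (A + (b + 1) * real i))"
      by simp
  qed
  then have "summable (\<lambda>i. inverse (real i))" using summable_Suc_iff by blast
  then show False using not_summable_harmonic by blast
qed

text \<open>Since the harmonic series diverges, a long alternating block would force \<open>p / (q + 1)\<close> below zero. So along an
  alternating block \<open>p\<close> and \<open>q\<close> cannot both start bounded: orbits with alternating words run into infinity.\<close>

lemma long_alternating_block_unbounded:
  assumes "0 < M"
  shows "\<exists>n. \<forall>w l m p q k. orbit b w l m p q \<longrightarrow> l \<le> k \<longrightarrow> k + 2 * int n \<le> m \<longrightarrow>
    (\<forall>j. w (k + 2 * int j) = 1 \<and> w (k + 2 * int j + 1) = 0) \<longrightarrow> p k \<le> M \<longrightarrow> q k \<le> M \<longrightarrow> False"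
proof -
  define S where "S n = (\<Sum>i<n. 2 / (M + b + 2 + (b + 1) * real i))" for n
  obtain n where n: "M < S n"
    using harmonic_progression_unbounded[of "M + b + 2" M] assms b unfolding S_def by auto
  show ?thesis
  proof (intro exI[of _ n] allI impI)
    fix w l m p q k
    assume o: "orbit b w l m p q" and k: "l \<le> k" "k + 2 * int n \<le> m"
      and alt: "\<forall>j. w (k + 2 * int j) = 1 \<and> w (k + 2 * int j + 1) = 0" and M: "p k \<le> M" "q k \<le> M"
    have "q (k + 2 * int j) \<le> M + (b + 1) * j \<and> p (k + 2 * int j) / (q (k + 2 * int j) + 1) \<le> M - S j" if "j \<le> n" for j
      using that
    proof (induction j)
      case 0
      have "0 < p k" "0 < q k" using orbit_posD[OF o, of k] k by auto
      then have "p k / (q k + 1) \<le> p k / 1" by (intro divide_left_mono) auto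
      then show ?case using M by (simp add: S_def)
    next
      case (Suc j)
      define i where "i = k + 2 * int j"
      have e: "k + 2 * int (Suc j) = i + 2" by (simp add: i_def)
      have i: "l \<le> i" "i + 2 \<le> m" "w i = 1" "w (i + 1) = 0" "w (i + 2) = 1"
        using k Suc(2) alt[rule_format, of j] alt[rule_format, of "Suc j"] unfolding e by (auto simp: i_def)
      note d = alternating_decrease[OF o i]
      have IH: "q i \<le> M + (b + 1) * j" "p i / (q i + 1) \<le> M - S j" using Suc by (auto simp: i_def)
      have "0 < q i" using orbit_posD[OF o, of i] i by auto
      then have "2 / (M + b + 2 + (b + 1) * j) \<le> 2 / (q i + b + 2)"
        using IH b assms by (intro divide_left_mono) (auto intro!: mult_pos_pos add_pos_nonneg)
      then show ?case unfolding e using d IH by (simp add: S_def algebra_simps)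
    qed
    from this[of n] n have "p (k + 2 * int n) / (q (k + 2 * int n) + 1) < 0" by auto
    moreover have "0 < p (k + 2 * int n)" "0 < q (k + 2 * int n)" using orbit_posD[OF o, of "k + 2 * int n"] k by auto
    ultimately show False using divide_pos_pos[of "p (k + 2 * int n)" "q (k + 2 * int n) + 1"] by linarith
  qed
qed

end

section \<open>Orbits with the same word are close\<close>

context
  fixes b :: real
  assumes b: "1 < b"
begin

lemma gap_double_zero_le:
  assumes o: "orbit b w l m p q" "orbit b w l m r s" and k: "l \<le> k" "k < m" "double_zero w k"
  shows "gap p q r s k \<le> ldist (p k) (r k)" "ldist (p k) (r k) \<le> ln b"
proof -
  show "gap p q r s k \<le> ldist (p k) (r k)" by (simp add: gap_def)
  have "0 < ln (p k)" "ln (p k) < ln b" "0 < ln (r k)" "ln (r k) < ln b"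
    using double_zero_bounds[OF b o(1) k] double_zero_bounds[OF b o(2) k] b by auto
  then show "ldist (p k) (r k) \<le> ln b" unfolding ldist_def by linarith
qed

text \<open>At a block \<open>00\<close> the value of \<open>gap\<close> is at most \<open>ln b\<close>. A value above \<open>e\<close> at \<open>K\<close> would grow by a fixed amount at every
  later block \<open>00\<close>, and so exceed this bound after finitely many of them.\<close>

lemma gap_small_infinitely_many_00:
  assumes w: "w \<in> Sig" and inf: "\<And>m. \<exists>k\<ge>m. double_zero w k" and e: "0 < e"
  shows "\<exists>N>K. \<forall>l m p q r s. orbit b w l m p q \<longrightarrow> orbit b w l m r s \<longrightarrow> l \<le> K \<longrightarrow> N \<le> m \<longrightarrow> gap p q r s K \<le> e"
proof -
  define d where "d = 2 / (b + 1) * e"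
  have d: "0 < d" using b e by (simp add: d_def)
  \<comment> \<open>the position \<open>n\<close> depends only on the word, so the estimate is uniform over all pairs of orbits\<close>
  have S: "\<exists>n\<ge>K. double_zero w n \<and> (\<forall>l m p q r s. orbit b w l m p q \<longrightarrow> orbit b w l m r s \<longrightarrow> l \<le> K \<longrightarrow> n < m \<longrightarrow>
     e < gap p q r s K \<longrightarrow> e + real R * d \<le> gap p q r s n)" for R
  proof (induction R)
    case 0
    obtain n where n: "K \<le> n" "double_zero w n" using inf by blast
    show ?case
    proof (intro exI[of _ n] conjI allI impI)
      fix l m p q r s
      assume h: "orbit b w l m p q" "orbit b w l m r s" "l \<le> K" "n < m" "e < gap p q r s K"
      then show "e + real 0 * d \<le> gap p q r s n"
        using gap_mono[OF b w h(1,2), of K n] n by simp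
    qed (use n in auto)
  next
    case (Suc R)
    then obtain n where n: "K \<le> n" "double_zero w n"
      and IH: "\<And>l m p q r s. orbit b w l m p q \<Longrightarrow> orbit b w l m r s \<Longrightarrow> l \<le> K \<Longrightarrow> n < m \<Longrightarrow>
     e < gap p q r s K \<Longrightarrow> e + real R * d \<le> gap p q r s n" by blast
    obtain n' where n': "n + 1 \<le> n'" "double_zero w n'" using inf by blast
    show ?case
    proof (intro exI[of _ n'] conjI allI impI)
      fix l m p q r s
      assume h: "orbit b w l m p q" "orbit b w l m r s" "l \<le> K" "n' < m" "e < gap p q r s K"
      have i: "e + real R * d \<le> gap p q r s n" using IH[OF h(1,2,3) _ h(5)] h n' by simp
      have "gap p q r s n \<le> ldist (p n) (r n)" using gap_double_zero_le[OF h(1,2)] n n' h by simp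
      moreover have "0 \<le> real R * d" using d by simp
      ultimately have "e \<le> ldist (p n) (r n) + ldist (q (n+1)) (s (n+1))"
        using i ldist_nonneg[of "q (n+1)" "s (n+1)"] by linarith
      then have "d \<le> 2 / (b + 1) * (ldist (p n) (r n) + ldist (q (n+1)) (s (n+1)))"
        unfolding d_def using b by (intro mult_left_mono) auto
      then have "gap p q r s n + d \<le> gap p q r s (n + 1)"
        using gap_gain_00[OF b w h(1,2), of n] n n' h by simp
      moreover have "gap p q r s (n + 1) \<le> gap p q r s n'"
        using gap_mono[OF b w h(1,2), of "n+1" n'] n n' h by simp
      ultimately show "e + real (Suc R) * d \<le> gap p q r s n'" using i by (simp add: algebra_simps)
    qed (use n n' in auto)
  qed
  obtain R :: nat where "ln b / d < real R" using reals_Archimedean2 by blast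
  then have R: "ln b < e + real R * d" using d e by (simp add: divide_less_eq)
  obtain n where n: "K \<le> n" "double_zero w n"
      and I: "\<And>l m p q r s. orbit b w l m p q \<Longrightarrow> orbit b w l m r s \<Longrightarrow> l \<le> K \<Longrightarrow> n < m \<Longrightarrow>
     e < gap p q r s K \<Longrightarrow> e + real R * d \<le> gap p q r s n" using S[of R] by blast
  show ?thesis
  proof (intro exI[of _ "n + 1"] conjI allI impI)
    fix l m p q r s
    assume h: "orbit b w l m p q" "orbit b w l m r s" "l \<le> K" "n + 1 \<le> m"
    have "gap p q r s n \<le> ln b" using gap_double_zero_le[OF h(1,2), of n] n h by simp
    then show "gap p q r s K \<le> e" using I[OF h(1,2,3)] R h by fastforce
  qed (use n in auto)
qed

lemma ldist_near_1:
  assumes "1 < x" "1 < y" "x - 1 \<le> e" "y - 1 \<le> e"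
  shows "ldist x y \<le> e"
proof -
  have "ln x \<le> x - 1" "ln y \<le> y - 1" using assms by (auto intro: ln_le_minus_one)
  moreover have "0 < ln x" "0 < ln y" using assms by auto
  ultimately show ?thesis using assms unfolding ldist_def by linarith
qed

text \<open>If the word alternates after the block \<open>00\<close> at \<open>K\<close>, then \<open>p (K + 1)\<close> is huge on every long orbit, since
  \<open>q (K + 1) < b\<close> is bounded. As \<open>p K - 1 = (b - 1) q K / (p (K + 1) + q K)\<close>, this forces \<open>p K\<close> close to
  \<open>1\<close>.\<close>

lemma ldist_small_last_00:
  assumes w: "w \<in> Sig" and K: "double_zero w K" and last: "\<And>k. K < k \<Longrightarrow> \<not> double_zero w k" and e: "0 < e"
  shows "\<exists>N>K. \<forall>l m p q r s. orbit b w l m p q \<longrightarrow> orbit b w l m r s \<longrightarrow> l \<le> K \<longrightarrow> N \<le> m \<longrightarrow>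
    q K \<le> B \<longrightarrow> s K \<le> B \<longrightarrow> ldist (p K) (r K) \<le> e"
proof -
  have alt: "w k \<noteq> w (k + 1)" if "K + 2 \<le> k" for k
    using last[of k] that Sig_digit[OF w, of k] Sig_not_11[OF w, of k] by (auto simp: double_zero_def)
  have w2: "w (K + 2) = 1"
    using last[of "K+1"] K Sig_digit[OF w, of "K + 2"] by (auto simp: double_zero_def add.assoc)
  note par = alternating_future_parity[OF w alt w2]
  define M where "M = max b ((b - 1) * B / e)"
  have M0: "0 < M" using b by (simp add: M_def less_max_iff_disj)
  obtain n where n: "\<And>w l m p q k. orbit b w l m p q \<Longrightarrow> l \<le> k \<Longrightarrow> k + 2 * int n \<le> m \<Longrightarrow>
    (\<forall>j. w (k + 2 * int j) = 1 \<and> w (k + 2 * int j + 1) = 0) \<Longrightarrow> p k \<le> M \<Longrightarrow> q k \<le> M \<Longrightarrow> False"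
    using long_alternating_block_unbounded[OF b M0] by blast
  have p1: "p K - 1 \<le> e" if o: "orbit b w l m p q" and l: "l \<le> K" "K + 2 + 2 * int n \<le> m" and B: "q K \<le> B" for l m p q
  proof -
    note dz = double_zero_bounds[OF b o l(1) _ K]
    have st: "step b 0 1 (p (K+1)) (q (K+1)) (p (K+2)) (q (K+2))"
      using orbit_stepD[OF o, of "K+1"] l K w2 by (simp add: double_zero_def add.assoc)
    have pos: "0 < p (K+2)" "0 < q (K+1)" "0 < q (K+2)" "0 < q K"
      using orbit_posD[OF o, of "K+2"] orbit_posD[OF o, of "K+1"] orbit_posD[OF o, of "K"] l by auto
    have e1: "p (K+1) = p (K+2) + b + 1" "q (K+2) = q (K+1) * ((p (K+2) + 1) / (p (K+2) + b))"
      using st by (auto simp: step_def gen_def)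
    have "q (K+2) \<le> q (K+1) * 1" unfolding e1 using pos b by (intro mult_left_mono) auto
    also have "\<dots> < b" using dz(4) l by simp
    finally have "q (K+2) \<le> M" by (simp add: M_def)
    moreover have "l \<le> K + 2" using l by simp
    ultimately have "M < p (K+2)"
      using n[OF o, of "K+2"] l(2) par by (cases "p (K+2) \<le> M") auto
    then have "(b - 1) * B / e < p (K+1) + q K" using e1 pos b by (auto simp: M_def)
    moreover have "0 < p (K+1) + q K" using e1 pos b by simp
    ultimately have "(b - 1) * B / (p (K+1) + q K) \<le> e" using e by (simp add: field_simps)
    moreover have "p K - 1 \<le> (b - 1) * B / (p (K+1) + q K)"
      using dz(5) l B b e1 pos by (simp add: divide_right_mono)
    ultimately show ?thesis by simp
  qed
  show ?thesis
  proof (intro exI[of _ "K + 2 + 2 * int n"] conjI allI impI)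
    fix l m p q r s
    assume h: "orbit b w l m p q" "orbit b w l m r s" "l \<le> K" "K + 2 + 2 * int n \<le> m" "q K \<le> B" "s K \<le> B"
    show "ldist (p K) (r K) \<le> e"
      using p1[OF h(1,3,4,5)] p1[OF h(2,3,4,6)] double_zero_bounds(1)[OF b h(1,3) _ K] double_zero_bounds(1)[OF b h(2,3) _ K] h
      by (intro ldist_near_1) auto
  qed auto
qed

text \<open>The future of a word that is not alternating has either infinitely many blocks \<open>00\<close> or a last one; for the latter the
  past supplies the bound on \<open>q K\<close>.
  The case \<open>K = 0\<close> is recorded separately, because no step after time \<open>0\<close> is then available to control
  \<open>ldist (p 0) (r 0)\<close>.\<close>

lemma gap_small_future:
  assumes w: "w \<in> Sig" "\<not> alternating_on {0..} w" "\<not> alternating_on {..0} w" and e: "0 < e"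
  shows "\<exists>K\<ge>0. \<exists>N>K. \<forall>l m p q r s. orbit b w l m p q \<longrightarrow> orbit b w l m r s \<longrightarrow> l \<le> - N \<longrightarrow> N \<le> m \<longrightarrow>
    gap p q r s K \<le> e \<and> (K = 0 \<longrightarrow> w 0 = 0 \<and> ldist (p 0) (r 0) \<le> e)"
proof -
  obtain k0 where k0: "0 \<le> k0" "double_zero w k0" using not_alternating_future[OF w(1,2)] .
  show ?thesis
  proof (cases "\<forall>m. \<exists>k\<ge>m. double_zero w k")
    case True
    then obtain N where N: "1 < N" "\<And>l m p q r s. orbit b w l m p q \<Longrightarrow> orbit b w l m r s \<Longrightarrow> l \<le> 1 \<Longrightarrow> N \<le> m \<Longrightarrow> gap p q r s 1 \<le> e"
      using gap_small_infinitely_many_00[OF w(1) _ e, of 1] by blast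
    show ?thesis
      by (rule exI[of _ 1], intro conjI exI[of _ N] allI impI) (use N in auto)
  next
    case False
    then obtain m where m: "\<And>k. m \<le> k \<Longrightarrow> \<not> double_zero w k" by auto
    define A where "A = {k \<in> {0..m}. double_zero w k}"
    have A: "finite A" "k0 \<in> A"
    proof -
      show "finite A" unfolding A_def by (rule finite_subset[of _ "{0..m}"]) auto
      have "k0 \<le> m" using k0 m[of k0] by linarith
      then show "k0 \<in> A" using k0 by (simp add: A_def)
    qed
    define K where "K = Max A"
    have "K \<in> A" unfolding K_def using A by (intro Max_in) auto
    then have K: "0 \<le> K" "double_zero w K" by (auto simp: A_def)
    have last: "\<not> double_zero w k" if "K < k" for k
    proof
      assume d: "double_zero w k"
      then have "k \<le> m" using m[of k] by linarith
      then have "k \<in> A" using d that K by (auto simp: A_def)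
      then have "k \<le> K" unfolding K_def using A by simp
      then show False using that by simp
    qed
    obtain k1 where k1: "k1 < 0" "double_zero w k1" using not_alternating_past[OF w(1,3)] .
    obtain N0 where N0: "K < N0" "\<And>l m p q r s. orbit b w l m p q \<Longrightarrow> orbit b w l m r s \<Longrightarrow> l \<le> K \<Longrightarrow> N0 \<le> m \<Longrightarrow>
      q K \<le> b + (b + 1) * (K - k1 - 1) \<Longrightarrow> s K \<le> b + (b + 1) * (K - k1 - 1) \<Longrightarrow> ldist (p K) (r K) \<le> e"
      using ldist_small_last_00[OF w(1) K(2) last e, of "b + (b + 1) * (K - k1 - 1)"] by blast
    define N where "N = max N0 (- k1)"
    have N: "N0 \<le> N" "- k1 \<le> N" by (auto simp: N_def)
    show ?thesis
    proof (rule exI[of _ K], intro conjI exI[of _ N] allI impI)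
      fix l m p q r s
      assume h: "orbit b w l m p q" "orbit b w l m r s" "l \<le> - N" "N \<le> m"
      have D: "ldist (p K) (r K) \<le> e"
        by (rule N0(2)[OF h(1,2)])
          (use h N0(1) K k1 orbit_q_bound[OF b w(1) h(1), of k1 K] orbit_q_bound[OF b w(1) h(2), of k1 K] N in \<open>auto\<close>)
      then show "gap p q r s K \<le> e" using ldist_nonneg[of "q K" "s K"] unfolding gap_def by linarith
      assume "K = 0"
      then show "w 0 = 0" "ldist (p 0) (r 0) \<le> e" using D K by (auto simp: double_zero_def)
    qed (use K N0 N in auto)
  qed
qed

lemma gap_reverse: "gap (\<lambda>k. q (- k)) (\<lambda>k. p (- k)) (\<lambda>k. s (- k)) (\<lambda>k. r (- k)) k = - gap p q r s (- k)"
  by (simp add: gap_def)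

text \<open>Future and past together squeeze \<open>gap\<close> between \<open>- d\<close> and \<open>d\<close> on a time interval around \<open>0\<close>. Its total
  increase there is then at most \<open>2 d\<close>, and the gain of a single step next to time \<open>0\<close> bounds
  \<open>ldist (p 0) (r 0)\<close>, unless this is already known to be small.\<close>

lemma ldist_p_small:
  assumes w: "w \<in> Sig" "\<not> alternating_on {0..} w" "\<not> alternating_on {..0} w" and e: "0 < e"
  shows "\<exists>N\<ge>0. \<forall>l m p q r s. orbit b w l m p q \<longrightarrow> orbit b w l m r s \<longrightarrow> l \<le> - N \<longrightarrow> N \<le> m \<longrightarrow> ldist (p 0) (r 0) \<le> e"
proof -
  obtain k0 where k0: "0 \<le> k0" "double_zero w k0" using not_alternating_future[OF w(1,2)] .
  define M where "M = b + (b + 1) * k0"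
  have M: "1 \<le> M" using b k0 by (simp add: M_def add_increasing2)
  \<comment> \<open>\<open>2 / (M + b + 1)\<close> is a gain constant for the steps \<open>00\<close> and, on orbits bounded by \<open>M\<close>, for the steps \<open>01\<close>\<close>
  define d where "d = e / (M + b + 1)"
  have d: "0 < d" "d \<le> e" "d * (M + b + 1) = e" using e M b by (auto simp: d_def divide_le_eq)
  obtain K N1 where K: "0 \<le> K" "K < N1"
    and f: "\<And>l m p q r s. orbit b w l m p q \<Longrightarrow> orbit b w l m r s \<Longrightarrow> l \<le> - N1 \<Longrightarrow> N1 \<le> m \<Longrightarrow>
    gap p q r s K \<le> d \<and> (K = 0 \<longrightarrow> w 0 = 0 \<and> ldist (p 0) (r 0) \<le> d)"
    using gap_small_future[OF w d(1)] by blast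
  let ?w = "\<lambda>k. w (- k)"
  have rw: "?w \<in> Sig" "\<not> alternating_on {0..} ?w" "\<not> alternating_on {..0} ?w"
    using w Sig_reverse alternating_on_reverse[of w] alternating_on_reverse[of ?w] by auto
  obtain J N2 where J: "0 \<le> J" "J < N2"
    and g: "\<And>l m p q r s. orbit b ?w l m p q \<Longrightarrow> orbit b ?w l m r s \<Longrightarrow> l \<le> - N2 \<Longrightarrow> N2 \<le> m \<Longrightarrow>
    gap p q r s J \<le> d \<and> (J = 0 \<longrightarrow> ?w 0 = 0 \<and> ldist (p 0) (r 0) \<le> d)"
    using gap_small_future[OF rw d(1)] by blast
  define N where "N = max (max N1 N2) (k0 + 1)"
  have N: "N1 \<le> N" "N2 \<le> N" "k0 + 1 \<le> N" by (auto simp: N_def)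
  show ?thesis
  proof (intro exI[of _ N] conjI allI impI)
    show "0 \<le> N" using K N by auto
    fix l m p q r s
    assume o: "orbit b w l m p q" "orbit b w l m r s" and lm: "l \<le> - N" "N \<le> m"
    have gK: "gap p q r s K \<le> d" and K0: "K = 0 \<Longrightarrow> w 0 = 0 \<and> ldist (p 0) (r 0) \<le> d"
      using f[OF o] lm N by auto
    have gJ: "- d \<le> gap p q r s (- J)" and J0: "J = 0 \<Longrightarrow> w 0 = 0"
      using g[OF orbit_reverse[OF o(1)] orbit_reverse[OF o(2)]] lm gap_reverse[of q p s r J] N by auto
    have win: "gap p q r s (j + 1) - gap p q r s j \<le> 2 * d" if "- J \<le> j" "j < K" for j
      using gap_mono[OF b w(1) o, of "- J" j] gap_mono[OF b w(1) o, of "j+1" K] gK gJ that lm K J N by auto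
    have pM: "p j \<le> M" "r j \<le> M" if "0 \<le> j" "j \<le> k0" for j
    proof -
      have "(b + 1) * (k0 - j) \<le> (b + 1) * k0" using that b by (intro mult_left_mono) auto
      then show "p j \<le> M" "r j \<le> M"
        using orbit_p_bound[OF b w(1) o(1) _ k0(2), of j] orbit_p_bound[OF b w(1) o(2) _ k0(2), of j] that lm N
        by (auto simp: M_def)
    qed
    have conv: "x \<le> e" if "2 / (M + b + 1) * x \<le> 2 * d" for x
    proof -
      have "2 / (M + b + 1) * x * (M + b + 1) \<le> 2 * d * (M + b + 1)"
        using that M b by (intro mult_right_mono) auto
      then show ?thesis using d M b by simp
    qed
    consider "K = 0" | "0 < K" "w 0 = 0" "w 1 = 0" | "0 < K" "w 0 = 0" "w 1 = 1" | "w 0 = 1"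
      using K Sig_digit[OF w(1), of 0] Sig_digit[OF w(1), of 1] by fastforce
    then show "ldist (p 0) (r 0) \<le> e"
    proof cases
      case 1 then show ?thesis using K0 d by simp
    next
      case 2
      have "gap p q r s 0 + 2 / (b + 1) * (ldist (p 0) (r 0) + ldist (q 1) (s 1)) \<le> gap p q r s 1"
        using gap_gain_00[OF b w(1) o, of 0] 2 lm K N by (simp add: double_zero_def)
      moreover have "2 / (M + b + 1) * ldist (p 0) (r 0) \<le> 2 / (b + 1) * (ldist (p 0) (r 0) + ldist (q 1) (s 1))"
        using M b by (intro mult_mono frac_le) auto
      ultimately show ?thesis using win[of 0] 2 J by (intro conv) simp
    next
      case 3
      have "1 \<le> k0" using k0 3 by (cases "k0 = 0") (auto simp: double_zero_def)
      then have "p 1 \<le> M" "r 1 \<le> M" using pM by auto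
      then have "gap p q r s 0 + 2 / (M + b + 1) * ldist (p 1) (r 1) \<le> gap p q r s 1" "ldist (p 0) (r 0) \<le> ldist (p 1) (r 1)"
        using gap_gain_01[OF b o, of 0 M] 3 lm K N by auto
      moreover have "ldist (p 1) (r 1) \<le> e" using calculation(1) win[of 0] 3 J by (intro conv) simp
      ultimately show ?thesis by simp
    next
      case 4
      \<comment> \<open>here the step before time \<open>0\<close> is used, which carries the digits \<open>01\<close>\<close>
      have w1: "w (- 1) = 0" using Sig_digit[OF w(1), of "- 1"] Sig_not_11[OF w(1), of "- 1"] 4 by auto
      have JK: "0 < J" "0 < K" using J0 K0 4 J K by (auto simp: less_le)
      have "p 0 \<le> M" "r 0 \<le> M" using pM k0 by auto
      then have "gap p q r s (- 1) + 2 / (M + b + 1) * ldist (p 0) (r 0) \<le> gap p q r s 0"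
        using gap_gain_01[OF b o, of "- 1" M] 4 w1 lm J N by auto
      then show ?thesis using win[of "- 1"] JK by (intro conv) simp
    qed
  qed
qed

lemma bounds_at_0:
  assumes w: "w \<in> Sig" "\<not> alternating_on {0..} w" "\<not> alternating_on {..0} w"
  shows "\<exists>N\<ge>0. \<exists>M>0. \<forall>l m p q. orbit b w l m p q \<longrightarrow> l \<le> - N \<longrightarrow> N \<le> m \<longrightarrow> p 0 \<le> M \<and> q 0 \<le> M"
proof -
  obtain k0 where k0: "0 \<le> k0" "double_zero w k0" using not_alternating_future[OF w(1,2)] .
  obtain k1 where k1: "k1 < 0" "double_zero w k1" using not_alternating_past[OF w(1,3)] .
  define N where "N = max (k0 + 1) (- k1)"
  define M where "M = max b (max (b + (b + 1) * k0) (b + (b + 1) * (- k1 - 1)))"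
  have N: "k0 + 1 \<le> N" "- k1 \<le> N" by (auto simp: N_def)
  have M: "0 < M" "b + (b + 1) * k0 \<le> M" "b + (b + 1) * (- k1 - 1) \<le> M" using b by (auto simp: M_def)
  show ?thesis
  proof (intro exI[of _ N] conjI exI[of _ M] allI impI)
    fix l m p q assume o: "orbit b w l m p q" and lm: "l \<le> - N" "N \<le> m"
    have "p 0 \<le> b + (b + 1) * (k0 - 0)"
      using orbit_p_bound[OF b w(1) o _ k0(2), of 0] k0 k1 lm N by simp
    then show "p 0 \<le> M" using M by simp
    have "q 0 \<le> b + (b + 1) * (0 - k1 - 1)"
      using orbit_q_bound[OF b w(1) o _ k1(2), of 0] k0 k1 lm N by simp
    then show "q 0 \<le> M" using M by simp
  qed (use k0 N M in auto)
qed

lemma abs_diff_le_ldist: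
  assumes "0 < x" "0 < y" "x \<le> M" "y \<le> M"
  shows "\<bar>x - y\<bar> \<le> M * ldist x y"
proof -
  have h: "v - u \<le> M * (ln v - ln u)" if "0 < u" "u \<le> v" "v \<le> M" for u v
  proof -
    have "ln (u / v) \<le> u / v - 1" using that by (intro ln_le_minus_one) auto
    then have "1 - u / v \<le> ln v - ln u" using that by (simp add: ln_div)
    then have "v * (1 - u / v) \<le> v * (ln v - ln u)" using that by (intro mult_left_mono) auto
    also have "\<dots> \<le> M * (ln v - ln u)" using that by (intro mult_right_mono) auto
    finally show ?thesis using that by (simp add: right_diff_distrib)
  qed
  show ?thesis using h[of x y] h[of y x] assms unfolding ldist_def
    by (cases "x \<le> y") auto
qed

text \<open>The coordinate \<open>q\<close> is \<open>p\<close> for the reversed orbit. The bounds at time \<open>0\<close> turn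
  logarithmic distances into distances.\<close>

proposition orbits_with_same_word_close:
  assumes w: "w \<in> Sig'" and e: "0 < e"
  shows "\<exists>N. \<forall>l m p q r s. orbit b w l m p q \<longrightarrow> orbit b w l m r s \<longrightarrow> l \<le> - int N \<longrightarrow> int N \<le> m \<longrightarrow>
     \<bar>p 0 - r 0\<bar> \<le> e \<and> \<bar>q 0 - s 0\<bar> \<le> e"
proof -
  have w: "w \<in> Sig" "\<not> alternating_on {0..} w" "\<not> alternating_on {..0} w" using w by (auto simp: Sig'_def)
  let ?w = "\<lambda>k. w (- k)"
  have rw: "?w \<in> Sig" "\<not> alternating_on {0..} ?w" "\<not> alternating_on {..0} ?w"
    using w Sig_reverse alternating_on_reverse[of w] alternating_on_reverse[of ?w] by auto
  obtain N0 M where M: "0 \<le> N0" "0 < M" "\<And>l m p q. orbit b w l m p q \<Longrightarrow> l \<le> - N0 \<Longrightarrow> N0 \<le> m \<Longrightarrow> p 0 \<le> M \<and> q 0 \<le> M"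
    using bounds_at_0[OF w] by blast
  have d: "0 < e / M" using e M by simp
  obtain N1 where N1: "0 \<le> N1" "\<And>l m p q r s. orbit b w l m p q \<Longrightarrow> orbit b w l m r s \<Longrightarrow> l \<le> - N1 \<Longrightarrow> N1 \<le> m \<Longrightarrow> ldist (p 0) (r 0) \<le> e / M"
    using ldist_p_small[OF w d] by blast
  obtain N2 where N2: "0 \<le> N2" "\<And>l m p q r s. orbit b ?w l m p q \<Longrightarrow> orbit b ?w l m r s \<Longrightarrow> l \<le> - N2 \<Longrightarrow> N2 \<le> m \<Longrightarrow> ldist (p 0) (r 0) \<le> e / M"
    using ldist_p_small[OF rw d] by blast
  define N where "N = nat (max N0 (max N1 N2))"
  have N: "N0 \<le> int N" "N1 \<le> int N" "N2 \<le> int N" using M(1) by (auto simp: N_def)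
  show ?thesis
  proof (intro exI[of _ N] allI impI)
    fix l m p q r s
    assume o: "orbit b w l m p q" "orbit b w l m r s" and lm: "l \<le> - int N" "int N \<le> m"
    have B: "p 0 \<le> M" "q 0 \<le> M" "r 0 \<le> M" "s 0 \<le> M"
      using M(3)[OF o(1)] M(3)[OF o(2)] M(1) lm N by auto
    have P: "0 < p 0" "0 < q 0" "0 < r 0" "0 < s 0"
      using orbit_posD[OF o(1), of 0] orbit_posD[OF o(2), of 0] M(1) lm N by auto
    have "ldist (p 0) (r 0) \<le> e / M" using N1(2)[OF o] N1(1) lm N by auto
    moreover have "ldist (q 0) (s 0) \<le> e / M"
      using N2(2)[OF orbit_reverse[OF o(1)] orbit_reverse[OF o(2)]] N2(1) lm N by auto
    ultimately have "M * ldist (p 0) (r 0) \<le> M * (e / M)" "M * ldist (q 0) (s 0) \<le> M * (e / M)"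
      using M(2) by (simp_all only: mult_le_cancel_left_pos)
    then show "\<bar>p 0 - r 0\<bar> \<le> e \<and> \<bar>q 0 - s 0\<bar> \<le> e"
      using abs_diff_le_ldist[OF P(1,3) B(1,3)] abs_diff_le_ldist[OF P(2,4) B(2,4)] M by auto
  qed
qed

end

section \<open>Existence of finite orbits\<close>

lemma orbit_extend:
  assumes "orbit b w l m p q" "adm (w (m + 1)) x y" "step b (w m) (w (m + 1)) (p m) (q m) x y"
  shows "orbit b w l (m + 1) (p(m + 1 := x)) (q(m + 1 := y))"
  unfolding orbit_def
proof (intro conjI ballI)
  fix k assume "k \<in> {l..m + 1}"
  then show "adm (w k) ((p(m + 1 := x)) k) ((q(m + 1 := y)) k)"
    using assms(2) orbit_admD[OF assms(1), of k] by (cases "k = m + 1") auto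
next
  fix k assume "k \<in> {l..<m + 1}"
  then show "step b (w k) (w (k + 1)) ((p(m + 1 := x)) k) ((q(m + 1 := y)) k) ((p(m + 1 := x)) (k + 1)) ((q(m + 1 := y)) (k + 1))"
    using assms(3) orbit_stepD[OF assms(1), of k] by (cases "k = m") auto
qed

lemma subpath_between_levels_increasing:
  fixes g :: "real \<Rightarrow> real"
  assumes g: "continuous_on {\<alpha>..\<beta>} g" and ab: "\<alpha> \<le> \<beta>" and cd: "g \<alpha> \<le> c" "c \<le> d" "d \<le> g \<beta>"
  shows "\<exists>\<alpha>' \<beta>'. \<alpha> \<le> \<alpha>' \<and> \<alpha>' \<le> \<beta>' \<and> \<beta>' \<le> \<beta> \<and> g \<alpha>' = c \<and> g \<beta>' = d \<and> (\<forall>t\<in>{\<alpha>'..\<beta>'}. c \<le> g t \<and> g t \<le> d)"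
proof -
  define D where "D = {t \<in> {\<alpha>..\<beta>}. g t = d}"
  have "closed D" unfolding D_def by (rule continuous_closed_preimage_constant[OF g]) simp
  moreover have "bounded D" unfolding D_def by (rule bounded_subset[OF bounded_closed_interval[of \<alpha> \<beta>]]) auto
  ultimately have cD: "compact D" by (simp add: compact_eq_bounded_closed)
  obtain x where "\<alpha> \<le> x" "x \<le> \<beta>" "g x = d"
    using IVT'[of g \<alpha> d \<beta>] g ab cd by auto
  then have "D \<noteq> {}" by (auto simp: D_def)
  from compact_attains_inf[OF cD this]
  obtain v where v: "v \<in> D" "\<And>t. t \<in> D \<Longrightarrow> v \<le> t" by auto
  have v': "\<alpha> \<le> v" "v \<le> \<beta>" "g v = d" using v by (auto simp: D_def)
  have gv: "continuous_on {\<alpha>..v} g" using g v' by (auto intro: continuous_on_subset)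
  have le: "g t \<le> d" if tv: "\<alpha> \<le> t" "t \<le> v" for t
  proof (rule ccontr)
    assume n: "\<not> g t \<le> d"
    have "continuous_on {\<alpha>..t} g" using gv that by (auto intro: continuous_on_subset)
    then obtain x where "\<alpha> \<le> x" "x \<le> t" "g x = d" using IVT'[of g \<alpha> d t] n tv order_trans[OF cd(1,2)] by auto
    moreover have "x \<noteq> t" using calculation n by auto
    ultimately show False using v(2)[of x] that v' by (auto simp: D_def)
  qed
  define C where "C = {t \<in> {\<alpha>..v}. g t = c}"
  have "closed C" unfolding C_def by (rule continuous_closed_preimage_constant[OF gv]) simp
  moreover have "bounded C" unfolding C_def by (rule bounded_subset[OF bounded_closed_interval[of \<alpha> v]]) auto
  ultimately have cC: "compact C" by (simp add: compact_eq_bounded_closed)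
  obtain x where "\<alpha> \<le> x" "x \<le> v" "g x = c"
    using IVT'[of g \<alpha> c v] gv v' cd by auto
  then have "C \<noteq> {}" by (auto simp: C_def)
  from compact_attains_sup[OF cC this]
  obtain u where u: "u \<in> C" "\<And>t. t \<in> C \<Longrightarrow> t \<le> u" by auto
  have u': "\<alpha> \<le> u" "u \<le> v" "g u = c" using u by (auto simp: C_def)
  have ge: "c \<le> g t" if tv: "u \<le> t" "t \<le> v" for t
  proof (rule ccontr)
    assume n: "\<not> c \<le> g t"
    have "continuous_on {t..v} g" using gv that u' by (auto intro: continuous_on_subset)
    then obtain x where "t \<le> x" "x \<le> v" "g x = c" using IVT'[of g t c v] n tv cd v' by auto
    moreover have "x \<noteq> t" using calculation n by auto
    ultimately show False using u(2)[of x] that u' by (auto simp: C_def)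
  qed
  show ?thesis
    by (rule exI[of _ u], rule exI[of _ v]) (use u' v' le ge in auto)
qed

text \<open>The reparametrisation \<open>h\<close> also absorbs a reversal of direction, so that paths crossing downwards
  need no separate treatment.\<close>

lemma subpath_between_levels:
  fixes g :: "real \<Rightarrow> real"
  assumes g: "continuous_on {\<alpha>..\<beta>} g" and ab: "\<alpha> \<le> \<beta>" and cd: "c \<le> d"
    and ends: "g \<alpha> \<le> c \<and> d \<le> g \<beta> \<or> g \<beta> \<le> c \<and> d \<le> g \<alpha>"
  shows "\<exists>(\<alpha>'::real) \<beta>' h. \<alpha>' \<le> \<beta>' \<and> continuous_on {\<alpha>'..\<beta>'} h \<and> h ` {\<alpha>'..\<beta>'} \<subseteq> {\<alpha>..\<beta>} \<and>
    g (h \<alpha>') = c \<and> g (h \<beta>') = d \<and> (\<forall>t\<in>{\<alpha>'..\<beta>'}. c \<le> g (h t) \<and> g (h t) \<le> d)"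
  using ends
proof
  assume "g \<alpha> \<le> c \<and> d \<le> g \<beta>"
  then obtain \<alpha>' \<beta>' where "\<alpha> \<le> \<alpha>'" "\<alpha>' \<le> \<beta>'" "\<beta>' \<le> \<beta>" "g \<alpha>' = c" "g \<beta>' = d" "\<forall>t\<in>{\<alpha>'..\<beta>'}. c \<le> g t \<and> g t \<le> d"
    using subpath_between_levels_increasing[OF g ab] cd by blast
  then show ?thesis
    by (intro exI[of _ \<alpha>'] exI[of _ \<beta>'] exI[of _ "\<lambda>t. t"]) auto
next
  assume e: "g \<beta> \<le> c \<and> d \<le> g \<alpha>"
  have "continuous_on {- \<beta>..- \<alpha>} (\<lambda>t. g (- t))"
    by (rule continuous_on_compose2[OF g]) (auto intro: continuous_intros)
  then obtain \<alpha>' \<beta>' where "- \<beta> \<le> \<alpha>'" "\<alpha>' \<le> \<beta>'" "\<beta>' \<le> - \<alpha>" "g (- \<alpha>') = c" "g (- \<beta>') = d" "\<forall>t\<in>{\<alpha>'..\<beta>'}. c \<le> g (- t) \<and> g (- t) \<le> d"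
    using subpath_between_levels_increasing[of "- \<beta>" "- \<alpha>" "\<lambda>t. g (- t)" c d] ab cd e by auto
  then show ?thesis
    by (intro exI[of _ \<alpha>'] exI[of _ \<beta>'] exI[of _ "uminus"]) (auto intro: continuous_intros)
qed

definition crossing_path :: "real \<Rightarrow> (int \<Rightarrow> nat) \<Rightarrow> int \<Rightarrow> int \<Rightarrow> real \<Rightarrow> real \<Rightarrow> real \<Rightarrow> real \<Rightarrow> real \<Rightarrow>
    (real \<Rightarrow> int \<Rightarrow> real) \<Rightarrow> (real \<Rightarrow> int \<Rightarrow> real) \<Rightarrow> bool" where
  "crossing_path b w l m B c d \<alpha> \<beta> P Q \<longleftrightarrow> \<alpha> \<le> \<beta> \<and>
     continuous_on {\<alpha>..\<beta>} (\<lambda>t. P t m) \<and> continuous_on {\<alpha>..\<beta>} (\<lambda>t. Q t m) \<and> P \<alpha> m = c \<and> P \<beta> m = d \<and>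
     (\<forall>t\<in>{\<alpha>..\<beta>}. orbit b w l m (P t) (Q t) \<and> c \<le> P t m \<and> P t m \<le> d \<and> Q t m \<le> B)"

text \<open>The unstable curve argument: the points at time \<open>m\<close> of orbits with a given word contain paths along which \<open>p\<close>
  runs between any two admissible values while \<open>q\<close> stays bounded. The image of a path crossing \<open>R_i\<close> in this sense
  contains one that crosses \<open>R_j\<close>.\<close>

definition crossed :: "real \<Rightarrow> (int \<Rightarrow> nat) \<Rightarrow> int \<Rightarrow> int \<Rightarrow> real \<Rightarrow> bool" where
  "crossed b w l m B \<longleftrightarrow> (\<forall>c d. (if w m = 0 then 1 else 0) < c \<and> c < d \<longrightarrow>
     (\<exists>\<alpha> \<beta> P Q. crossing_path b w l m B c d \<alpha> \<beta> P Q))"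

lemma crossing_path_extend:
  assumes cr: "crossing_path b w l m B c' d' \<alpha> \<beta> P Q" and cd: "(if w (m + 1) = 0 then 1 else 0) < c" "c < d"
    and cont: "continuous_on {\<alpha>..\<beta>} x" "continuous_on {\<alpha>..\<beta>} y"
    and y: "\<And>t. t \<in> {\<alpha>..\<beta>} \<Longrightarrow> (if w (m + 1) = 0 then 1 else 0) < y t \<and> y t \<le> B'"
    and st: "\<And>t. t \<in> {\<alpha>..\<beta>} \<Longrightarrow> step b (w m) (w (m + 1)) (P t m) (Q t m) (x t) (y t)"
    and ends: "x \<alpha> \<le> c \<and> d \<le> x \<beta> \<or> x \<beta> \<le> c \<and> d \<le> x \<alpha>"
  shows "\<exists>\<alpha> \<beta> P Q. crossing_path b w l (m + 1) B' c d \<alpha> \<beta> P Q"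
proof -
  have c: "\<alpha> \<le> \<beta>" "\<And>t. t \<in> {\<alpha>..\<beta>} \<Longrightarrow> orbit b w l m (P t) (Q t)"
    using cr by (auto simp: crossing_path_def)
  obtain \<alpha>' \<beta>' :: real and h where h: "\<alpha>' \<le> \<beta>'" "continuous_on {\<alpha>'..\<beta>'} h" "h ` {\<alpha>'..\<beta>'} \<subseteq> {\<alpha>..\<beta>}"
    "x (h \<alpha>') = c" "x (h \<beta>') = d" "\<forall>t\<in>{\<alpha>'..\<beta>'}. c \<le> x (h t) \<and> x (h t) \<le> d"
    using subpath_between_levels[OF cont(1) c(1) less_imp_le[OF cd(2)] ends]
    by auto
  have hin: "h t \<in> {\<alpha>..\<beta>}" if "t \<in> {\<alpha>'..\<beta>'}" for t using h(3) that by blast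
  let ?P = "\<lambda>t. (P (h t))(m + 1 := x (h t))" and ?Q = "\<lambda>t. (Q (h t))(m + 1 := y (h t))"
  have "crossing_path b w l (m + 1) B' c d \<alpha>' \<beta>' ?P ?Q"
    unfolding crossing_path_def
  proof (intro conjI ballI)
    show "continuous_on {\<alpha>'..\<beta>'} (\<lambda>t. ?P t (m + 1))" "continuous_on {\<alpha>'..\<beta>'} (\<lambda>t. ?Q t (m + 1))"
      using continuous_on_compose2[OF cont(1) h(2,3)] continuous_on_compose2[OF cont(2) h(2,3)] by auto
    fix t assume t: "t \<in> {\<alpha>'..\<beta>'}"
    note ht = hin[OF t]
    have "adm (w (m + 1)) (x (h t)) (y (h t))"
      using y[OF ht] cd bspec[OF h(6) t] by (auto simp: adm_def)
    then show "orbit b w l (m + 1) (?P t) (?Q t)" by (rule orbit_extend[OF c(2)[OF ht] _ st[OF ht]])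
  qed (use h hin y in auto)
  then show ?thesis by blast
qed

context
  fixes b :: real
  assumes b: "1 < b"
begin

lemma step_forward_00:
  assumes "1 < p" "p < b" "0 < q"
  shows "step b 0 0 p q (q * (b - p) / (p - 1)) (b + 1 - p)"
proof -
  define x where "x = q * (b - p) / (p - 1)"
  have x: "x * (p - 1) = q * (b - p)" "0 < x" using assms by (auto simp: x_def)
  have "p * (x + q) = x + b * q" "(b + 1 - p) * (x + q) = q + b * x" using x by (simp_all add: algebra_simps)
  then show ?thesis unfolding x_def[symmetric] step_def gen_def using x assms
    by (simp add: eq_divide_eq add.commute)
qed

lemma step_forward_01:
  assumes "b + 1 < p"
  shows "step b 0 1 p q (p - b - 1) (q * (p - b) / (p - 1))"
  by (simp add: step_def gen_def)

lemma step_forward_10: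
  assumes "0 < q"
  shows "step b 1 0 p q (p * (q + b) / (q + 1)) (q + b + 1)"
  using assms b by (simp add: step_def gen_def)

lemma crossed_extend:
  assumes w: "w \<in> Sig" and l: "l \<le> m" and cr: "crossed b w l m B"
  shows "crossed b w l (m + 1) (b + max B 0 + 1)"
  unfolding crossed_def
proof (intro allI impI)
  fix c d :: real
  assume cd: "(if w (m + 1) = 0 then 1 else 0) < c \<and> c < d"
  consider "w m = 0" "w (m+1) = 0" | "w m = 0" "w (m+1) = 1" | "w m = 1" "w (m+1) = 0"
    using Sig_digit[OF w, of m] Sig_digit[OF w, of "m+1"] Sig_not_11[OF w, of m] by argo
  then show "\<exists>\<alpha> \<beta> P Q. crossing_path b w l (m + 1) (b + max B 0 + 1) c d \<alpha> \<beta> P Q"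
  proof cases
    case 1
    define B1 where "B1 = max B 1"
    have c: "1 < c" "c < d" using cd 1 by auto
    \<comment> \<open>chosen so that the new \<open>p\<close> is at least \<open>d\<close> at \<open>c'\<close> and at most \<open>c\<close> at \<open>d'\<close>, for every \<open>q\<close> between \<open>1\<close> and \<open>B1\<close>\<close>
    define c' where "c' = 1 + (b - 1) / (d + 1)"
    define d' where "d' = 1 + (b - 1) * B1 / (c + B1)"
    have B1: "1 \<le> B1" by (simp add: B1_def)
    have "b - c' = (b - 1) * d / (d + 1)" "c' - 1 = (b - 1) / (d + 1)"
      using c by (auto simp: c'_def field_simps)
    then have c': "1 < c'" "(b - c') / (c' - 1) = d"
      using b c by (auto simp: c'_def)
    have "b - d' = (b - 1) * c / (c + B1)" "d' - 1 = (b - 1) * B1 / (c + B1)"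
      using c B1 by (auto simp: d'_def field_simps)
    moreover have "0 < (b - 1) * c / (c + B1)" using b c B1 by simp
    ultimately have "0 < b - d'" "B1 * (b - d') / (d' - 1) = c"
      using b c B1 by auto
    then have d': "d' < b" "B1 * (b - d') / (d' - 1) = c" by auto
    have "1 * d \<le> B1 * d" using B1 c by (intro mult_right_mono) auto
    then have "c < B1 * d" using c by linarith
    then have "1 / (d + 1) < B1 / (c + B1)"
      using B1 c by (simp add: divide_simps algebra_simps)
    then have "(b - 1) * (1 / (d + 1)) < (b - 1) * (B1 / (c + B1))" using b by (intro mult_strict_left_mono) auto
    then have cd': "c' < d'" by (simp add: c'_def d'_def)
    obtain \<alpha> \<beta> P Q where cp: "crossing_path b w l m B c' d' \<alpha> \<beta> P Q"
      using cr[unfolded crossed_def, rule_format, of c' d'] c' cd' 1 by auto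
    have o: "\<And>t. t \<in> {\<alpha>..\<beta>} \<Longrightarrow> orbit b w l m (P t) (Q t)" and ab: "\<alpha> \<le> \<beta>"
      and P: "\<And>t. t \<in> {\<alpha>..\<beta>} \<Longrightarrow> c' \<le> P t m \<and> P t m \<le> d'" "P \<alpha> m = c'" "P \<beta> m = d'"
      and QB: "\<And>t. t \<in> {\<alpha>..\<beta>} \<Longrightarrow> Q t m \<le> B"
      and cont: "continuous_on {\<alpha>..\<beta>} (\<lambda>t. P t m)" "continuous_on {\<alpha>..\<beta>} (\<lambda>t. Q t m)"
      using cp by (auto simp: crossing_path_def)
    have Q1: "1 < Q t m" if "t \<in> {\<alpha>..\<beta>}" for t
      using orbit_admD[OF o[OF that], of m] l 1 by (simp add: adm_def)
    have P1: "1 < P t m" "P t m < b" if "t \<in> {\<alpha>..\<beta>}" for t using P(1)[OF that] c' d' by auto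
    show ?thesis
    proof (rule crossing_path_extend[OF cp, where x = "\<lambda>t. Q t m * (b - P t m) / (P t m - 1)" and y = "\<lambda>t. b + 1 - P t m"])
      show "continuous_on {\<alpha>..\<beta>} (\<lambda>t. Q t m * (b - P t m) / (P t m - 1))"
        using P1 by (intro continuous_intros cont) force
      show "continuous_on {\<alpha>..\<beta>} (\<lambda>t. b + 1 - P t m)" by (intro continuous_intros cont)
      show "step b (w m) (w (m + 1)) (P t m) (Q t m) (Q t m * (b - P t m) / (P t m - 1)) (b + 1 - P t m)" if "t \<in> {\<alpha>..\<beta>}" for t
        using step_forward_00[of "P t m" "Q t m"] P1[OF that] Q1[OF that] 1 by simp
      have e: "\<alpha> \<in> {\<alpha>..\<beta>}" "\<beta> \<in> {\<alpha>..\<beta>}" using ab by auto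
      have "d \<le> Q \<alpha> m * (b - P \<alpha> m) / (P \<alpha> m - 1)"
      proof -
        have "1 * d \<le> Q \<alpha> m * d"
          using Q1[OF e(1)] c by (intro mult_right_mono) auto
        moreover have "Q \<alpha> m * (b - P \<alpha> m) / (P \<alpha> m - 1) = Q \<alpha> m * d"
          unfolding P(2) c'(2)[symmetric] by simp
        ultimately show ?thesis by simp
      qed
      moreover have "Q \<beta> m * (b - P \<beta> m) / (P \<beta> m - 1) \<le> c"
      proof -
        have "Q \<beta> m * (b - d') / (d' - 1) \<le> B1 * (b - d') / (d' - 1)"
          using QB[OF e(2)] d' c' cd' by (intro divide_right_mono mult_right_mono) (auto simp: B1_def)
        then show ?thesis unfolding P(3) d'(2) .
      qed
      ultimately show "Q \<alpha> m * (b - P \<alpha> m) / (P \<alpha> m - 1) \<le> c \<and> d \<le> Q \<beta> m * (b - P \<beta> m) / (P \<beta> m - 1) \<or>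
         Q \<beta> m * (b - P \<beta> m) / (P \<beta> m - 1) \<le> c \<and> d \<le> Q \<alpha> m * (b - P \<alpha> m) / (P \<alpha> m - 1)" by simp
      show "(if w (m + 1) = 0 then 1 else 0) < b + 1 - P t m \<and> b + 1 - P t m \<le> b + max B 0 + 1" if "t \<in> {\<alpha>..\<beta>}" for t
        using P1[OF that] 1 by simp
    qed (use cd in auto)
  next
    case 2
    obtain \<alpha> \<beta> P Q where cp: "crossing_path b w l m B (c + b + 1) (d + b + 1) \<alpha> \<beta> P Q"
      using cr[unfolded crossed_def, rule_format, of "c + b + 1" "d + b + 1"] cd b 2 by auto
    have o: "\<And>t. t \<in> {\<alpha>..\<beta>} \<Longrightarrow> orbit b w l m (P t) (Q t)" and ab: "\<alpha> \<le> \<beta>"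
      and P: "\<And>t. t \<in> {\<alpha>..\<beta>} \<Longrightarrow> c + b + 1 \<le> P t m" "P \<alpha> m = c + b + 1" "P \<beta> m = d + b + 1"
      and QB: "\<And>t. t \<in> {\<alpha>..\<beta>} \<Longrightarrow> Q t m \<le> B"
      and cont: "continuous_on {\<alpha>..\<beta>} (\<lambda>t. P t m)" "continuous_on {\<alpha>..\<beta>} (\<lambda>t. Q t m)"
      using cp by (auto simp: crossing_path_def)
    have Q1: "1 < Q t m" if "t \<in> {\<alpha>..\<beta>}" for t
      using orbit_admD[OF o[OF that], of m] l 2 by (simp add: adm_def)
    have P1: "b + 1 < P t m" if "t \<in> {\<alpha>..\<beta>}" for t using P(1)[OF that] cd 2 by auto
    show ?thesis
    proof (rule crossing_path_extend[OF cp, where x = "\<lambda>t. P t m - b - 1" and y = "\<lambda>t. Q t m * (P t m - b) / (P t m - 1)"])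
      show "continuous_on {\<alpha>..\<beta>} (\<lambda>t. Q t m * (P t m - b) / (P t m - 1))"
        using P1 b by (intro continuous_intros cont) force
      show "continuous_on {\<alpha>..\<beta>} (\<lambda>t. P t m - b - 1)" by (intro continuous_intros cont)
      show "step b (w m) (w (m + 1)) (P t m) (Q t m) (P t m - b - 1) (Q t m * (P t m - b) / (P t m - 1))" if "t \<in> {\<alpha>..\<beta>}" for t
        using step_forward_01[of "P t m" "Q t m"] P1[OF that] 2 by simp
      show "P \<alpha> m - b - 1 \<le> c \<and> d \<le> P \<beta> m - b - 1 \<or> P \<beta> m - b - 1 \<le> c \<and> d \<le> P \<alpha> m - b - 1" using P by simp
      show "(if w (m + 1) = 0 then 1 else 0) < Q t m * (P t m - b) / (P t m - 1) \<and> Q t m * (P t m - b) / (P t m - 1) \<le> b + max B 0 + 1" if "t \<in> {\<alpha>..\<beta>}" for t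
      proof -
        have "Q t m * ((P t m - b) / (P t m - 1)) \<le> Q t m * 1"
          using Q1[OF that] P1[OF that] b by (intro mult_left_mono) auto
        then show ?thesis using QB[OF that] Q1[OF that] P1[OF that] b 2 by simp
      qed
    qed (use cd in auto)
  next
    case 3
    have c: "0 < c / b" "c / b < d" "1 < c" "c < d"
    proof -
      show c: "1 < c" "c < d" using cd 3 by auto
      show "0 < c / b" using b c by simp
      have "c / b \<le> c / 1" using b c by (intro divide_left_mono) auto
      then show "c / b < d" using c by simp
    qed
    obtain \<alpha> \<beta> P Q where cp: "crossing_path b w l m B (c / b) d \<alpha> \<beta> P Q"
      using cr[unfolded crossed_def, rule_format, of "c / b" d] c 3 by auto
    have o: "\<And>t. t \<in> {\<alpha>..\<beta>} \<Longrightarrow> orbit b w l m (P t) (Q t)" and ab: "\<alpha> \<le> \<beta>"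
      and P: "\<And>t. t \<in> {\<alpha>..\<beta>} \<Longrightarrow> c / b \<le> P t m" "P \<alpha> m = c / b" "P \<beta> m = d"
      and QB: "\<And>t. t \<in> {\<alpha>..\<beta>} \<Longrightarrow> Q t m \<le> B"
      and cont: "continuous_on {\<alpha>..\<beta>} (\<lambda>t. P t m)" "continuous_on {\<alpha>..\<beta>} (\<lambda>t. Q t m)"
      using cp by (auto simp: crossing_path_def)
    have Q1: "0 < Q t m" if "t \<in> {\<alpha>..\<beta>}" for t
      using orbit_admD[OF o[OF that], of m] l 3 by (simp add: adm_def)
    show ?thesis
    proof (rule crossing_path_extend[OF cp, where x = "\<lambda>t. P t m * (Q t m + b) / (Q t m + 1)" and y = "\<lambda>t. Q t m + b + 1"])
      show "continuous_on {\<alpha>..\<beta>} (\<lambda>t. P t m * (Q t m + b) / (Q t m + 1))"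
        using Q1 by (intro continuous_intros cont) force
      show "continuous_on {\<alpha>..\<beta>} (\<lambda>t. Q t m + b + 1)" by (intro continuous_intros cont)
      show "step b (w m) (w (m + 1)) (P t m) (Q t m) (P t m * (Q t m + b) / (Q t m + 1)) (Q t m + b + 1)" if "t \<in> {\<alpha>..\<beta>}" for t
        using step_forward_10[of "Q t m" "P t m"] Q1[OF that] 3 by simp
      have e: "\<alpha> \<in> {\<alpha>..\<beta>}" "\<beta> \<in> {\<alpha>..\<beta>}" using ab by auto
      have "c / b * ((Q \<alpha> m + b) / (Q \<alpha> m + 1)) \<le> c / b * b"
        using Q1[OF e(1)] c b by (intro mult_left_mono) (auto simp: field_simps)
      moreover have "d * 1 \<le> d * ((Q \<beta> m + b) / (Q \<beta> m + 1))"
        using Q1[OF e(2)] c b by (intro mult_left_mono) (auto simp: field_simps)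
      ultimately show "P \<alpha> m * (Q \<alpha> m + b) / (Q \<alpha> m + 1) \<le> c \<and> d \<le> P \<beta> m * (Q \<beta> m + b) / (Q \<beta> m + 1) \<or>
         P \<beta> m * (Q \<beta> m + b) / (Q \<beta> m + 1) \<le> c \<and> d \<le> P \<alpha> m * (Q \<alpha> m + b) / (Q \<alpha> m + 1)" using P b by simp
      show "(if w (m + 1) = 0 then 1 else 0) < Q t m + b + 1 \<and> Q t m + b + 1 \<le> b + max B 0 + 1" if "t \<in> {\<alpha>..\<beta>}" for t
        using Q1[OF that] QB[OF that] b 3 by simp
    qed (use cd in auto)
  qed
qed

lemma crossed_exists:
  assumes w: "w \<in> Sig" and l: "l \<le> m"
  shows "\<exists>B. crossed b w l m B"
  using l
proof (induction m rule: int_ge_induct)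
  case base
  have "crossed b w l l 2" unfolding crossed_def
  proof (intro allI impI)
    fix c d :: real assume "(if w l = 0 then 1 else 0) < c \<and> c < d"
    then have "crossing_path b w l l 2 c d c d (\<lambda>t k. t) (\<lambda>t k. 2)"
      by (auto simp: crossing_path_def orbit_def adm_def split: if_splits)
    then show "\<exists>\<alpha> \<beta> P Q. crossing_path b w l l 2 c d \<alpha> \<beta> P Q" by blast
  qed
  then show ?case by blast
next
  case (step i)
  then show ?case using crossed_extend[OF w] by blast
qed

proposition orbit_exists:
  assumes "w \<in> Sig" "l \<le> m"
  shows "\<exists>p q. orbit b w l m p q"
proof -
  obtain B where "crossed b w l m B" using crossed_exists[OF assms] by blast
  from this[unfolded crossed_def, rule_format, of 2 3]
  obtain \<alpha> \<beta> P Q where "crossing_path b w l m B 2 3 \<alpha> \<beta> P Q" by fastforce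
  then show ?thesis unfolding crossing_path_def by (metis atLeastAtMost_iff order_refl)
qed

end

section \<open>The word is locally constant on the plane\<close>

context
  fixes b :: real
  assumes b: "1 < b"
begin

lemma step_00_solved:
  assumes "step b 0 0 p q p' q'" "0 < q" "0 < p'"
  shows "p' = q * (b - p) / (p - 1)" "q' = b + 1 - p"
proof -
  have s: "0 < p' + q" using assms by simp
  have "p * (p' + q) = p' + b * q" using assms s by (simp add: step_def gen_def)
  then have "p' * (p - 1) = q * (b - p)" by (simp add: algebra_simps)
  moreover have "1 < p" using step_00[OF b assms] by simp
  ultimately show "p' = q * (b - p) / (p - 1)" by (simp add: eq_divide_eq)
  show "q' = b + 1 - p" using step_00[OF b assms] by simp
qed

lemma step_01_solved:
  assumes "step b 0 1 p q p' q'"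
  shows "p' = p - b - 1" "q' = q * (p - b) / (p - 1)"
  using assms by (auto simp: step_def gen_def)

lemma step_10_solved:
  assumes "step b 1 0 p q p' q'" "0 < q"
  shows "p' = p * (q + b) / (q + 1)" "q' = q + b + 1"
  using assms b by (auto simp: step_def gen_def)

text \<open>Along a family of orbits whose points converge, the digits stabilise one after another. The dichotomy in the hypothesis
  and the conclusion is needed because \<open>f\<close> collapses the line \<open>x = 1\<close> to a point at infinity: if \<open>p\<close> tends to
  \<open>1\<close> at a block \<open>00\<close>, the next \<open>p\<close> tends to infinity. From then on \<open>p\<close> keeps tending to infinity, and the
  digits are forced to alternate.\<close>

lemma itinerary_eventually_determined_step:
  assumes ev: "\<forall>\<^sub>F i in F. W i \<in> Sig \<and> orbit b (W i) k (k + 1) (P i) (Q i) \<and> W i k = s"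
    and tends: "filterlim (\<lambda>i. P i k) at_top F \<or> (\<exists>x y. ((\<lambda>i. P i k) \<longlongrightarrow> x) F \<and> ((\<lambda>i. Q i k) \<longlongrightarrow> y) F)"
  shows "\<exists>s'. (\<forall>\<^sub>F i in F. W i (k + 1) = s') \<and>
    (filterlim (\<lambda>i. P i (k+1)) at_top F \<or> (\<exists>x y. ((\<lambda>i. P i (k+1)) \<longlongrightarrow> x) F \<and> ((\<lambda>i. Q i (k+1)) \<longlongrightarrow> y) F))"
proof -
  have *: "step b (W i k) (W i (k+1)) (P i k) (Q i k) (P i (k+1)) (Q i (k+1))"
      "0 < P i k" "0 < Q i k" "0 < P i (k+1)" "0 < Q i (k+1)" "adm (W i k) (P i k) (Q i k)"
      "adm (W i (k+1)) (P i (k+1)) (Q i (k+1))"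
      "W i k = 0 \<or> W i k = 1" "W i (k+1) = 0 \<or> W i (k+1) = 1" "W i k = 1 \<Longrightarrow> W i (k+1) = 0"
    if "W i \<in> Sig \<and> orbit b (W i) k (k + 1) (P i) (Q i) \<and> W i k = s" for i
    using that orbit_stepD[of b "W i" k "k+1" "P i" "Q i" k] orbit_posD[of b "W i" k "k+1" "P i" "Q i" k]
      orbit_posD[of b "W i" k "k+1" "P i" "Q i" "k+1"] orbit_admD[of b "W i" k "k+1" "P i" "Q i" k]
      orbit_admD[of b "W i" k "k+1" "P i" "Q i" "k+1"] Sig_digit[of "W i" k] Sig_digit[of "W i" "k+1"]
      Sig_not_11[of "W i" k] by auto
  show ?thesis
  proof (cases "s = 0")
    case s: False
    have ev': "\<forall>\<^sub>F i in F. W i (k+1) = 0 \<and> P i (k+1) = P i k * (Q i k + b) / (Q i k + 1) \<and> Q i (k+1) = Q i k + b + 1 \<and> 0 < P i k \<and> 0 < Q i k"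
      using ev
    proof eventually_elim
      case (elim i)
      note f = *[OF elim]
      have "W i k = 1" using f(8) elim s by auto
      moreover have "W i (k+1) = 0" using f(10) calculation by simp
      ultimately show ?case using step_10_solved[of "P i k" "Q i k" "P i (k+1)" "Q i (k+1)"] f by simp
    qed
    have "filterlim (\<lambda>i. P i (k+1)) at_top F \<or> (\<exists>x y. ((\<lambda>i. P i (k+1)) \<longlongrightarrow> x) F \<and> ((\<lambda>i. Q i (k+1)) \<longlongrightarrow> y) F)"
      using tends
    proof
      assume inf: "filterlim (\<lambda>i. P i k) at_top F"
      have "\<forall>\<^sub>F i in F. P i k \<le> P i (k+1)" using ev'
      proof eventually_elim
        case (elim i)
        have "P i k * 1 \<le> P i k * ((Q i k + b) / (Q i k + 1))" using elim b by (intro mult_left_mono) auto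
        then show ?case using elim by simp
      qed
      then have "filterlim (\<lambda>i. P i (k+1)) at_top F" by (rule filterlim_at_top_mono[OF inf])
      then show ?thesis by blast
    next
      assume "\<exists>x y. ((\<lambda>i. P i k) \<longlongrightarrow> x) F \<and> ((\<lambda>i. Q i k) \<longlongrightarrow> y) F"
      then obtain x y where xy: "((\<lambda>i. P i k) \<longlongrightarrow> x) F" "((\<lambda>i. Q i k) \<longlongrightarrow> y) F" by blast
      show ?thesis
      proof (cases "F = bot")
        case False
        have y: "0 \<le> y"
          by (rule tendsto_lowerbound[OF xy(2) _ False]) (use ev' in \<open>auto elim: eventually_mono\<close>)
        have "((\<lambda>i. P i k * (Q i k + b) / (Q i k + 1)) \<longlongrightarrow> x * (y + b) / (y + 1)) F"
          using y by (intro tendsto_intros xy) auto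
        then have "((\<lambda>i. P i (k+1)) \<longlongrightarrow> x * (y + b) / (y + 1)) F"
          by (rule Lim_transform_eventually) (use ev' in \<open>auto elim: eventually_mono\<close>)
        moreover have "((\<lambda>i. Q i k + b + 1) \<longlongrightarrow> y + b + 1) F" by (intro tendsto_intros xy)
        then have "((\<lambda>i. Q i (k+1)) \<longlongrightarrow> y + b + 1) F"
          by (rule Lim_transform_eventually) (use ev' in \<open>auto elim: eventually_mono\<close>)
        ultimately show ?thesis by blast
      qed auto
    qed
    moreover have "\<forall>\<^sub>F i in F. W i (k+1) = 0" using ev' by eventually_elim auto
    ultimately show ?thesis by blast
  next
    case s: True
    have low: "\<forall>\<^sub>F i in F. W i (k+1) = 0 \<longrightarrow> 1 < P i k \<and> P i k < b \<and> 1 < Q i k \<and>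
        P i (k+1) = Q i k * (b - P i k) / (P i k - 1) \<and> Q i (k+1) = b + 1 - P i k"
      using ev
    proof (eventually_elim, intro impI)
      fix i assume e: "W i \<in> Sig \<and> orbit b (W i) k (k + 1) (P i) (Q i) \<and> W i k = s" and z: "W i (k+1) = 0"
      note f = *[OF e]
      have "step b 0 0 (P i k) (Q i k) (P i (k+1)) (Q i (k+1))" using f(1) e z s by simp
      then show "1 < P i k \<and> P i k < b \<and> 1 < Q i k \<and>
        P i (k+1) = Q i k * (b - P i k) / (P i k - 1) \<and> Q i (k+1) = b + 1 - P i k"
        using step_00_solved step_00[OF b] f e s by (simp add: adm_def)
    qed
    have high: "\<forall>\<^sub>F i in F. W i (k+1) \<noteq> 0 \<longrightarrow> W i (k+1) = 1 \<and> b + 1 < P i k \<and>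
        P i (k+1) = P i k - b - 1 \<and> Q i (k+1) = Q i k * (P i k - b) / (P i k - 1)"
      using ev
    proof (eventually_elim, intro impI)
      fix i assume e: "W i \<in> Sig \<and> orbit b (W i) k (k + 1) (P i) (Q i) \<and> W i k = s" and z: "W i (k+1) \<noteq> 0"
      note f = *[OF e]
      have w1: "W i (k+1) = 1" using f(9) z by simp
      have "step b 0 1 (P i k) (Q i k) (P i (k+1)) (Q i (k+1))" using f(1) e w1 s by simp
      from step_01_solved[OF this] show "W i (k+1) = 1 \<and> b + 1 < P i k \<and>
        P i (k+1) = P i k - b - 1 \<and> Q i (k+1) = Q i k * (P i k - b) / (P i k - 1)"
        using f(4) w1 by simp
    qed
    \<comment> \<open>the values of \<open>p\<close> that lead to the digit 0 lie below \<open>b\<close>, those that lead to 1 above \<open>b + 1\<close>\<close>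
    consider (inf) "filterlim (\<lambda>i. P i k) at_top F"
      | (small) x y where "((\<lambda>i. P i k) \<longlongrightarrow> x) F" "((\<lambda>i. Q i k) \<longlongrightarrow> y) F" "x < b + 1"
      | (large) x y where "((\<lambda>i. P i k) \<longlongrightarrow> x) F" "((\<lambda>i. Q i k) \<longlongrightarrow> y) F" "b + 1 \<le> x"
      using tends by (meson not_less)
    then show ?thesis
    proof cases
      case inf
      have "\<forall>\<^sub>F i in F. b < P i k" using inf by (simp add: filterlim_at_top_dense)
      with low high have ev': "\<forall>\<^sub>F i in F. W i (k+1) = 1 \<and> P i (k+1) = P i k - b - 1"
        by eventually_elim auto
      have "filterlim (\<lambda>i. - (b + 1) + P i k) at_top F"
        by (rule filterlim_tendsto_add_at_top[OF tendsto_const inf])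
      then have "filterlim (\<lambda>i. P i (k+1)) at_top F"
        by (rule filterlim_at_top_mono) (use ev' in \<open>auto elim: eventually_mono\<close>)
      moreover have "\<forall>\<^sub>F i in F. W i (k+1) = 1" using ev' by eventually_elim auto
      ultimately show ?thesis by blast
    next
      case large
      have "\<forall>\<^sub>F i in F. b < P i k" using order_tendstoD(1)[OF large(1), of b] large(3) by simp
      with low high have ev': "\<forall>\<^sub>F i in F. W i (k+1) = 1 \<and> P i (k+1) = P i k - b - 1 \<and> Q i (k+1) = Q i k * (P i k - b) / (P i k - 1)"
        by eventually_elim auto
      have "((\<lambda>i. P i k - b - 1) \<longlongrightarrow> x - b - 1) F" by (intro tendsto_intros large)
      then have "((\<lambda>i. P i (k+1)) \<longlongrightarrow> x - b - 1) F"
        by (rule Lim_transform_eventually) (use ev' in \<open>auto elim: eventually_mono\<close>)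
      moreover have "((\<lambda>i. Q i k * (P i k - b) / (P i k - 1)) \<longlongrightarrow> y * (x - b) / (x - 1)) F"
        using large(3) b by (intro tendsto_intros large) auto
      then have "((\<lambda>i. Q i (k+1)) \<longlongrightarrow> y * (x - b) / (x - 1)) F"
        by (rule Lim_transform_eventually) (use ev' in \<open>auto elim: eventually_mono\<close>)
      moreover have "\<forall>\<^sub>F i in F. W i (k+1) = 1" using ev' by eventually_elim auto
      ultimately show ?thesis by blast
    next
      case small
      have "\<forall>\<^sub>F i in F. P i k < b + 1" using order_tendstoD(2)[OF small(1) small(3)] by simp
      with low high have ev': "\<forall>\<^sub>F i in F. W i (k+1) = 0 \<and> 1 < P i k \<and> P i k < b \<and> 1 < Q i k \<and>
         P i (k+1) = Q i k * (b - P i k) / (P i k - 1) \<and> Q i (k+1) = b + 1 - P i k"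
        by eventually_elim auto
      have "filterlim (\<lambda>i. P i (k+1)) at_top F \<or> (\<exists>x y. ((\<lambda>i. P i (k+1)) \<longlongrightarrow> x) F \<and> ((\<lambda>i. Q i (k+1)) \<longlongrightarrow> y) F)"
      proof (cases "1 < x")
        case True
        have "((\<lambda>i. Q i k * (b - P i k) / (P i k - 1)) \<longlongrightarrow> y * (b - x) / (x - 1)) F"
          using True by (intro tendsto_intros small) auto
        then have "((\<lambda>i. P i (k+1)) \<longlongrightarrow> y * (b - x) / (x - 1)) F"
          by (rule Lim_transform_eventually) (use ev' in \<open>auto elim: eventually_mono\<close>)
        moreover have "((\<lambda>i. b + 1 - P i k) \<longlongrightarrow> b + 1 - x) F" by (intro tendsto_intros small)
        then have "((\<lambda>i. Q i (k+1)) \<longlongrightarrow> b + 1 - x) F"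
          by (rule Lim_transform_eventually) (use ev' in \<open>auto elim: eventually_mono\<close>)
        ultimately show ?thesis by blast
      next
        case False
        \<comment> \<open>as \<open>p\<close> exceeds \<open>1\<close>, the orbits approach the line \<open>x = 1\<close> that \<open>f\<close> collapses\<close>
        have "filterlim (\<lambda>i. P i (k+1)) at_top F"
          unfolding filterlim_at_top_gt[where c = 0]
        proof (intro allI impI)
          fix Z :: real assume Z: "0 < Z"
          define r where "r = 1 + (b - 1) / (Z + 1)"
          have "0 < (b - 1) / (Z + 1)" using b Z by simp
          then have "x < r" using False by (simp add: r_def)
          then have "\<forall>\<^sub>F i in F. P i k < r" using order_tendstoD(2)[OF small(1)] by simp
          with ev' show "\<forall>\<^sub>F i in F. Z \<le> P i (k+1)"
          proof eventually_elim
            case (elim i)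
            have "(P i k - 1) * (Z + 1) \<le> b - 1" using elim Z by (simp add: r_def field_simps)
            then have "Z * (P i k - 1) \<le> b - P i k" by (simp add: algebra_simps)
            then have "Z \<le> 1 * ((b - P i k) / (P i k - 1))" using elim by (simp add: le_divide_eq)
            also have "\<dots> \<le> Q i k * ((b - P i k) / (P i k - 1))" using elim by (intro mult_right_mono) auto
            finally show ?case using elim by simp
          qed
        qed
        then show ?thesis by blast
      qed
      moreover have "\<forall>\<^sub>F i in F. W i (k+1) = 0" using ev' by eventually_elim auto
      ultimately show ?thesis by blast
    qed
  qed
qed

lemma itinerary_eventually_determined_future:
  assumes ev: "\<forall>\<^sub>F i in F. W i \<in> Sig \<and> orbit b (W i) 0 (int n) (P i) (Q i) \<and> W i 0 = s"
    and tends: "((\<lambda>i. P i 0) \<longlongrightarrow> x) F" "((\<lambda>i. Q i 0) \<longlongrightarrow> y) F"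
  shows "\<exists>s'. \<forall>\<^sub>F i in F. W i (int n) = s'"
proof -
  have "\<exists>s'. (\<forall>\<^sub>F i in F. W i (int j) = s') \<and>
    (filterlim (\<lambda>i. P i (int j)) at_top F \<or> (\<exists>x y. ((\<lambda>i. P i (int j)) \<longlongrightarrow> x) F \<and> ((\<lambda>i. Q i (int j)) \<longlongrightarrow> y) F))" if "j \<le> n" for j
    using that
  proof (induction j)
    case 0
    have "\<forall>\<^sub>F i in F. W i (int 0) = s" using ev by eventually_elim auto
    then show ?case using tends by auto
  next
    case (Suc j)
    then obtain s' where s': "\<forall>\<^sub>F i in F. W i (int j) = s'"
      and t: "filterlim (\<lambda>i. P i (int j)) at_top F \<or> (\<exists>x y. ((\<lambda>i. P i (int j)) \<longlongrightarrow> x) F \<and> ((\<lambda>i. Q i (int j)) \<longlongrightarrow> y) F)"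
      by auto
    have "\<forall>\<^sub>F i in F. W i \<in> Sig \<and> orbit b (W i) (int j) (int j + 1) (P i) (Q i) \<and> W i (int j) = s'"
      using ev s'
    proof eventually_elim
      case (elim i)
      then show ?case using orbit_subset[of b "W i" 0 "int n" "P i" "Q i" "int j" "int j + 1"] Suc(2) by auto
    qed
    from itinerary_eventually_determined_step[OF this t] show ?case by (simp add: add.commute)
  qed
  then show ?thesis by blast
qed

lemma itinerary_eventually_determined:
  fixes j :: int
  assumes ev: "\<forall>\<^sub>F i in F. W i \<in> Sig \<and> orbit b (W i) (- \<bar>j\<bar>) \<bar>j\<bar> (P i) (Q i)"
    and tends: "((\<lambda>i. chart (W i 0) (P i 0) (Q i 0)) \<longlongrightarrow> z) F"
  shows "\<exists>s. \<forall>\<^sub>F i in F. W i j = s"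
proof -
  have t: "((\<lambda>i. fst (chart (W i 0) (P i 0) (Q i 0))) \<longlongrightarrow> fst z) F"
    "((\<lambda>i. snd (chart (W i 0) (P i 0) (Q i 0))) \<longlongrightarrow> snd z) F"
    using tends by (auto intro: tendsto_fst tendsto_snd)
  have e: "\<forall>\<^sub>F i in F. (W i 0 = 0 \<longrightarrow> 1 < fst (chart (W i 0) (P i 0) (Q i 0))) \<and>
      (W i 0 \<noteq> 0 \<longrightarrow> W i 0 = 1 \<and> fst (chart (W i 0) (P i 0) (Q i 0)) < 0)"
    using ev
  proof eventually_elim
    case (elim i)
    then show ?case
      using orbit_admD[of b "W i" "- \<bar>j\<bar>" "\<bar>j\<bar>" "P i" "Q i" 0] Sig_digit[of "W i" 0]
      by (auto simp: chart_def adm_def)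
  qed
  have "\<exists>s\<in>{0,1}. \<forall>\<^sub>F i in F. W i 0 = s"
  proof (cases "fst z < 1")
    case True
    then have "\<forall>\<^sub>F i in F. fst (chart (W i 0) (P i 0) (Q i 0)) < 1" using order_tendstoD(2)[OF t(1)] by simp
    with e have "\<forall>\<^sub>F i in F. W i 0 = 1" by eventually_elim force
    then show ?thesis by blast
  next
    case False
    then have "\<forall>\<^sub>F i in F. fst (chart (W i 0) (P i 0) (Q i 0)) > 0" using order_tendstoD(1)[OF t(1)] by simp
    with e have "\<forall>\<^sub>F i in F. W i 0 = 0" by eventually_elim force
    then show ?thesis by blast
  qed
  then obtain s where s: "s \<in> {0,1}" "\<forall>\<^sub>F i in F. W i 0 = s" by blast
  have "(\<exists>x. ((\<lambda>i. P i 0) \<longlongrightarrow> x) F) \<and> (\<exists>y. ((\<lambda>i. Q i 0) \<longlongrightarrow> y) F)"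
  proof (cases "s = 0")
    case True
    have "((\<lambda>i. P i 0) \<longlongrightarrow> fst z) F"
      by (rule Lim_transform_eventually[OF t(1)]) (use s(2) True in \<open>auto simp: chart_def elim!: eventually_mono\<close>)
    moreover have "((\<lambda>i. Q i 0) \<longlongrightarrow> - snd z) F"
      by (rule Lim_transform_eventually[OF tendsto_minus[OF t(2)]]) (use s(2) True in \<open>auto simp: chart_def elim!: eventually_mono\<close>)
    ultimately show ?thesis by blast
  next
    case False
    have "((\<lambda>i. P i 0) \<longlongrightarrow> snd z) F"
      by (rule Lim_transform_eventually[OF t(2)]) (use s(2) False in \<open>auto simp: chart_def elim!: eventually_mono\<close>)
    moreover have "((\<lambda>i. Q i 0) \<longlongrightarrow> - fst z) F"
      by (rule Lim_transform_eventually[OF tendsto_minus[OF t(1)]]) (use s(2) False in \<open>auto simp: chart_def elim!: eventually_mono\<close>)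
    ultimately show ?thesis by blast
  qed
  then obtain x y where xy: "((\<lambda>i. P i 0) \<longlongrightarrow> x) F" "((\<lambda>i. Q i 0) \<longlongrightarrow> y) F" by blast
  define n where "n = nat \<bar>j\<bar>"
  show ?thesis
  proof (cases "0 \<le> j")
    case True
    have "\<forall>\<^sub>F i in F. W i \<in> Sig \<and> orbit b (W i) 0 (int n) (P i) (Q i) \<and> W i 0 = s"
      using ev s(2) by eventually_elim (auto simp: n_def intro: orbit_subset)
    from itinerary_eventually_determined_future[OF this xy] show ?thesis using True by (simp add: n_def)
  next
    case False
    have "\<forall>\<^sub>F i in F. (\<lambda>k. W i (- k)) \<in> Sig \<and> orbit b (\<lambda>k. W i (- k)) 0 (int n) (\<lambda>k. Q i (- k)) (\<lambda>k. P i (- k)) \<and> W i (- 0) = s"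
      using ev s(2)
    proof eventually_elim
      case (elim i)
      then show ?case
        using orbit_subset[OF orbit_reverse[of b "W i" "- \<bar>j\<bar>" "\<bar>j\<bar>" "P i" "Q i"], of 0 "int n"] Sig_reverse
        by (auto simp: n_def)
    qed
    from itinerary_eventually_determined_future[OF this] xy show ?thesis using False by (simp add: n_def)
  qed
qed

text \<open>The filter below consists of all orbits whose point at time \<open>0\<close> tends to \<open>z\<close>, with arbitrary words. Stabilisation
  along it is local constancy of the digit at \<open>j\<close>.\<close>

proposition itinerary_locally_constant:
  "\<exists>e>0. \<exists>s. \<forall>w p q. w \<in> Sig \<longrightarrow> orbit b w (- \<bar>j\<bar>) \<bar>j\<bar> p q \<longrightarrow> dist (chart (w 0) (p 0) (q 0)) z < e \<longrightarrow> w j = s"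
proof -
  define A where "A = {(w, p, q). w \<in> Sig \<and> orbit b w (- \<bar>j\<bar>) \<bar>j\<bar> p q}"
  define f where "f i = chart (fst i 0) (fst (snd i) 0) (snd (snd i) 0)"
    for i :: "(int \<Rightarrow> nat) \<times> (int \<Rightarrow> real) \<times> (int \<Rightarrow> real)"
  define F where "F = inf (filtercomap f (nhds z)) (principal A)"
  have "\<exists>s. \<forall>\<^sub>F i in F. fst i j = s"
  proof (rule itinerary_eventually_determined)
    show "\<forall>\<^sub>F i in F. fst i \<in> Sig \<and> orbit b (fst i) (- \<bar>j\<bar>) \<bar>j\<bar> (fst (snd i)) (snd (snd i))"
      unfolding F_def eventually_inf_principal by (rule always_eventually) (auto simp: A_def)
    have "filterlim f (nhds z) F"
      unfolding F_def by (rule filterlim_mono[OF filterlim_filtercomap order_refl inf_le1])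
    then show "((\<lambda>i. chart (fst i 0) (fst (snd i) 0) (snd (snd i) 0)) \<longlongrightarrow> z) F"
      by (simp add: f_def[abs_def])
  qed
  then obtain s where "\<forall>\<^sub>F i in filtercomap f (nhds z). i \<in> A \<longrightarrow> fst i j = s"
    unfolding F_def eventually_inf_principal by blast
  then obtain R where R: "eventually R (nhds z)" "\<And>i. R (f i) \<Longrightarrow> i \<in> A \<Longrightarrow> fst i j = s"
    unfolding eventually_filtercomap by blast
  obtain e where e: "0 < e" "\<And>x. dist x z < e \<Longrightarrow> R x" using R(1) unfolding eventually_nhds_metric by blast
  show ?thesis
  proof (intro exI[of _ e] conjI exI[of _ s] allI impI)
    fix w p q assume "w \<in> Sig" "orbit b w (- \<bar>j\<bar>) \<bar>j\<bar> p q" "dist (chart (w 0) (p 0) (q 0)) z < e"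
    then show "w j = s" using R(2)[of "(w, p, q)"] e(2) by (auto simp: A_def f_def)
  qed (rule e(1))
qed

end

section \<open>Blocks on the torus are finite orbits\<close>

definition emb :: "real \<times> real \<Rightarrow> pt" where
  "emb z = (Some (fst z), Some (snd z))"

lemma emb_eq_iff [simp]: "emb z = emb z' \<longleftrightarrow> z = z'"
  by (simp add: emb_def prod_eq_iff)

lemma f_ext_finite: "x \<noteq> 1 \<Longrightarrow> f_ext a (Some x, Some y) = (Some (y * ((x + a) / (x - 1))), Some (x + a - 1))"
  by (simp add: f_ext_def indet_f_def)

lemma finv_ext_finite: "y \<noteq> - 1 \<Longrightarrow> finv_ext a (Some x, Some y) = (Some (y + 1 - a), Some (x * ((y - a) / (y + 1))))"
  by (simp add: finv_ext_def indet_finv_def)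

text \<open>Every neighbourhood of \<open>\<infinity>\<close> meets the unbounded complement of \<open>A\<close>, so \<open>\<infinity>\<close> is not
  an interior point.\<close>

lemma interior_circle_insert_infinity:
  assumes "\<not> bounded (- A)"
  shows "circle interior_of insert None (Some ` A) = Some ` interior (A :: real set)"
proof
  show "Some ` interior A \<subseteq> circle interior_of insert None (Some ` A)"
  proof (rule interior_of_maximal)
    show "Some ` interior A \<subseteq> insert None (Some ` A)" using interior_subset by blast
    show "openin circle (Some ` interior A)" unfolding openin_circle using open_interior by blast
  qed
  show "circle interior_of insert None (Some ` A) \<subseteq> Some ` interior A"
  proof
    fix u assume "u \<in> circle interior_of insert None (Some ` A)"
    then obtain V where V: "openin circle V" "V \<subseteq> insert None (Some ` A)" "u \<in> V"
      unfolding interior_of_def by blast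
    have sub: "{x. Some x \<in> V} \<subseteq> A" using V(2) by auto
    have "None \<notin> V"
    proof
      assume "None \<in> V"
      from openin_circleD2[OF V(1) this] have "bounded {x. Some x \<notin> V}" by (rule compact_imp_bounded)
      moreover have "- A \<subseteq> {x. Some x \<notin> V}" using sub by auto
      ultimately show False using assms bounded_subset by blast
    qed
    then obtain x where x: "u = Some x" using V(3) by (cases u) auto
    then have "x \<in> interior A"
      using interiorI[OF openin_circleD1[OF V(1)] _ sub, of x] V(3) by simp
    then show "u \<in> Some ` interior A" using x by blast
  qed
qed

lemma not_bounded_half_lines: "\<not> bounded {..<c :: real}" "\<not> bounded {c :: real<..}"
proof -
  show "\<not> bounded {..<c}"
  proof
    assume "bounded {..<c}"
    then obtain B where "\<And>x. x < c \<Longrightarrow> \<bar>x\<bar> \<le> B" unfolding bounded_iff by auto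
    from this[of "min (c - 1) (- \<bar>B\<bar> - 1)"] show False by linarith
  qed
  show "\<not> bounded {c<..}"
  proof
    assume "bounded {c<..}"
    then obtain B where "\<And>x. c < x \<Longrightarrow> \<bar>x\<bar> \<le> B" unfolding bounded_iff by auto
    from this[of "max (c + 1) (\<bar>B\<bar> + 1)"] show False by linarith
  qed
qed

lemma interior_half_line_atLeast: "circle interior_of insert None (Some ` {c..}) = Some ` {c<..}"
proof -
  have "- {c..} = {..<c}" by auto
  then show ?thesis
    by (subst interior_circle_insert_infinity) (simp_all add: not_bounded_half_lines interior_real_atLeast)
qed

lemma interior_half_line_atMost: "circle interior_of insert None (Some ` {..c}) = Some ` {..<c}"
proof -
  have "- {..c} = {c<..}" by auto
  then show ?thesis
    by (subst interior_circle_insert_infinity) (simp_all add: not_bounded_half_lines interior_real_atMost)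
qed

lemma interior_rect:
  "torus interior_of rect i = {emb (chart i p q) | p q. adm i p q}"
proof (cases "i = 0")
  case True
  have "torus interior_of rect i = Some ` {1<..} \<times> Some ` {..<- 1}"
    using True by (simp only: torus_def rect_def if_True if_False simp_thms interior_of_Times
        interior_half_line_atLeast interior_half_line_atMost)
  also have "\<dots> = {emb (chart i p q) | p q. adm i p q}"
  proof (intro equalityI subsetI)
    fix u assume "u \<in> Some ` {1::real<..} \<times> Some ` {..<- 1::real}"
    then obtain x y where "u = (Some x, Some y)" "1 < x" "y < - 1" by auto
    then have "u = emb (chart i x (- y)) \<and> adm i x (- y)" using True by (simp add: emb_def chart_def adm_def)
    then show "u \<in> {emb (chart i p q) | p q. adm i p q}" by blast
  qed (use True in \<open>auto simp: emb_def chart_def adm_def\<close>)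
  finally show ?thesis .
next
  case False
  have "torus interior_of rect i = Some ` {..<0} \<times> Some ` {0<..}"
    using False by (simp only: torus_def rect_def if_True if_False simp_thms interior_of_Times
        interior_half_line_atLeast interior_half_line_atMost)
  also have "\<dots> = {emb (chart i p q) | p q. adm i p q}"
  proof (intro equalityI subsetI)
    fix u assume "u \<in> Some ` {..<0::real} \<times> Some ` {0::real<..}"
    then obtain x y where "u = (Some x, Some y)" "x < 0" "0 < y" by auto
    then have "u = emb (chart i y (- x)) \<and> adm i y (- x)" using False by (simp add: emb_def chart_def adm_def)
    then show "u \<in> {emb (chart i p q) | p q. adm i p q}" by blast
  qed (use False in \<open>auto simp: emb_def chart_def adm_def\<close>)
  finally show ?thesis .
qed

text \<open>Sets that keep the iterates of the extended maps under control. The safe sets are invariant under \<open>f\<^sup>-\<^sup>1\<close>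
  (backward) or \<open>f\<close> (forward) and avoid the indeterminate points, so the unspecified values are never met. The escaped
  sets are invariant too, contain the images of the curves that are collapsed, and miss the interiors of both rectangles; an orbit that comes
  back to a rectangle has therefore never been in them.\<close>

definition backward_safe :: "pt set" where
  "backward_safe = {(Some x, Some y) | x y. \<not> (x \<le> 0 \<and> y \<le> - 1)} \<union> {(Some c, None) | c. 0 < c} \<union> {(None, Some c) | c. 0 < c}"

definition backward_escaped :: "pt set" where
  "backward_escaped = {(Some x, Some y) | x y. 1 \<le> x \<and> 0 \<le> y} \<union> {(Some c, None) | c. 0 < c} \<union> {(None, Some c) | c. 0 < c}"

definition forward_safe :: "pt set" where
  "forward_safe = {(Some x, Some y) | x y. \<not> (1 \<le> x \<and> 0 \<le> y)} \<union> {(Some c, None) | c. c < 0} \<union> {(None, Some c) | c. c < 0}"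

definition forward_escaped :: "pt set" where
  "forward_escaped = {(Some x, Some y) | x y. x \<le> 0 \<and> y \<le> - 1} \<union> {(Some c, None) | c. c < 0} \<union> {(None, Some c) | c. c < 0}"

text \<open>If \<open>g\<close> inverts \<open>h\<close> except where \<open>h\<close> leads into a trap \<open>E\<close>, then \<open>g\<close> retraces every orbit
  that ends outside \<open>E\<close>.\<close>

lemma funpow_left_inverse_at:
  assumes G: "\<And>p. p \<in> G \<Longrightarrow> h p \<in> G" and E: "\<And>p. p \<in> E \<Longrightarrow> h p \<in> E"
    and inv: "\<And>p. p \<in> G \<Longrightarrow> h p \<notin> E \<Longrightarrow> g (h p) = p"
    and z: "z \<in> G" "(h ^^ n) z \<notin> E"
  shows "(g ^^ n) ((h ^^ n) z) = z"
  using z(2)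
proof (induction n)
  case (Suc n)
  have "(h ^^ n) z \<notin> E" using Suc.prems E by auto
  moreover have "(h ^^ n) z \<in> G" using z(1) G by (induction n) auto
  ultimately show ?case using Suc inv[of "(h ^^ n) z"] by (simp add: funpow_swap1)
qed simp

lemma interior_rect_safe:
  "torus interior_of rect i \<subseteq> backward_safe - backward_escaped" "torus interior_of rect i \<subseteq> forward_safe - forward_escaped"
  unfolding interior_rect
  by (auto simp: emb_def chart_def adm_def backward_safe_def backward_escaped_def forward_safe_def forward_escaped_def split: if_splits)

context
  fixes a :: real
  assumes a: "a < - 1"
begin

lemma finv_ext_infinite:
  "finv_ext a (Some c, None) = (None, Some c)"
  "c \<noteq> a \<Longrightarrow> finv_ext a (None, Some c) = (Some (c + 1 - a), None)"
  "x \<noteq> 0 \<Longrightarrow> finv_ext a (Some x, Some (- 1)) = (Some (- a), None)"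
  by (auto simp: finv_ext_def indet_finv_def)

lemma f_ext_infinite:
  "f_ext a (None, Some c) = (Some c, None)"
  "c \<noteq> - a \<Longrightarrow> f_ext a (Some c, None) = (None, Some (c + a - 1))"
  "y \<noteq> 0 \<Longrightarrow> f_ext a (Some 1, Some y) = (None, Some a)"
  by (auto simp: f_ext_def indet_f_def)

lemma finv_ext_backward_safe:
  assumes "p \<in> backward_safe"
  shows "finv_ext a p \<in> backward_safe"
proof -
  consider (fin) x y where "p = (Some x, Some y)" "y \<noteq> - 1" "\<not> (x \<le> 0 \<and> y \<le> - 1)" | (pole) x where "p = (Some x, Some (- 1))" "0 < x"
    | (i1) c where "p = (Some c, None)" "0 < c" | (i2) c where "p = (None, Some c)" "0 < c"
    using assms unfolding backward_safe_def by force
  then show ?thesis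
  proof cases
    case fin
    have "\<not> (y + 1 - a \<le> 0 \<and> x * ((y - a) / (y + 1)) \<le> - 1)"
    proof
      assume h: "y + 1 - a \<le> 0 \<and> x * ((y - a) / (y + 1)) \<le> - 1"
      then have "0 < (y - a) / (y + 1)" using a by (intro divide_neg_neg) auto
      moreover have "0 < x" using fin h a by auto
      ultimately have "0 < x * ((y - a) / (y + 1))" by (intro mult_pos_pos)
      then show False using h by linarith
    qed
    then show ?thesis using fin by (simp add: finv_ext_finite backward_safe_def)
  qed (use a in \<open>auto simp: finv_ext_infinite backward_safe_def\<close>)
qed

lemma finv_ext_backward_escaped:
  assumes "p \<in> backward_escaped"
  shows "finv_ext a p \<in> backward_escaped"
  using assms a unfolding backward_escaped_def
  by (auto simp: finv_ext_finite finv_ext_infinite)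

lemma f_finv_ext:
  assumes "p \<in> backward_safe" "finv_ext a p \<notin> backward_escaped"
  shows "f_ext a (finv_ext a p) = p"
proof -
  have "p \<notin> backward_escaped" using finv_ext_backward_escaped assms(2) by blast
  then obtain x y where p: "p = (Some x, Some y)" "\<not> (x \<le> 0 \<and> y \<le> - 1)"
    using assms(1) unfolding backward_safe_def backward_escaped_def by blast
  have y: "y \<noteq> - 1" using assms(2) p a by (auto simp: finv_ext_infinite backward_escaped_def)
  moreover have "y \<noteq> a" using assms(2) p a by (auto simp: finv_ext_finite backward_escaped_def)
  ultimately show ?thesis using p by (simp add: finv_ext_finite f_ext_finite)
qed

lemma f_ext_forward_safe:
  assumes "p \<in> forward_safe"
  shows "f_ext a p \<in> forward_safe"
proof -
  consider (fin) x y where "p = (Some x, Some y)" "x \<noteq> 1" "\<not> (1 \<le> x \<and> 0 \<le> y)" | (pole) y where "p = (Some 1, Some y)" "y < 0"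
    | (i1) c where "p = (Some c, None)" "c < 0" | (i2) c where "p = (None, Some c)" "c < 0"
    using assms unfolding forward_safe_def by force
  then show ?thesis
  proof cases
    case fin
    have "\<not> (1 \<le> y * ((x + a) / (x - 1)) \<and> 0 \<le> x + a - 1)"
    proof
      assume h: "1 \<le> y * ((x + a) / (x - 1)) \<and> 0 \<le> x + a - 1"
      then have "0 < (x + a) / (x - 1)" using a by (intro divide_pos_pos) auto
      moreover have "y < 0" using fin h a by auto
      ultimately have "y * ((x + a) / (x - 1)) < 0" by (intro mult_neg_pos)
      then show False using h by linarith
    qed
    then show ?thesis using fin by (simp add: f_ext_finite forward_safe_def)
  qed (use a in \<open>auto simp: f_ext_infinite forward_safe_def\<close>)
qed

lemma f_ext_forward_escaped:
  assumes "p \<in> forward_escaped"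
  shows "f_ext a p \<in> forward_escaped"
proof -
  consider (fin) x y where "p = (Some x, Some y)" "x \<le> 0" "y \<le> - 1"
    | (i1) c where "p = (Some c, None)" "c < 0" | (i2) c where "p = (None, Some c)" "c < 0"
    using assms unfolding forward_escaped_def by force
  then show ?thesis
  proof cases
    case fin
    have "0 \<le> (x + a) / (x - 1)" using fin a by (intro divide_nonpos_nonpos) auto
    then have "y * ((x + a) / (x - 1)) \<le> 0" using fin by (intro mult_nonpos_nonneg) auto
    then show ?thesis using fin a by (simp add: f_ext_finite forward_escaped_def)
  qed (use a in \<open>auto simp: f_ext_infinite forward_escaped_def\<close>)
qed

lemma finv_f_ext:
  assumes "p \<in> forward_safe" "f_ext a p \<notin> forward_escaped"
  shows "finv_ext a (f_ext a p) = p"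
proof -
  have "p \<notin> forward_escaped" using f_ext_forward_escaped assms(2) by blast
  then obtain x y where p: "p = (Some x, Some y)" "\<not> (1 \<le> x \<and> 0 \<le> y)"
    using assms(1) unfolding forward_safe_def forward_escaped_def by blast
  have "x \<noteq> 1" using assms(2) p a by (auto simp: f_ext_infinite forward_escaped_def)
  moreover have "x \<noteq> - a" using assms(2) p a by (auto simp: f_ext_finite forward_escaped_def)
  ultimately show ?thesis using p by (simp add: f_ext_finite finv_ext_finite)
qed

text \<open>Blocks are defined by images under the iterates of \<open>f\<^sup>-\<^sup>1\<close> and \<open>f\<close>, which are not injective on the torus.
  For a point that comes from one rectangle and ends in another, the image can be undone.\<close>

lemma f_iter_eqD:
  assumes "z \<in> torus interior_of rect i" "u \<in> torus interior_of rect j" "f_iter a (- k) z = u"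
  shows "z = f_iter a k u"
proof (cases "0 < k")
  case True
  have "(f_ext a ^^ nat k) ((finv_ext a ^^ nat k) z) = z"
    by (rule funpow_left_inverse_at[of backward_safe _ backward_escaped])
      (use assms True interior_rect_safe[of i] interior_rect_safe[of j] finv_ext_backward_safe finv_ext_backward_escaped f_finv_ext
        in \<open>auto simp: f_iter_def\<close>)
  then show ?thesis using assms(3) True by (simp add: f_iter_def)
next
  case False
  have "(finv_ext a ^^ nat (- k)) ((f_ext a ^^ nat (- k)) z) = z"
    by (rule funpow_left_inverse_at[of forward_safe _ forward_escaped])
      (use assms False interior_rect_safe[of i] interior_rect_safe[of j] f_ext_forward_safe f_ext_forward_escaped finv_f_ext
        in \<open>auto simp: f_iter_def\<close>)
  then show ?thesis using assms(3) False by (cases "k = 0") (auto simp: f_iter_def)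
qed

lemma f_ext_step:
  assumes "step (- a) i j p q p' q'" "adm i p q" "adm j p' q'" "i = 0 \<or> i = 1" "j = 0 \<or> j = 1" "i = 1 \<Longrightarrow> j = 0"
  shows "f_ext a (emb (chart i p q)) = emb (chart j p' q')"
proof -
  have b: "1 < - a" using a by simp
  have pos: "0 < p" "0 < q" "0 < p'" "0 < q'" using adm_pos[OF assms(2)] adm_pos[OF assms(3)] by auto
  consider "i = 0" "j = 0" | "i = 0" "j = 1" | "i = 1" "j = 0" using assms by auto
  then show ?thesis
  proof cases
    case 1
    have "1 < p" using assms 1 by (simp add: adm_def)
    then show ?thesis using step_00_solved[OF b, of p q p' q'] assms 1 pos
      by (simp add: emb_def chart_def f_ext_finite field_simps)
  next
    case 2
    have "1 < p" using assms 2 by (simp add: adm_def)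
    then show ?thesis using step_01_solved[OF b, of p q p' q'] assms 2 pos
      by (simp add: emb_def chart_def f_ext_finite field_simps)
  next
    case 3
    have "(- q + a) / (- q - 1) = (- (q + - a)) / (- (q + 1))"
      by (simp only: minus_add_distrib minus_minus diff_conv_add_uminus)
    also have "\<dots> = (q + - a) / (q + 1)" by (simp only: minus_divide_divide)
    finally have r: "(a - q) / (- q - 1) = (q - a) / (q + 1)" by simp
    have e: "p * (a - q) / (- q - 1) = p * (q - a) / (q + 1)"
      unfolding times_divide_eq_right[symmetric] r ..
    show ?thesis using step_10_solved[OF b, of p q p' q'] assms 3 pos
      by (simp add: emb_def chart_def f_ext_finite e)
  qed
qed

lemma finv_ext_step:
  assumes "step (- a) i j p q p' q'" "adm i p q" "adm j p' q'" "i = 0 \<or> i = 1" "j = 0 \<or> j = 1" "i = 1 \<Longrightarrow> j = 0"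
  shows "finv_ext a (emb (chart j p' q')) = emb (chart i p q)"
proof -
  have "emb (chart i p q) \<in> torus interior_of rect i" "emb (chart j p' q') \<in> torus interior_of rect j"
    unfolding interior_rect using assms by auto
  then have "finv_ext a (f_ext a (emb (chart i p q))) = emb (chart i p q)"
    using interior_rect_safe[of i] interior_rect_safe[of j] f_ext_step[OF assms] by (intro finv_f_ext) auto
  then show ?thesis using f_ext_step[OF assms] by simp
qed

lemma step_from_f_ext:
  assumes "f_ext a (emb (chart i p q)) = emb (chart j p' q')" "adm i p q" "adm j p' q'" "i = 0 \<or> i = 1" "j = 0 \<or> j = 1" "i = 1 \<Longrightarrow> j = 0"
  shows "step (- a) i j p q p' q'"
proof -
  have b: "1 < - a" using a by simp
  have pos: "0 < p" "0 < q" "0 < p'" "0 < q'" using adm_pos[OF assms(2)] adm_pos[OF assms(3)] by auto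
  consider "i = 0" "j = 0" | "i = 0" "j = 1" | "i = 1" "j = 0" using assms by auto
  then show ?thesis
  proof cases
    case 1
    have p: "1 < p" "1 < q'" using assms 1 by (auto simp: adm_def)
    then have e: "p' = - q * ((p + a) / (p - 1))" "- q' = p + a - 1"
      using assms(1) 1 by (auto simp: emb_def chart_def f_ext_finite)
    have "step (- a) 0 0 p q (q * (- a - p) / (p - 1)) (- a + 1 - p)"
      by (rule step_forward_00) (use p e pos a in auto)
    moreover have "p' = q * (- a - p) / (p - 1)" "q' = - a + 1 - p"
      using e p by (auto simp: field_simps)
    ultimately show ?thesis using 1 by simp
  next
    case 2
    have p: "1 < p" "0 < p'" using assms 2 by (auto simp: adm_def)
    then have e: "- q' = - q * ((p + a) / (p - 1))" "p' = p + a - 1"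
      using assms(1) 2 by (auto simp: emb_def chart_def f_ext_finite)
    have "step (- a) 0 1 p q (p - (- a) - 1) (q * (p - (- a)) / (p - 1))"
      by (rule step_forward_01) (use p e a in auto)
    moreover have "q' = q * (p - (- a)) / (p - 1)" "p' = p - (- a) - 1"
      using e p by (auto simp: field_simps)
    ultimately show ?thesis using 2 by simp
  next
    case 3
    have "(- q + a) / (- q - 1) = (- (q + - a)) / (- (q + 1))"
      by (simp only: minus_add_distrib minus_minus diff_conv_add_uminus)
    also have "\<dots> = (q + - a) / (q + 1)" by (simp only: minus_divide_divide)
    finally have r: "(a - q) / (- q - 1) = (q - a) / (q + 1)" by simp
    have x: "p * (a - q) / (- q - 1) = p * (q - a) / (q + 1)"
      unfolding times_divide_eq_right[symmetric] r ..
    have e: "p' = p * ((q + - a) / (q + 1))" "- q' = - q + a - 1"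
      using assms(1) 3 pos by (auto simp: emb_def chart_def f_ext_finite x)
    have "step (- a) 1 0 p q (p * (q + - a) / (q + 1)) (q + - a + 1)"
      by (rule step_forward_10) (use pos a in auto)
    moreover have "p' = p * (q + - a) / (q + 1)" "q' = q + - a + 1" using e by auto
    ultimately show ?thesis using 3 by simp
  qed
qed

lemma f_iter_Suc:
  assumes z: "\<And>k. l \<le> k \<Longrightarrow> k \<le> m \<Longrightarrow> \<exists>i. f_iter a k u \<in> torus interior_of rect i" and k: "l \<le> k" "k < m"
  shows "f_ext a (f_iter a k u) = f_iter a (k + 1) u"
proof (cases "0 \<le> k")
  case True
  then show ?thesis by (simp add: f_iter_def nat_add_distrib)
next
  case False
  then have "nat (- k) = Suc (nat (- (k + 1)))" by simp
  then have e: "f_iter a k u = finv_ext a (f_iter a (k + 1) u)" using False by (auto simp: f_iter_def)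
  obtain i j where ij: "f_iter a k u \<in> torus interior_of rect i" "f_iter a (k+1) u \<in> torus interior_of rect j"
    using z[of k] z[of "k+1"] k by auto
  then show ?thesis unfolding e
    using interior_rect_safe[of i] interior_rect_safe[of j] by (intro f_finv_ext) (auto simp flip: e)
qed

text \<open>The passage from the extended maps on the torus to the recursion in positive coordinates.\<close>

proposition block_interior_eq:
  assumes w: "w \<in> Sig"
  shows "(\<Inter>k\<in>{- int n..int m}. f_iter a (- k) ` (torus interior_of rect (w k))) =
    {emb (chart (w 0) (p 0) (q 0)) | p q. orbit (- a) w (- int n) (int m) p q}"
proof (intro equalityI subsetI)
  fix u assume u: "u \<in> (\<Inter>k\<in>{- int n..int m}. f_iter a (- k) ` (torus interior_of rect (w k)))"
  have u0: "u \<in> torus interior_of rect (w 0)" using INT_D[OF u, of 0] by (simp add: f_iter_def)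
  have z: "f_iter a k u \<in> torus interior_of rect (w k)" if "- int n \<le> k" "k \<le> int m" for k
  proof -
    have "u \<in> f_iter a (- k) ` (torus interior_of rect (w k))" using u that by simp
    then obtain z where z: "z \<in> torus interior_of rect (w k)" "f_iter a (- k) z = u" by auto
    show ?thesis using f_iter_eqD[OF z(1) u0 z(2)] z(1) by simp
  qed
  have "\<forall>k. \<exists>pq. - int n \<le> k \<longrightarrow> k \<le> int m \<longrightarrow> f_iter a k u = emb (chart (w k) (fst pq) (snd pq)) \<and> adm (w k) (fst pq) (snd pq)"
    using z unfolding interior_rect by fastforce
  then obtain pq where pq: "\<And>k. - int n \<le> k \<Longrightarrow> k \<le> int m \<Longrightarrow> f_iter a k u = emb (chart (w k) (fst (pq k)) (snd (pq k))) \<and> adm (w k) (fst (pq k)) (snd (pq k))"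
    by metis
  have "orbit (- a) w (- int n) (int m) (\<lambda>k. fst (pq k)) (\<lambda>k. snd (pq k))"
    unfolding orbit_def
  proof (intro conjI ballI)
    fix k assume "k \<in> {- int n..<int m}"
    then have k: "- int n \<le> k" "k < int m" by auto
    have "f_ext a (f_iter a k u) = f_iter a (k + 1) u"
      by (rule f_iter_Suc[of "- int n" "int m"]) (use z k in auto)
    then show "step (- a) (w k) (w (k + 1)) (fst (pq k)) (snd (pq k)) (fst (pq (k + 1))) (snd (pq (k + 1)))"
      using pq[of k] pq[of "k+1"] k Sig_digit[OF w, of k] Sig_digit[OF w, of "k+1"] Sig_not_11[OF w, of k]
      by (intro step_from_f_ext) auto
  qed (use pq in auto)
  moreover have "u = emb (chart (w 0) (fst (pq 0)) (snd (pq 0)))" using pq[of 0] by (simp add: f_iter_def)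
  ultimately show "u \<in> {emb (chart (w 0) (p 0) (q 0)) | p q. orbit (- a) w (- int n) (int m) p q}"
    by (intro CollectI exI[of _ "\<lambda>k. fst (pq k)"] exI[of _ "\<lambda>k. snd (pq k)"] conjI)
next
  fix u assume "u \<in> {emb (chart (w 0) (p 0) (q 0)) | p q. orbit (- a) w (- int n) (int m) p q}"
  then obtain p q where u: "u = emb (chart (w 0) (p 0) (q 0))" and o: "orbit (- a) w (- int n) (int m) p q" by blast
  define Z where "Z k = emb (chart (w k) (p k) (q k))" for k
  have st: "f_ext a (Z k) = Z (k + 1)" "finv_ext a (Z (k + 1)) = Z k" if "- int n \<le> k" "k < int m" for k
    using f_ext_step[OF orbit_stepD[OF o that]] finv_ext_step[OF orbit_stepD[OF o that]]
      orbit_admD[OF o, of k] orbit_admD[OF o, of "k+1"] that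
      Sig_digit[OF w, of k] Sig_digit[OF w, of "k+1"] Sig_not_11[OF w, of k] unfolding Z_def by auto
  have backward: "(finv_ext a ^^ j) (Z (int j)) = Z 0" if "int j \<le> int m" for j
    using that
  proof (induction j)
    case (Suc j)
    then have "finv_ext a (Z (int j + 1)) = Z (int j)" using st(2)[of "int j"] by simp
    then show ?case using Suc by (simp add: funpow_swap1 add.commute)
  qed simp
  have forward: "(f_ext a ^^ j) (Z (- int j)) = Z 0" if "int j \<le> int n" for j
    using that
  proof (induction j)
    case (Suc j)
    then have "f_ext a (Z (- int (Suc j))) = Z (- int j)" using st(1)[of "- int (Suc j)"] by simp
    then show ?case using Suc by (simp add: funpow_swap1)
  qed simp
  show "u \<in> (\<Inter>k\<in>{- int n..int m}. f_iter a (- k) ` (torus interior_of rect (w k)))"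
  proof
    fix k assume k: "k \<in> {- int n..int m}"
    have "f_iter a (- k) (Z k) = u"
    proof (cases "0 < k")
      case True then show ?thesis using backward[of "nat k"] k u by (simp add: f_iter_def Z_def)
    next
      case False then show ?thesis using forward[of "nat (- k)"] k u by (simp add: f_iter_def Z_def)
    qed
    moreover have "Z k \<in> torus interior_of rect (w k)"
      unfolding interior_rect Z_def using orbit_admD[OF o, of k] k by auto
    ultimately show "u \<in> f_iter a (- k) ` (torus interior_of rect (w k))" by blast
  qed
qed

end

section \<open>The coding map\<close>

definition box_around :: "real \<times> real \<Rightarrow> real \<Rightarrow> pt set" where
  "box_around z e = emb ` {v. \<bar>fst v - fst z\<bar> \<le> e \<and> \<bar>snd v - snd z\<bar> \<le> e}"

lemma closedin_box_around: "closedin torus (box_around z e)"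
proof -
  have seg: "closedin circle (Some ` {c..d :: real})" for c d
  proof -
    have "openin circle (- Some ` {c..d})"
    proof (rule openin_circleI2)
      have "{x. Some x \<notin> - Some ` {c..d}} = {c..d}" by auto
      then show "compact {x. Some x \<notin> - Some ` {c..d}}" by simp
    qed auto
    then show ?thesis unfolding closedin_def topspace_circle by (simp add: Compl_eq_Diff_UNIV)
  qed
  have "box_around z e = Some ` {fst z - e..fst z + e} \<times> Some ` {snd z - e..snd z + e}"
  proof (intro equalityI subsetI)
    fix u assume "u \<in> Some ` {fst z - e..fst z + e} \<times> Some ` {snd z - e..snd z + e}"
    then obtain x y where "u = emb (x, y)" "\<bar>x - fst z\<bar> \<le> e" "\<bar>y - snd z\<bar> \<le> e" by (auto simp: emb_def)
    then show "u \<in> box_around z e" by (auto simp: box_around_def)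
  qed (auto simp: box_around_def emb_def abs_le_iff algebra_simps intro!: imageI)
  then show ?thesis using seg by (simp add: torus_def closedin_prod_Times_iff)
qed

lemma openin_torus_boxes:
  assumes UV: "open U" "open V"
  shows "openin torus (Some ` U \<times> Some ` V)"
proof -
  have "openin circle (Some ` A)" if "open A" for A :: "real set"
    unfolding openin_circle using that by blast
  then show ?thesis using UV by (simp add: torus_def openin_prod_Times_iff)
qed

lemma openin_torus_contains_box:
  assumes "openin torus V" "emb z \<in> V"
  shows "\<exists>e>0. box_around z e \<subseteq> V"
proof -
  obtain A B where AB: "openin circle A" "openin circle B" "Some (fst z) \<in> A" "Some (snd z) \<in> B" "A \<times> B \<subseteq> V"
    using assms(1)[unfolded torus_def openin_prod_topology_alt, rule_format, of "Some (fst z)" "Some (snd z)"]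
      assms(2) by (auto simp: emb_def)
  obtain d where d: "0 < d" "\<And>x. \<bar>x - fst z\<bar> \<le> d \<Longrightarrow> Some x \<in> A"
    using openin_circleD1[OF AB(1), unfolded open_contains_cball, rule_format, of "fst z"] AB(3)
    by (auto simp: subset_iff dist_real_def abs_minus_commute)
  obtain e where e: "0 < e" "\<And>x. \<bar>x - snd z\<bar> \<le> e \<Longrightarrow> Some x \<in> B"
    using openin_circleD1[OF AB(2), unfolded open_contains_cball, rule_format, of "snd z"] AB(4)
    by (auto simp: subset_iff dist_real_def abs_minus_commute)
  have "box_around z (min d e) \<subseteq> V" using AB(5) d(2) e(2) by (auto simp: box_around_def emb_def)
  moreover have "0 < min d e" using d(1) e(1) by simp
  ultimately show ?thesis by blast
qed

context
  fixes a :: real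
  assumes a: "a < - 1"
begin

lemma R_block_eq:
  "w \<in> Sig \<Longrightarrow> R_block a w n m = torus closure_of {emb (chart (w 0) (p 0) (q 0)) | p q. orbit (- a) w (- int n) (int m) p q}"
  unfolding R_block_def using block_interior_eq[OF a] by simp

lemma R_word_nearby_orbit:
  assumes w: "w \<in> Sig" and z: "emb z \<in> R_word a w" and e: "0 < e"
  obtains p q where "orbit (- a) w (- int n) (int m) p q"
    "\<bar>fst (chart (w 0) (p 0) (q 0)) - fst z\<bar> < e" "\<bar>snd (chart (w 0) (p 0) (q 0)) - snd z\<bar> < e"
proof -
  define T where "T = Some ` {fst z - e<..<fst z + e} \<times> Some ` {snd z - e<..<snd z + e}"
  have "openin torus T" unfolding T_def by (intro openin_torus_boxes) auto
  moreover have "emb z \<in> T" using e by (auto simp: T_def emb_def)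
  moreover have "emb z \<in> R_block a w n m" using z by (auto simp: R_word_def)
  ultimately obtain u where u: "u \<in> {emb (chart (w 0) (p 0) (q 0)) | p q. orbit (- a) w (- int n) (int m) p q}" "u \<in> T"
    unfolding R_block_eq[OF w] in_closure_of by blast
  then obtain p q where pq: "u = emb (chart (w 0) (p 0) (q 0))" "orbit (- a) w (- int n) (int m) p q" by blast
  show thesis
    by (rule that[OF pq(2)]) (use u(2) in \<open>auto simp: T_def pq(1) emb_def\<close>)
qed

lemma no_orbit_with_alternating_future:
  assumes w: "w \<in> Sig" and alt: "alternating_on {0..} w" and M: "0 < M"
  shows "\<exists>n. \<forall>l m p q. orbit (- a) w l m p q \<longrightarrow> l \<le> 0 \<longrightarrow> int n \<le> m \<longrightarrow> p 0 \<le> M \<longrightarrow> q 0 \<le> M \<longrightarrow> False"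
proof -
  have b: "1 < - a" using a by simp
  have alt': "w k \<noteq> w (k + 1)" if "0 \<le> k" for k using alt that by (auto simp: alternating_on_def)
  obtain n where n: "\<And>w l m p q k. orbit (- a) w l m p q \<Longrightarrow> l \<le> k \<Longrightarrow> k + 2 * int n \<le> m \<Longrightarrow>
    (\<forall>j. w (k + 2 * int j) = 1 \<and> w (k + 2 * int j + 1) = 0) \<Longrightarrow> p k \<le> M \<Longrightarrow> q k \<le> M \<Longrightarrow> False"
    using long_alternating_block_unbounded[OF b M] by blast
  show ?thesis
  proof (intro exI[of _ "2 * n + 1"] allI impI)
    fix l m p q
    assume o: "orbit (- a) w l m p q" and lm: "l \<le> 0" "int (2 * n + 1) \<le> m" and pq: "p 0 \<le> M" "q 0 \<le> M"
    show False
    proof (cases "w 0 = 1")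
      case True
      have "\<And>j. w (0 + 2 * int j) = 1 \<and> w (0 + 2 * int j + 1) = 0"
        by (rule alternating_future_parity[OF w alt' True])
      then show False using n[OF o lm(1)] lm(2) pq by simp
    next
      case False
      then have w01: "w 0 = 0" "w 1 = 1"
        using Sig_digit[OF w, of 0] Sig_digit[OF w, of 1] alt'[of 0] by auto
      have par: "\<And>j. w (1 + 2 * int j) = 1 \<and> w (1 + 2 * int j + 1) = 0"
        by (rule alternating_future_parity[OF w alt' w01(2)]) simp
      have st: "step (- a) 0 1 (p 0) (q 0) (p 1) (q 1)" using orbit_stepD[OF o, of 0] lm w01 by simp
      have pos: "0 < q 0" "0 < p 1" using orbit_posD[OF o, of 0] orbit_posD[OF o, of 1] lm by auto
      have e: "p 0 = p 1 + - a + 1" "q 1 = q 0 * ((p 1 + 1) / (p 1 + - a))"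
        using st by (auto simp: step_def gen_def)
      have "q 0 * ((p 1 + 1) / (p 1 + - a)) \<le> q 0 * 1" using pos b by (intro mult_left_mono) auto
      then have "q 1 \<le> M" "p 1 \<le> M" using e pq b by auto
      then show False using n[OF o _ _, of 1] par lm by simp
    qed
  qed
qed

text \<open>Points of \<open>R_word a w\<close> are limits of points of orbits with longer and longer blocks of \<open>w\<close>. If the limit is finite,
  these orbits are bounded at time \<open>0\<close>, which excludes alternating halves of \<open>w\<close>.\<close>

lemma R_word_meets_plane_imp_Sig':
  assumes w: "w \<in> Sig" and z: "emb z \<in> R_word a w"
  shows "w \<in> Sig'"
proof -
  define M where "M = \<bar>fst z\<bar> + \<bar>snd z\<bar> + 1"
  have M: "0 < M" by (simp add: M_def)
  have bd: "\<exists>p q. orbit (- a) w (- int n) (int n) p q \<and> p 0 \<le> M \<and> q 0 \<le> M" for n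
  proof -
    obtain p q where pq: "orbit (- a) w (- int n) (int n) p q"
      "\<bar>fst (chart (w 0) (p 0) (q 0)) - fst z\<bar> < 1" "\<bar>snd (chart (w 0) (p 0) (q 0)) - snd z\<bar> < 1"
      using R_word_nearby_orbit[OF w z zero_less_one] .
    have "p 0 \<le> M \<and> q 0 \<le> M" using pq(2,3) unfolding chart_def M_def by (auto split: if_splits)
    then show ?thesis using pq(1) by blast
  qed
  have "\<not> alternating_on {0..} w"
  proof
    assume "alternating_on {0..} w"
    from no_orbit_with_alternating_future[OF w this M] obtain n where
      n: "\<And>l m p q. orbit (- a) w l m p q \<Longrightarrow> l \<le> 0 \<Longrightarrow> int n \<le> m \<Longrightarrow> p 0 \<le> M \<Longrightarrow> q 0 \<le> M \<Longrightarrow> False" by blast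
    obtain p q where "orbit (- a) w (- int n) (int n) p q" "p 0 \<le> M" "q 0 \<le> M" using bd by blast
    then show False using n[of "- int n" "int n" p q] by simp
  qed
  moreover have "\<not> alternating_on {..0} w"
  proof
    assume "alternating_on {..0} w"
    then have "alternating_on {0..} (\<lambda>k. w (- k))" by (simp add: alternating_on_reverse)
    from no_orbit_with_alternating_future[OF Sig_reverse[OF w] this M] obtain n where
      n: "\<And>l m p q. orbit (- a) (\<lambda>k. w (- k)) l m p q \<Longrightarrow> l \<le> 0 \<Longrightarrow> int n \<le> m \<Longrightarrow> p 0 \<le> M \<Longrightarrow> q 0 \<le> M \<Longrightarrow> False" by blast
    obtain p q where pq: "orbit (- a) w (- int n) (int n) p q" "p 0 \<le> M" "q 0 \<le> M" using bd by blast
    show False using n[OF orbit_reverse[OF pq(1)]] pq by simp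
  qed
  ultimately show ?thesis using w by (simp add: Sig'_def)
qed

lemma digit_locally_constant:
  "\<exists>e>0. \<exists>s. \<forall>w\<in>Sig. \<forall>v. emb v \<in> R_word a w \<longrightarrow> \<bar>fst v - fst z\<bar> < e \<longrightarrow> \<bar>snd v - snd z\<bar> < e \<longrightarrow> w j = s"
proof -
  have b: "1 < - a" using a by simp
  obtain e s where e: "0 < e" and es: "\<And>w p q. w \<in> Sig \<Longrightarrow> orbit (- a) w (- \<bar>j\<bar>) \<bar>j\<bar> p q \<Longrightarrow>
      dist (chart (w 0) (p 0) (q 0)) z < e \<Longrightarrow> w j = s"
    using itinerary_locally_constant[OF b, of j z] by blast
  show ?thesis
  proof (intro exI[of _ "e / 4"] conjI exI[of _ s] ballI allI impI)
    fix w v assume w: "w \<in> Sig" and v: "emb v \<in> R_word a w" "\<bar>fst v - fst z\<bar> < e / 4" "\<bar>snd v - snd z\<bar> < e / 4"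
    have e4: "0 < e / 4" using e by simp
    obtain p q where pq: "orbit (- a) w (- int (nat \<bar>j\<bar>)) (int (nat \<bar>j\<bar>)) p q"
      "\<bar>fst (chart (w 0) (p 0) (q 0)) - fst v\<bar> < e / 4" "\<bar>snd (chart (w 0) (p 0) (q 0)) - snd v\<bar> < e / 4"
      using R_word_nearby_orbit[OF w v(1) e4] .
    let ?c = "chart (w 0) (p 0) (q 0)"
    have "dist ?c z \<le> \<bar>dist (fst ?c) (fst z)\<bar> + \<bar>dist (snd ?c) (snd z)\<bar>"
      unfolding dist_prod_def by (rule sqrt_sum_squares_le_sum_abs)
    also have "\<dots> < e" using v(2,3) pq(2,3) unfolding dist_real_def by linarith
    finally show "w j = s" using es[OF w] pq(1) by simp
  qed (use e in auto)
qed

text \<open>The points at time \<open>0\<close> of orbits with the blocks \<open>w_{-n} ... w_n\<close> form a Cauchy sequence, and its limit is the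
  point of \<open>w\<close>. The second conclusion is continuity of the coding map in the product topology.\<close>

lemma R_word_point:
  assumes w': "w \<in> Sig'"
  obtains z where "R_word a w = {emb z}"
    "\<And>e. 0 < e \<Longrightarrow> \<exists>N. \<forall>w'\<in>Sig. (\<forall>k. \<bar>k\<bar> \<le> int N \<longrightarrow> w' k = w k) \<longrightarrow> R_word a w' \<subseteq> box_around z e"
proof -
  have b: "1 < - a" using a by simp
  have w: "w \<in> Sig" using w' by (simp add: Sig'_def)
  have "\<exists>p q. orbit (- a) w (- int n) (int n) p q" for n by (rule orbit_exists[OF b w]) simp
  then obtain P Q where PQ: "\<And>n. orbit (- a) w (- int n) (int n) (P n) (Q n)" by metis
  define Z where "Z n = chart (w 0) (P n 0) (Q n 0)" for n
  have close: "\<exists>N. \<forall>n\<ge>N. \<forall>l m p q. orbit (- a) w l m p q \<longrightarrow> l \<le> - int N \<longrightarrow> int N \<le> m \<longrightarrow>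
      \<bar>fst (chart (w 0) (p 0) (q 0)) - fst (Z n)\<bar> \<le> e \<and> \<bar>snd (chart (w 0) (p 0) (q 0)) - snd (Z n)\<bar> \<le> e" if e: "0 < e" for e
  proof -
    obtain N where N: "\<And>l m p q r s. orbit (- a) w l m p q \<Longrightarrow> orbit (- a) w l m r s \<Longrightarrow> l \<le> - int N \<Longrightarrow> int N \<le> m \<Longrightarrow>
     \<bar>p 0 - r 0\<bar> \<le> e \<and> \<bar>q 0 - s 0\<bar> \<le> e"
      using orbits_with_same_word_close[OF b w' e] by blast
    show ?thesis
    proof (intro exI[of _ N] allI impI)
      fix n l m p q assume h: "N \<le> n" "orbit (- a) w l m p q" "l \<le> - int N" "int N \<le> m"
      have "\<bar>p 0 - P n 0\<bar> \<le> e \<and> \<bar>q 0 - Q n 0\<bar> \<le> e"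
        by (rule N[of "- int N" "int N"]) (use h in \<open>auto intro: orbit_subset[OF PQ] orbit_subset[OF h(2)]\<close>)
      then show "\<bar>fst (chart (w 0) (p 0) (q 0)) - fst (Z n)\<bar> \<le> e \<and> \<bar>snd (chart (w 0) (p 0) (q 0)) - snd (Z n)\<bar> \<le> e"
        by (auto simp: Z_def chart_def)
    qed
  qed
  have cau: "\<exists>N. \<forall>m\<ge>N. \<forall>n\<ge>N. \<bar>fst (Z m) - fst (Z n)\<bar> < e \<and> \<bar>snd (Z m) - snd (Z n)\<bar> < e" if e: "0 < e" for e
  proof -
    have e2: "0 < e / 2" using e by simp
    obtain N where N: "\<And>n l m p q. N \<le> n \<Longrightarrow> orbit (- a) w l m p q \<Longrightarrow> l \<le> - int N \<Longrightarrow> int N \<le> m \<Longrightarrow>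
      \<bar>fst (chart (w 0) (p 0) (q 0)) - fst (Z n)\<bar> \<le> e / 2 \<and> \<bar>snd (chart (w 0) (p 0) (q 0)) - snd (Z n)\<bar> \<le> e / 2"
      using close[OF e2] by blast
    show ?thesis
    proof (intro exI[of _ N] allI impI)
      fix m n assume "N \<le> m" "N \<le> n"
      then show "\<bar>fst (Z m) - fst (Z n)\<bar> < e \<and> \<bar>snd (Z m) - snd (Z n)\<bar> < e"
        using N[of n "- int m" "int m" "P m" "Q m"] PQ[of m] e unfolding Z_def[of m] by auto
    qed
  qed
  have "Cauchy (\<lambda>n. fst (Z n))" "Cauchy (\<lambda>n. snd (Z n))"
    unfolding Cauchy_def dist_real_def using cau by meson+
  then obtain x y where xy: "(\<lambda>n. fst (Z n)) \<longlonglongrightarrow> x" "(\<lambda>n. snd (Z n)) \<longlonglongrightarrow> y"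
    by (auto simp: Cauchy_convergent_iff convergent_def)
  have box: "\<exists>N. \<forall>w'\<in>Sig. (\<forall>k. \<bar>k\<bar> \<le> int N \<longrightarrow> w' k = w k) \<longrightarrow> R_word a w' \<subseteq> box_around (x, y) e" if e: "0 < e" for e
  proof -
    obtain N where N: "\<And>n l m p q. N \<le> n \<Longrightarrow> orbit (- a) w l m p q \<Longrightarrow> l \<le> - int N \<Longrightarrow> int N \<le> m \<Longrightarrow>
      \<bar>fst (chart (w 0) (p 0) (q 0)) - fst (Z n)\<bar> \<le> e \<and> \<bar>snd (chart (w 0) (p 0) (q 0)) - snd (Z n)\<bar> \<le> e"
      using close[OF e] by blast
    show ?thesis
    proof (intro exI[of _ N] ballI impI)
      fix w' assume ws: "w' \<in> Sig" and eq: "\<forall>k. \<bar>k\<bar> \<le> int N \<longrightarrow> w' k = w k"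
      have "R_word a w' \<subseteq> R_block a w' N N" by (auto simp: R_word_def)
      also have "\<dots> \<subseteq> box_around (x, y) e"
        unfolding R_block_eq[OF ws]
      proof (rule closure_of_minimal[OF subsetI closedin_box_around])
        fix u assume "u \<in> {emb (chart (w' 0) (p 0) (q 0)) | p q. orbit (- a) w' (- int N) (int N) p q}"
        then obtain p q where u: "u = emb (chart (w' 0) (p 0) (q 0))" and o': "orbit (- a) w' (- int N) (int N) p q" by blast
        from o' have o: "orbit (- a) w (- int N) (int N) p q" by (rule orbit_cong) (use eq in auto)
        have near: "\<bar>fst (chart (w 0) (p 0) (q 0)) - fst (Z n)\<bar> \<le> e \<and> \<bar>snd (chart (w 0) (p 0) (q 0)) - snd (Z n)\<bar> \<le> e"
          if "N \<le> n" for n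
          using N[OF that o] by simp
        have lim: "(\<lambda>n. \<bar>fst (chart (w 0) (p 0) (q 0)) - fst (Z n)\<bar>) \<longlonglongrightarrow> \<bar>fst (chart (w 0) (p 0) (q 0)) - x\<bar>"
          "(\<lambda>n. \<bar>snd (chart (w 0) (p 0) (q 0)) - snd (Z n)\<bar>) \<longlonglongrightarrow> \<bar>snd (chart (w 0) (p 0) (q 0)) - y\<bar>"
          by (intro tendsto_intros xy)+
        have "\<bar>fst (chart (w 0) (p 0) (q 0)) - x\<bar> \<le> e"
          by (rule LIMSEQ_le_const2[OF lim(1)], rule exI[of _ N]) (simp add: near)
        moreover have "\<bar>snd (chart (w 0) (p 0) (q 0)) - y\<bar> \<le> e"
          by (rule LIMSEQ_le_const2[OF lim(2)], rule exI[of _ N]) (simp add: near)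
        moreover have "w' 0 = w 0" using eq by simp
        ultimately show "u \<in> box_around (x, y) e" by (simp add: box_around_def u)
      qed
      finally show "R_word a w' \<subseteq> box_around (x, y) e" .
    qed
  qed
  have "R_word a w = {emb (x, y)}"
  proof (intro equalityI subsetI)
    fix u assume u: "u \<in> R_word a w"
    have ub: "u \<in> box_around (x, y) e" if "0 < e" for e using box[OF that] u w by blast
    then obtain v where v: "u = emb v" using zero_less_one unfolding box_around_def by blast
    have le: "\<bar>fst v - x\<bar> \<le> e \<and> \<bar>snd v - y\<bar> \<le> e" if "0 < e" for e
      using ub[OF that] unfolding v box_around_def by auto
    have "\<bar>fst v - x\<bar> \<le> 0" by (rule field_le_epsilon) (simp add: le)
    moreover have "\<bar>snd v - y\<bar> \<le> 0" by (rule field_le_epsilon) (simp add: le)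
    ultimately have "v = (x, y)" by (simp add: prod_eq_iff)
    then show "u \<in> {emb (x, y)}" using v by simp
  next
    fix u assume u: "u \<in> {emb (x, y)}"
    have "emb (x, y) \<in> R_block a w n m" for n m
      unfolding R_block_eq[OF w] in_closure_of
    proof (intro conjI allI impI)
      fix T assume T: "emb (x, y) \<in> T \<and> openin torus T"
      then obtain e where e: "0 < e" "box_around (x, y) e \<subseteq> T" using openin_torus_contains_box by blast
      have "\<forall>\<^sub>F k in sequentially. \<bar>fst (Z k) - x\<bar> < e" "\<forall>\<^sub>F k in sequentially. \<bar>snd (Z k) - y\<bar> < e"
        using tendstoD[OF xy(1) e(1)] tendstoD[OF xy(2) e(1)] by (auto simp: dist_real_def)
      then have "\<forall>\<^sub>F k in sequentially. \<bar>fst (Z k) - x\<bar> < e \<and> \<bar>snd (Z k) - y\<bar> < e \<and> max n m \<le> k"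
        using eventually_ge_at_top[of "max n m"] by eventually_elim auto
      then obtain k where k: "\<bar>fst (Z k) - x\<bar> < e" "\<bar>snd (Z k) - y\<bar> < e" "max n m \<le> k"
        using eventually_happens'[OF sequentially_bot] by blast
      have "emb (Z k) \<in> T" using e(2) k by (auto simp: box_around_def)
      moreover have "orbit (- a) w (- int n) (int m) (P k) (Q k)" by (rule orbit_subset[OF PQ]) (use k in auto)
      ultimately show "\<exists>v. v \<in> {emb (chart (w 0) (p 0) (q 0)) | p q. orbit (- a) w (- int n) (int m) p q} \<and> v \<in> T"
        unfolding Z_def by blast
    qed simp
    then show "u \<in> R_word a w" using u by (simp add: R_word_def)
  qed
  then show thesis using that box by blast
qed

text \<open>Applying \<open>f\<close> up to the first difference of the words is not enough, since the orbit of
  \<open>z\<close> may reach a collapsed line before; local constancy of the digits covers this case.\<close>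

lemma itinerary_unique:
  assumes "w \<in> Sig" "w' \<in> Sig" "emb z \<in> R_word a w" "emb z \<in> R_word a w'"
  shows "w = w'"
proof
  fix j
  obtain e s where "0 < e" and s: "\<forall>w\<in>Sig. \<forall>v. emb v \<in> R_word a w \<longrightarrow> \<bar>fst v - fst z\<bar> < e \<longrightarrow> \<bar>snd v - snd z\<bar> < e \<longrightarrow> w j = s"
    using digit_locally_constant[of z j] by blast
  show "w j = w' j"
    using s[rule_format, OF assms(1,3)] s[rule_format, OF assms(2,4)] \<open>0 < e\<close> by simp
qed

end

theorem theorem8p1:
  fixes a :: real
  assumes "a < - 1"
  shows "(\<forall>w\<in>Sig'. \<exists>p. R_word a w = {p}) \<and>
    homeomorphic_map (subtopology seq_topology Sig') (subtopology torus (Om a \<inter> plane))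
      (\<lambda>w. the_elem (R_word a w))"
proof (rule conjI)
  note R_word_point = R_word_point[OF assms]
    and R_word_meets_plane_imp_Sig' = R_word_meets_plane_imp_Sig'[OF assms]
    and itinerary_unique = itinerary_unique[OF assms]
    and digit_locally_constant = digit_locally_constant[OF assms]
  show single: "\<forall>w\<in>Sig'. \<exists>p. R_word a w = {p}"
  proof
    fix w assume "w \<in> Sig'"
    then obtain z where "R_word a w = {emb z}" by (rule R_word_point)
    then show "\<exists>p. R_word a w = {p}" by blast
  qed
  let ?X = "subtopology seq_topology Sig'" and ?Y = "subtopology torus (Om a \<inter> plane)"
  define h where "h w = the_elem (R_word a w)" for w
  define g where "g u = (SOME w. w \<in> Sig' \<and> u \<in> R_word a w)" for u
  have plane: "u \<in> plane \<longleftrightarrow> (\<exists>z. u = emb z)" for u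
    by (cases u) (auto simp: plane_def emb_def)
  have Sig'_Sig: "w \<in> Sig" if "w \<in> Sig'" for w using that by (simp add: Sig'_def)
  have h: "R_word a w = {h w}" if "w \<in> Sig'" for w
    using single that unfolding h_def by (metis the_elem_eq)
  have hY: "h w \<in> Om a \<inter> plane" if w: "w \<in> Sig'" for w
  proof -
    obtain z where "R_word a w = {emb z}" using w by (rule R_word_point)
    then show ?thesis using h[OF w] Sig'_Sig[OF w] plane unfolding Om_def by auto
  qed
  have g: "g u \<in> Sig'" "h (g u) = u" if u: "u \<in> Om a \<inter> plane" for u
  proof -
    obtain w where w: "w \<in> Sig" "u \<in> R_word a w" using u unfolding Om_def by blast
    moreover obtain z where "u = emb z" using u plane by blast
    ultimately have "w \<in> Sig'" using R_word_meets_plane_imp_Sig' by blast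
    then have "\<exists>w. w \<in> Sig' \<and> u \<in> R_word a w" using w by blast
    then have "g u \<in> Sig' \<and> u \<in> R_word a (g u)" unfolding g_def by (rule someI_ex)
    then show "g u \<in> Sig'" "h (g u) = u" using h by auto
  qed
  have gh: "g (h w) = w" if w: "w \<in> Sig'" for w
  proof -
    obtain z where z: "h w = emb z" using hY[OF w] plane by blast
    show ?thesis
      using itinerary_unique[OF Sig'_Sig[OF g(1)[OF hY[OF w]]] Sig'_Sig[OF w], of z] h[OF g(1)[OF hY[OF w]]] h[OF w] g(2)[OF hY[OF w]] z
      by simp
  qed
  have Sig'_top: "Sig' \<subseteq> topspace seq_topology"
  proof
    fix w assume "w \<in> Sig'"
    then have "w k \<in> {0, 1}" for k using Sig_digit[OF Sig'_Sig, of w k] by simp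
    then show "w \<in> topspace seq_topology" unfolding seq_topology_def by (simp only: topspace_product_topology_alt topspace_discrete_topology) simp
  qed
  have topX: "topspace ?X = Sig'" using Sig'_top by auto
  have topY: "topspace ?Y = Om a \<inter> plane" by simp
  have "continuous_map ?X torus h"
    unfolding continuous_map_def topX
  proof (intro conjI allI impI)
    fix V assume V: "openin torus V"
    show "openin ?X {w \<in> Sig'. h w \<in> V}"
    proof (subst openin_subopen, intro ballI)
      fix w assume w: "w \<in> {w \<in> Sig'. h w \<in> V}"
      then have "w \<in> Sig'" by simp
      then obtain z where z: "R_word a w = {emb z}"
        "\<And>e. 0 < e \<Longrightarrow> \<exists>N. \<forall>w'\<in>Sig. (\<forall>k. \<bar>k\<bar> \<le> int N \<longrightarrow> w' k = w k) \<longrightarrow> R_word a w' \<subseteq> box_around z e"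
        by (rule R_word_point) (rule that)
      have "emb z \<in> V" using z(1) h[of w] w by simp
      then obtain e where e: "0 < e" "box_around z e \<subseteq> V" using openin_torus_contains_box[OF V] by blast
      obtain N where N: "\<And>w'. w' \<in> Sig \<Longrightarrow> (\<forall>k. \<bar>k\<bar> \<le> int N \<longrightarrow> w' k = w k) \<Longrightarrow> R_word a w' \<subseteq> box_around z e"
        using z(2)[OF e(1)] by blast
      define C where "C = PiE UNIV (\<lambda>k. if \<bar>k\<bar> \<le> int N then {w k} else {0, 1})"
      have wd: "w k \<in> {0, 1}" for k using Sig_digit[OF Sig'_Sig, of w k] w by simp
      have "finite {k :: int. \<bar>k\<bar> \<le> int N}"
        by (rule finite_subset[of _ "{- int N..int N}"]) auto
      moreover have "{k. (if \<bar>k\<bar> \<le> int N then {w k} else {0, 1}) \<noteq> {0, 1 :: nat}} \<subseteq> {k. \<bar>k\<bar> \<le> int N}" by auto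
      ultimately have fin: "finite {k. (if \<bar>k\<bar> \<le> int N then {w k} else {0, 1}) \<noteq> {0, 1 :: nat}}"
        using finite_subset by blast
      have "openin seq_topology C"
        unfolding seq_topology_def C_def
        by (rule product_topology_basis) (use wd fin in \<open>auto split: if_splits\<close>)
      then have "openin ?X (C \<inter> Sig')" by (rule openin_subtopology_Int)
      moreover have "w \<in> C \<inter> Sig'" using w wd by (auto simp: C_def)
      moreover have "C \<inter> Sig' \<subseteq> {w \<in> Sig'. h w \<in> V}"
      proof
        fix v assume v: "v \<in> C \<inter> Sig'"
        then have "R_word a v \<subseteq> box_around z e"
          by (intro N) (auto simp: C_def PiE_iff Sig'_Sig split: if_splits)
        then show "v \<in> {w \<in> Sig'. h w \<in> V}" using v h[of v] e(2) by auto
      qed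
      ultimately show "\<exists>T. openin ?X T \<and> w \<in> T \<and> T \<subseteq> {w \<in> Sig'. h w \<in> V}" by blast
    qed
  qed simp
  then have ch: "continuous_map ?X ?Y h"
    using hY topX by (intro continuous_map_into_subtopology) auto
  have "continuous_map ?Y (discrete_topology {0, 1}) (\<lambda>u. g u k)" for k
    unfolding continuous_map_def topY
  proof (intro conjI allI impI)
    show "(\<lambda>u. g u k) \<in> Om a \<inter> plane \<rightarrow> topspace (discrete_topology {0, 1})"
      using Sig_digit[OF Sig'_Sig[OF g(1)]] by (auto simp: Pi_iff)
    fix V :: "nat set" assume "openin (discrete_topology {0, 1}) V"
    show "openin ?Y {u \<in> Om a \<inter> plane. g u k \<in> V}"
    proof (subst openin_subopen, intro ballI)
      fix u assume u: "u \<in> {u \<in> Om a \<inter> plane. g u k \<in> V}"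
      then obtain z where z: "u = emb z" using plane by blast
      obtain e s where e: "0 < e" and s: "\<forall>w\<in>Sig. \<forall>v. emb v \<in> R_word a w \<longrightarrow> \<bar>fst v - fst z\<bar> < e \<longrightarrow> \<bar>snd v - snd z\<bar> < e \<longrightarrow> w k = s"
        using digit_locally_constant[of z k] by blast
      define T where "T = Some ` {fst z - e<..<fst z + e} \<times> Some ` {snd z - e<..<snd z + e}"
      have T: "openin torus T" unfolding T_def by (intro openin_torus_boxes) auto
      have uT: "u \<in> T" using e by (auto simp: T_def z emb_def)
      have dig: "g v k = s" if v: "v \<in> T" "v \<in> Om a \<inter> plane" for v
      proof -
        obtain y where y: "v = emb y" using v plane by blast
        have "\<bar>fst y - fst z\<bar> < e" "\<bar>snd y - snd z\<bar> < e" using v(1) by (auto simp: T_def y emb_def)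
        moreover have "emb y \<in> R_word a (g v)" using h[OF g(1)[OF v(2)]] g(2)[OF v(2)] y by simp
        ultimately show ?thesis using s Sig'_Sig[OF g(1)[OF v(2)]] by blast
      qed
      have "s \<in> V" using dig[OF uT] u by auto
      then have "T \<inter> (Om a \<inter> plane) \<subseteq> {u \<in> Om a \<inter> plane. g u k \<in> V}" using dig by auto
      moreover have "openin ?Y (T \<inter> (Om a \<inter> plane))" using T by (rule openin_subtopology_Int)
      ultimately show "\<exists>T. openin ?Y T \<and> u \<in> T \<and> T \<subseteq> {u \<in> Om a \<inter> plane. g u k \<in> V}"
        using uT u by blast
    qed
  qed
  then have "continuous_map ?Y seq_topology g"
    unfolding seq_topology_def continuous_map_componentwise_UNIV by simp
  then have cg: "continuous_map ?Y ?X g"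
    using g(1) topY by (intro continuous_map_into_subtopology) auto
  have "homeomorphic_maps ?X ?Y h g"
    unfolding homeomorphic_maps_def using ch cg gh g topX topY by auto
  then have "homeomorphic_map ?X ?Y h" unfolding homeomorphic_map_maps by blast
  then show "homeomorphic_map ?X ?Y (\<lambda>w. the_elem (R_word a w))" by (simp add: h_def[abs_def])
qed

end
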